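(* Let $G$ be a class 2 graph with maximum degree $\Delta$, let $r\in V(G)$ be a light $\Delta$-vertex, and let $s\in N_{\Delta-1}(r)$ be such that $rs$ is a critical edge of $G$. For every $x\in V(G)\setminus N[r]$, if $d(x)\le \Delta-3$, then $N(x)\cap N(s)\subseteq N(r)\setminus N_\Delta(r)$.
   Context: All graphs are finite and simple. $\chi'(G)$ is the chromatic index; $G$ is class 2 if $\chi'(G)=\Delta(G)+1$, where $\Delta(G)$ is the maximum degree. $N(v)$ is the set of neighbors of $v$ in $G$, $N[v]=N(v)\cup\{v\}$, $d(v)=|N(v)|$. A $k$-vertex is a vertex of degree $k$ in $G$, and $N_k(v)$ is the set of $k$-vertices in $N(v)$. A vertex is light if it is adjacent to at most two $\Delta(G)$-vertices. An edge $e$ of $G$ is critical if $\chi'(G-e)<\chi'(G)$. *)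

theory Defs
  imports Main
begin

text \<open>
  A graph is a pair of a vertex set \<open>V\<close> and an edge set \<open>E\<close>, an edge being the
  two-element set of its ends. Notions that do not need the isolated vertices take only \<open>E\<close>.
\<close>

definition simple_graph :: "'a set \<Rightarrow> 'a set set \<Rightarrow> bool" where
  "simple_graph V E \<longleftrightarrow> finite V \<and> (\<forall>e\<in>E. e \<subseteq> V \<and> card e = 2)"

definition nbhd :: "'a set set \<Rightarrow> 'a \<Rightarrow> 'a set" where
  "nbhd E v = {u. {u, v} \<in> E}"

definition closed_nbhd :: "'a set set \<Rightarrow> 'a \<Rightarrow> 'a set" where
  "closed_nbhd E v = insert v (nbhd E v)"

definition degree :: "'a set set \<Rightarrow> 'a \<Rightarrow> nat" where
  "degree E v = card (nbhd E v)"

text \<open>Only meaningful for a finite nonempty \<open>V\<close>, as \<open>Max {}\<close> is unspecified.\<close>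

definition max_degree :: "'a set \<Rightarrow> 'a set set \<Rightarrow> nat" where
  "max_degree V E = Max (degree E ` V)"

definition nbhd_deg :: "'a set set \<Rightarrow> nat \<Rightarrow> 'a \<Rightarrow> 'a set" where
  "nbhd_deg E k v = {u \<in> nbhd E v. degree E u = k}"

definition light :: "'a set \<Rightarrow> 'a set set \<Rightarrow> 'a \<Rightarrow> bool" where
  "light V E v \<longleftrightarrow> card (nbhd_deg E (max_degree V E) v) \<le> 2"

definition proper_edge_colouring :: "'a set set \<Rightarrow> nat \<Rightarrow> ('a set \<Rightarrow> nat) \<Rightarrow> bool" where
  "proper_edge_colouring E k c \<longleftrightarrow>
     (\<forall>e\<in>E. c e < k) \<and> (\<forall>e\<in>E. \<forall>f\<in>E. e \<noteq> f \<and> e \<inter> f \<noteq> {} \<longrightarrow> c e \<noteq> c f)"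

definition chromatic_index :: "'a set set \<Rightarrow> nat" where
  "chromatic_index E = (LEAST k. \<exists>c. proper_edge_colouring E k c)"

text \<open>For finite \<open>E\<close> some \<open>k\<close> qualifies, so the \<open>LEAST\<close> above is a genuine minimum.\<close>

lemma proper_edge_colouring_exists:
  assumes "finite E"
  shows "\<exists>k c. proper_edge_colouring E k c"
proof -
  obtain c where c: "bij_betw c E {0..<card E}"
    using ex_bij_betw_finite_nat[OF assms] by blast
  have "c e < card E" if "e \<in> E" for e
    using bij_betwE[OF c] that by auto
  moreover have "c e \<noteq> c f" if "e \<in> E" "f \<in> E" "e \<noteq> f" for e f
    using inj_onD[OF bij_betw_imp_inj_on[OF c]] that by blast
  ultimately have "proper_edge_colouring E (card E) c"
    unfolding proper_edge_colouring_def by blast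
  then show ?thesis by blast
qed

definition class2 :: "'a set \<Rightarrow> 'a set set \<Rightarrow> bool" where
  "class2 V E \<longleftrightarrow> chromatic_index E = max_degree V E + 1"

definition critical_edge :: "'a set set \<Rightarrow> 'a set \<Rightarrow> bool" where
  "critical_edge E e \<longleftrightarrow> e \<in> E \<and> chromatic_index (E - {e}) < chromatic_index E"

end

theory Submission
  imports Defs
begin

text \<open>
  Colour \<open>G - rs\<close> with \<open>\<Delta>\<close> colours; then \<open>r\<close> misses one colour \<open>p\<close>, and \<open>s\<close> misses two colours \<open>a\<close>, \<open>b\<close>.
  Call a colour reachable if it is missing at \<open>s\<close>, or missing at a neighbour of \<open>r\<close> whose edge to \<open>r\<close> has
  a reachable colour. The fan spanned by the reachable colours is elementary, its two halves (starting
  at \<open>a\<close> and at \<open>b\<close>) are disjoint, and each contains a \<open>\<Delta>\<close>-vertex. As \<open>r\<close> is light, there is no other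
  \<open>\<Delta>\<close>-neighbour of \<open>r\<close>; so every chain of edges at \<open>r\<close> with unreachable colours extends until its
  first vertex misses a reachable colour or \<open>p\<close>, or until a missing colour repeats.

  Now let \<open>x\<close> be a vertex not adjacent to \<open>r\<close> that misses three colours, and let \<open>u\<close> be a common neighbour of
  \<open>x\<close> and \<open>s\<close>. Exchanges with \<open>p\<close> permute the reachable colours missing at \<open>x\<close>, and the
  chains at \<open>r\<close> make at least two colours missing at \<open>x\<close> reachable or equal to \<open>p\<close>. So \<open>x\<close> may be assumed
  to miss \<open>a\<close> and \<open>b\<close>. If the colour of \<open>ux\<close> is reachable or \<open>p\<close>, then exchanges at \<open>x\<close> move it to \<open>a\<close>
  while \<open>x\<close> misses \<open>p\<close>, which puts the colour of \<open>su\<close> in the half of \<open>a\<close>; the same with \<open>b\<close> puts it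
  in the half of \<open>b\<close>, a contradiction. A chain ending at the colour of \<open>ux\<close> reduces the remaining case to
  this one or gives the same contradiction directly.
\<close>

section \<open>Kempe exchanges\<close>

text \<open>The obstacle is that \<open>x\<close> lies outside the fan, so elementarity gives no
  hold on the colours missing there. What can be controlled is an exchange of \<open>p\<close> with
  a reachable colour \<open>c\<close>: the component of \<open>r\<close> for these colours is a path
  whose other end is the unique fan vertex missing \<open>c\<close>. If \<open>x\<close> misses
  \<open>p\<close> or \<open>c\<close>, it belongs to another component, and an exchange there
  changes nothing in the fan. Exchanges with an unreachable colour carry no such guarantee; they
  usually need a case distinction on whether the component contains \<open>r\<close>. The number
  three comes from the situation in which a single colour \<open>c\<close> missing at
  \<open>x\<close> is reachable. Chains for two others may then both have heads that miss
  \<open>c\<close>. As a component has only two ends, the heads coincide, and the place where the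
  chains part, or where one of them stops, allows one more exchange. The contradiction is derived
  from any common neighbour \<open>u\<close> of \<open>x\<close> and \<open>s\<close>, so the
  intersection in the theorem is in fact empty.\<close>

definition sw :: "nat \<Rightarrow> nat \<Rightarrow> nat \<Rightarrow> nat" where
  "sw p q k = (if k = p then q else if k = q then p else k)"

lemma sw_simps [simp]: "sw p q p = q" "sw p q q = p" "k \<noteq> p \<Longrightarrow> k \<noteq> q \<Longrightarrow> sw p q k = k"
  and sw_sw [simp]: "sw p q (sw p q k) = k"
  and sw_eq_iff [simp]: "sw p q k = sw p q l \<longleftrightarrow> k = l"
  by (auto simp: sw_def)

text \<open>
  A partial edge colouring is a relation: \<open>ed v w c\<close> says that \<open>vw\<close> is an edge of colour \<open>c\<close>. Deleting,
  adding and recolouring edges then need no bookkeeping of the underlying graph.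
\<close>
type_synonym 'a col = "'a \<Rightarrow> 'a \<Rightarrow> nat \<Rightarrow> bool"

text \<open>Whether an edge is recoloured is decided by its first end alone, so the result is
  symmetric only if \<open>S\<close> is closed under both colours. Allowing any such
  \<open>S\<close> lets a component be given by an explicit list of vertices.\<close>

definition swp :: "'a col \<Rightarrow> nat \<Rightarrow> nat \<Rightarrow> 'a set \<Rightarrow> 'a col" where
  "swp ed p q S v w k = ed v w (if v \<in> S then sw p q k else k)"

definition kcomp :: "'a col \<Rightarrow> nat \<Rightarrow> nat \<Rightarrow> 'a \<Rightarrow> 'a set" where
  "kcomp ed p q v = {w. (\<lambda>a b. ed a b p \<or> ed a b q)\<^sup>*\<^sup>* v w}"

locale kempe =
  fixes n :: nat and V :: "'a set"
  assumes finV: "finite V"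
begin

definition M :: "'a col \<Rightarrow> 'a \<Rightarrow> nat set" where
  "M ed v = {c. c < n \<and> (\<forall>w. \<not> ed v w c)}"

definition pcol :: "'a col \<Rightarrow> bool" where
  "pcol ed \<longleftrightarrow> (\<forall>v w c. ed v w c \<longrightarrow> ed w v c \<and> c < n \<and> v \<in> V \<and> v \<noteq> w) \<and>
     (\<forall>v w c c'. ed v w c \<longrightarrow> ed v w c' \<longrightarrow> c = c') \<and>
     (\<forall>v w w' c. ed v w c \<longrightarrow> ed v w' c \<longrightarrow> w = w')"

lemma pcolI:
  assumes "\<And>v w c. ed v w c \<Longrightarrow> ed w v c \<and> c < n \<and> v \<in> V \<and> v \<noteq> w"
    and "\<And>v w c c'. ed v w c \<Longrightarrow> ed v w c' \<Longrightarrow> c = c'"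
    and "\<And>v w w' c. ed v w c \<Longrightarrow> ed v w' c \<Longrightarrow> w = w'"
  shows "pcol ed"
  unfolding pcol_def using assms by (intro conjI allI impI) auto

lemma pcolD:
  assumes "pcol ed" "ed v w c"
  shows "ed w v c" "c < n" "v \<in> V" "w \<in> V" "v \<noteq> w"
proof -
  have *: "\<And>v w c. ed v w c \<Longrightarrow> ed w v c \<and> c < n \<and> v \<in> V \<and> v \<noteq> w"
    using assms(1) unfolding pcol_def by blast
  show "ed w v c" "c < n" "v \<in> V" "v \<noteq> w" using *[OF assms(2)] by auto
  then show "w \<in> V" using *[of w v c] by auto
qed

lemma pcol_col: "pcol ed \<Longrightarrow> ed v w c \<Longrightarrow> ed v w c' \<Longrightarrow> c = c'"
  and pcol_nbr: "pcol ed \<Longrightarrow> ed v w c \<Longrightarrow> ed v w' c \<Longrightarrow> w = w'"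
  unfolding pcol_def by blast+

lemma M_less: "c \<in> M ed v \<Longrightarrow> c < n" by (simp add: M_def)
lemma M_not: "c \<in> M ed v \<Longrightarrow> \<not> ed v w c" by (simp add: M_def)
lemma finM [simp]: "finite (M ed v)" by (simp add: M_def)
lemma notM: "c < n \<Longrightarrow> c \<notin> M ed v \<Longrightarrow> \<exists>w. ed v w c" by (simp add: M_def)

definition closed :: "'a col \<Rightarrow> nat \<Rightarrow> nat \<Rightarrow> 'a set \<Rightarrow> bool" where
  "closed ed p q S \<longleftrightarrow> (\<forall>v\<in>S. \<forall>w. ed v w p \<or> ed v w q \<longrightarrow> w \<in> S)"

lemma swp_pcol:
  assumes "pcol ed" "p < n" "q < n" "closed ed p q S"
  shows "pcol (swp ed p q S)"
proof -
  have inv: "w \<in> S \<longleftrightarrow> v \<in> S" if "ed v w k" "k = p \<or> k = q" for v w k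
    using that assms(4) pcolD(1)[OF assms(1)] unfolding closed_def by blast
  show ?thesis
  proof (rule pcolI)
    fix v w k assume h: "swp ed p q S v w k"
    let ?k = "if v \<in> S then sw p q k else k"
    have e: "ed v w ?k" using h by (simp add: swp_def)
    note e' = pcolD[OF assms(1) e]
    have "k < n" using e'(2) assms(2,3) by (auto simp: sw_def split: if_splits)
    moreover have "swp ed p q S w v k"
    proof (cases "k = p \<or> k = q")
      case True
      then have "?k = p \<or> ?k = q" by (auto simp: sw_def)
      then have "w \<in> S \<longleftrightarrow> v \<in> S" using inv[OF e] by blast
      then show ?thesis using e'(1) by (simp add: swp_def)
    next
      case False
      then have "?k = k" by simp
      then have "ed w v k" using e'(1) by (rule subst)
      then show ?thesis using False by (simp add: swp_def)
    qed
    ultimately show "swp ed p q S w v k \<and> k < n \<and> v \<in> V \<and> v \<noteq> w" using e'(3,5) by blast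
  next
    fix v w c c' assume "swp ed p q S v w c" "swp ed p q S v w c'"
    then have "(if v \<in> S then sw p q c else c) = (if v \<in> S then sw p q c' else c')"
      unfolding swp_def by (rule pcol_col[OF assms(1)])
    then show "c = c'" by (cases "v \<in> S") simp_all
  next
    fix v w w' c assume "swp ed p q S v w c" "swp ed p q S v w' c"
    then show "w = w'" unfolding swp_def by (rule pcol_nbr[OF assms(1)])
  qed
qed

lemma sw_less: "p < n \<Longrightarrow> q < n \<Longrightarrow> sw p q k < n \<longleftrightarrow> k < n"
  by (auto simp: sw_def)

lemma M_swp:
  assumes "p < n" "q < n"
  shows "c \<in> M (swp ed p q S) v \<longleftrightarrow> (if v \<in> S then sw p q c else c) \<in> M ed v"
  using assms by (auto simp: M_def swp_def sw_less)

section \<open>Kempe components and their ends\<close>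

lemma comp_refl [simp]: "v \<in> kcomp ed p q v" by (simp add: kcomp_def)

lemma comp_closed: "closed ed p q (kcomp ed p q v)"
  unfolding closed_def kcomp_def by (blast intro: rtranclp.rtrancl_into_rtrancl)

lemma comp_min:
  assumes S: "closed ed p q S" "v \<in> S" shows "kcomp ed p q v \<subseteq> S"
proof
  fix w assume "w \<in> kcomp ed p q v"
  then have "(\<lambda>a b. ed a b p \<or> ed a b q)\<^sup>*\<^sup>* v w" by (simp add: kcomp_def)
  then show "w \<in> S"
  proof (induction rule: rtranclp_induct)
    case base
    show ?case by (rule S(2))
  next
    case (step y z)
    then show ?case using S(1) unfolding closed_def by blast
  qed
qed

lemma comp_step: "ed v w p \<or> ed v w q \<Longrightarrow> v \<in> kcomp ed p q z \<Longrightarrow> w \<in> kcomp ed p q z"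
  unfolding kcomp_def mem_Collect_eq by (erule rtranclp.rtrancl_into_rtrancl)

lemma comp_edge:
  assumes "pcol ed" "ed v w p \<or> ed v w q" shows "w \<in> kcomp ed p q z \<longleftrightarrow> v \<in> kcomp ed p q z"
proof
  assume w: "w \<in> kcomp ed p q z"
  have "ed w v p \<or> ed w v q" using assms(2) pcolD(1)[OF assms(1)] by metis
  then show "v \<in> kcomp ed p q z" using w by (rule comp_step)
next
  assume "v \<in> kcomp ed p q z"
  with assms(2) show "w \<in> kcomp ed p q z" by (rule comp_step)
qed

lemma comp_sym:
  assumes "pcol ed" "w \<in> kcomp ed p q v" shows "v \<in> kcomp ed p q w"
proof -
  have "closed ed p q {z. v \<in> kcomp ed p q z}"
    unfolding closed_def
  proof (intro ballI allI impI)
    fix z y assume z: "z \<in> {z. v \<in> kcomp ed p q z}" and e: "ed z y p \<or> ed z y q"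
    have "z \<in> kcomp ed p q y" using comp_edge[OF assms(1) e, of y] by simp
    then have "kcomp ed p q z \<subseteq> kcomp ed p q y" by (rule comp_min[OF comp_closed])
    then show "y \<in> {z. v \<in> kcomp ed p q z}" using z by auto
  qed
  then have "kcomp ed p q v \<subseteq> {z. v \<in> kcomp ed p q z}" by (rule comp_min) simp
  then show ?thesis using assms(2) by blast
qed

lemma comp_eq:
  assumes "pcol ed" "w \<in> kcomp ed p q v" shows "kcomp ed p q w = kcomp ed p q v"
proof
  show "kcomp ed p q w \<subseteq> kcomp ed p q v" by (rule comp_min[OF comp_closed assms(2)])
  show "kcomp ed p q v \<subseteq> kcomp ed p q w" by (rule comp_min[OF comp_closed comp_sym[OF assms]])
qed

text \<open>A Kempe component is a path or a cycle, so at most two of its vertices miss one of the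
  two colours. The proof counts instead of building the path: connectedness gives at least
  \<open>card S - 1\<close> edges, twice the number of edges is
  \<open>card (A p) + card (A q)\<close>, and three deficient vertices would bound this sum by
  \<open>2 * card S - 3\<close>.\<close>

lemma three_ends:
  assumes pc: "pcol ed" and pq: "p \<noteq> q"
    and S: "v1 \<in> kcomp ed p q v" "v2 \<in> kcomp ed p q v" "v3 \<in> kcomp ed p q v"
    and d: "v1 \<noteq> v2" "v1 \<noteq> v3" "v2 \<noteq> v3"
    and m: "p \<in> M ed v1 \<or> q \<in> M ed v1" "p \<in> M ed v2 \<or> q \<in> M ed v2" "p \<in> M ed v3 \<or> q \<in> M ed v3"
  shows False
proof -
  let ?S = "kcomp ed p q v"
  let ?R = "\<lambda>a b. ed a b p \<or> ed a b q"
  have "closed ed p q (V \<union> {v})" using pcolD(4)[OF pc] by (auto simp: closed_def)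
  then have "?S \<subseteq> V \<union> {v}" by (rule comp_min) simp
  then have fS: "finite ?S" by (rule finite_subset) (use finV in simp)
  \<comment> \<open>The distance from \<open>v\<close>. Choosing for each other vertex a predecessor
    at smaller distance yields a spanning tree of the component.\<close>
  define d where "d w = (LEAST k. (?R ^^ k) v w)" for w
  have par: "\<exists>z\<in>?S. ?R z w \<and> d w = Suc (d z)" if w: "w \<in> ?S" "w \<noteq> v" for w
  proof -
    have ex: "\<exists>k. (?R ^^ k) v w" using w(1) by (simp add: kcomp_def rtranclp_power)
    have dw: "(?R ^^ d w) v w" unfolding d_def using LeastI_ex[OF ex] .
    then obtain k where k: "d w = Suc k" using w(2) by (cases "d w") auto
    then obtain z where z: "(?R ^^ k) v z" "?R z w" using dw by auto
    have zS: "z \<in> ?S" using z(1) unfolding kcomp_def by (auto dest: relpowp_imp_rtranclp)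
    have 1: "d z \<le> k" unfolding d_def using z(1) by (rule Least_le)
    have "(?R ^^ d z) v z" unfolding d_def by (rule LeastI[of "\<lambda>k. (?R ^^ k) v z", OF z(1)])
    then have "(?R ^^ Suc (d z)) v w" using z(2) by auto
    then have "d w \<le> Suc (d z)" unfolding d_def[of w] by (rule Least_le)
    then show ?thesis using 1 k z zS by (intro bexI[of _ z]) auto
  qed
  then obtain P where P: "\<And>w. w \<in> ?S \<Longrightarrow> w \<noteq> v \<Longrightarrow> P w \<in> ?S \<and> ?R (P w) w \<and> d w = Suc (d (P w))"
    by metis
  define E where "E k = {{a, b} |a b. a \<in> ?S \<and> ed a b k}" for k
  define A where "A k = {a \<in> ?S. \<exists>b. ed a b k}" for k
  have UE: "\<Union> (E k) = A k" if "k = p \<or> k = q" for k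
  proof (rule set_eqI, rule iffI)
    fix z assume "z \<in> \<Union> (E k)"
    then obtain a b where ab: "a \<in> ?S" "ed a b k" "z = a \<or> z = b" unfolding E_def by blast
    then have "b \<in> ?S" using comp_edge[OF pc, of a b p q v] that by blast
    then show "z \<in> A k" using ab pcolD(1)[OF pc ab(2)] unfolding A_def by blast
  next
    fix z assume "z \<in> A k"
    then show "z \<in> \<Union> (E k)" unfolding A_def E_def by blast
  qed
  have finA: "finite (A k)" for k using fS by (simp add: A_def)
  have cE: "2 * card (E k) = card (A k)" if k: "k = p \<or> k = q" for k
  proof -
    have "2 * card (E k) = card (\<Union> (E k))"
    proof (rule card_partition)
      show "finite (\<Union> (E k))" using UE[OF k] finA by simp
      then show "finite (E k)" by (rule finite_UnionD)
      show "\<And>c. c \<in> E k \<Longrightarrow> card c = 2" unfolding E_def using pcolD(5)[OF pc] by (force simp: card_2_iff)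
      show "\<And>c1 c2. c1 \<in> E k \<Longrightarrow> c2 \<in> E k \<Longrightarrow> c1 \<noteq> c2 \<Longrightarrow> c1 \<inter> c2 = {}"
      proof (rule ccontr)
        fix c1 c2 assume c: "c1 \<in> E k" "c2 \<in> E k" "c1 \<noteq> c2" and "c1 \<inter> c2 \<noteq> {}"
        then obtain z where z: "z \<in> c1" "z \<in> c2" by blast
        have "\<exists>b. ed z b k \<and> c' = {z, b}" if "c' \<in> E k" "z \<in> c'" for c'
          using that pcolD(1)[OF pc] unfolding E_def by blast
        then obtain b1 b2 where "ed z b1 k" "c1 = {z, b1}" "ed z b2 k" "c2 = {z, b2}"
          using c z by meson
        then show False using pcol_nbr[OF pc, of z b1 k b2] c(3) by simp
      qed
    qed
    then show ?thesis using UE[OF k] by simp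
  qed
  have "finite (E k)" if "k = p \<or> k = q" for k
    using UE[OF that] finA[of k] by (intro finite_UnionD) simp
  then have finE: "finite (E p \<union> E q)" by simp
  \<comment> \<open>Two vertices with the same tree edge would be predecessors of each other, so
    each would be farther from \<open>v\<close> than the other.\<close>
  have inj: "inj_on (\<lambda>w. {w, P w}) (?S - {v})"
  proof (rule inj_onI)
    fix w w' assume w: "w \<in> ?S - {v}" "w' \<in> ?S - {v}" and eq: "{w, P w} = {w', P w'}"
    show "w = w'"
    proof (rule ccontr)
      assume "w \<noteq> w'"
      then have "w = P w'" "w' = P w" using eq by (auto simp: doubleton_eq_iff)
      then show False using P[of w] P[of w'] w by simp
    qed
  qed
  have sub: "(\<lambda>w. {w, P w}) ` (?S - {v}) \<subseteq> E p \<union> E q"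
  proof
    fix e assume "e \<in> (\<lambda>w. {w, P w}) ` (?S - {v})"
    then obtain w where w: "w \<in> ?S" "w \<noteq> v" "e = {w, P w}" by auto
    then have "?R w (P w)" using P[of w] pcolD(1)[OF pc] by blast
    then show "e \<in> E p \<union> E q" using w unfolding E_def by blast
  qed
  have "card (?S - {v}) \<le> card (E p \<union> E q)" using card_inj_on_le[OF inj sub finE] .
  also have "\<dots> \<le> card (E p) + card (E q)" by (rule card_Un_le)
  finally have 1: "2 * (card ?S - 1) \<le> card (A p) + card (A q)"
    using cE[of p] cE[of q] fS by (simp add: card_Diff_singleton)
  have Am: "a \<notin> A k" if "k \<in> M ed a" for a k using that by (simp add: A_def M_def)
  have "{v1, v2, v3} \<subseteq> (?S - A p) \<union> (?S - A q)" using S m Am by blast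
  then have "card {v1, v2, v3} \<le> card ((?S - A p) \<union> (?S - A q))" using fS by (intro card_mono) auto
  also have "\<dots> \<le> card (?S - A p) + card (?S - A q)" by (rule card_Un_le)
  finally have 2: "3 \<le> card (?S - A p) + card (?S - A q)" using d by simp
  have 3: "card (?S - A k) + card (A k) = card ?S" for k
  proof -
    have "A k \<subseteq> ?S" by (auto simp: A_def)
    then show ?thesis using card_Diff_subset[OF finA] card_mono[OF fS] by (simp add: \<open>A k \<subseteq> ?S\<close>)
  qed
  have "card ?S > 0" using fS by (auto simp: card_gt_0_iff intro: comp_refl)
  then show False using 1 2 3[of p] 3[of q] by linarith
qed

definition K :: "'a col \<Rightarrow> nat \<Rightarrow> nat \<Rightarrow> 'a \<Rightarrow> 'a col" where
  "K ed p q v = swp ed p q (kcomp ed p q v)"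

lemma K_pcol: "pcol ed \<Longrightarrow> p < n \<Longrightarrow> q < n \<Longrightarrow> pcol (K ed p q v)"
  by (simp add: K_def swp_pcol comp_closed)

lemma M_K: "p < n \<Longrightarrow> q < n \<Longrightarrow> c \<in> M (K ed p q v) w \<longleftrightarrow> (if w \<in> kcomp ed p q v then sw p q c else c) \<in> M ed w"
  by (simp add: K_def M_swp)

lemma K_ed: "K ed p q v w z k = ed w z (if w \<in> kcomp ed p q v then sw p q k else k)"
  by (simp add: K_def swp_def)

section \<open>Deleting, adding and recolouring a single edge\<close>

definition delE :: "'a col \<Rightarrow> 'a \<Rightarrow> 'a \<Rightarrow> 'a col" where
  "delE ed y z v w k \<longleftrightarrow> ed v w k \<and> {v, w} \<noteq> {y, z}"

definition addE :: "'a col \<Rightarrow> 'a \<Rightarrow> 'a \<Rightarrow> nat \<Rightarrow> 'a col" where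
  "addE ed y z c v w k \<longleftrightarrow> ed v w k \<or> k = c \<and> {v, w} = {y, z}"

lemma delE_pcol:
  assumes pc: "pcol ed" shows "pcol (delE ed y z)"
proof (rule pcolI)
  fix v w k assume "delE ed y z v w k"
  then have e: "ed v w k" "{v, w} \<noteq> {y, z}" by (auto simp: delE_def)
  have "{w, v} \<noteq> {y, z}" using e(2) by (simp add: insert_commute)
  then show "delE ed y z w v k \<and> k < n \<and> v \<in> V \<and> v \<noteq> w"
    using pcolD[OF pc e(1)] by (simp add: delE_def)
next
  fix v w c c' assume "delE ed y z v w c" "delE ed y z v w c'"
  then have "ed v w c" "ed v w c'" by (simp_all add: delE_def)
  then show "c = c'" by (rule pcol_col[OF pc])
next
  fix v w w' c assume "delE ed y z v w c" "delE ed y z v w' c"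
  then have "ed v w c" "ed v w' c" by (simp_all add: delE_def)
  then show "w = w'" by (rule pcol_nbr[OF pc])
qed

lemma addE_pcol:
  assumes pc: "pcol ed" and c: "c \<in> M ed y" "c \<in> M ed z" and yz: "y \<noteq> z" "y \<in> V" "z \<in> V"
    and new: "\<And>k. \<not> ed y z k"
  shows "pcol (addE ed y z c)"
proof -
  have new': "\<not> ed v w k" if "{v, w} = {y, z}" for v w k
    using that new pcolD(1)[OF pc, of v w k] by (auto simp: doubleton_eq_iff)
  have c': "\<not> ed v w c" if "v = y \<or> v = z" for v w using that c by (auto simp: M_def)
  show ?thesis
  proof (rule pcolI)
    fix v w k assume h: "addE ed y z c v w k"
    show "addE ed y z c w v k \<and> k < n \<and> v \<in> V \<and> v \<noteq> w"
    proof (cases "ed v w k")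
      case True
      then show ?thesis using pcolD[OF pc True] by (simp add: addE_def)
    next
      case False
      then have e: "k = c" "{v, w} = {y, z}" using h by (auto simp: addE_def)
      then have "v = y \<and> w = z \<or> v = z \<and> w = y" by (simp add: doubleton_eq_iff)
      then show ?thesis using e yz M_less[OF c(1)] by (auto simp: addE_def insert_commute)
    qed
  next
    fix v w k k' assume h: "addE ed y z c v w k" "addE ed y z c v w k'"
    show "k = k'"
    proof (cases "{v, w} = {y, z}")
      case True
      then show ?thesis using h new'[OF True] by (simp add: addE_def)
    next
      case False
      then show ?thesis using h pcol_col[OF pc] by (simp add: addE_def)
    qed
  next
    fix v w w' k assume h: "addE ed y z c v w k" "addE ed y z c v w' k"
    show "w = w'"
    proof (cases "(v = y \<or> v = z) \<and> k = c")
      case True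
      then have "{v, w} = {y, z}" "{v, w'} = {y, z}" using h c' by (auto simp: addE_def)
      then show ?thesis by (auto simp: doubleton_eq_iff)
    next
      case False
      then have "ed v w k" "ed v w' k" using h by (auto simp: addE_def doubleton_eq_iff)
      then show ?thesis by (rule pcol_nbr[OF pc])
    qed
  qed
qed

lemma M_addE: "c < n \<Longrightarrow> y \<noteq> z \<Longrightarrow> M (addE ed y z c) v = (if v = y \<or> v = z then M ed v - {c} else M ed v)"
  by (auto simp: M_def addE_def doubleton_eq_iff)

lemma M_delE:
  assumes "pcol ed" "ed y z c"
  shows "M (delE ed y z) v = (if v = y \<or> v = z then insert c (M ed v) else M ed v)"
proof (rule set_eqI)
  fix k
  have f: "c < n" "y \<noteq> z" "ed z y c" using pcolD[OF assms] by auto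
  have a: "ed v w k \<longleftrightarrow> delE ed y z v w k" if "\<not> (v = y \<and> w = z \<or> v = z \<and> w = y)" for w
    using that by (simp add: delE_def doubleton_eq_iff)
  have b: "\<not> delE ed y z v w k" if "v = y \<and> w = z \<or> v = z \<and> w = y" for w
    using that by (auto simp: delE_def)
  have u: "k = c" if "ed v w k" "v = y \<and> w = z \<or> v = z \<and> w = y" for w
    using that pcol_col[OF assms(1)] assms(2) f(3) by metis
  have t: "v = y \<and> w = z \<or> v = z \<and> w = y" if "ed v w c" "v = y \<or> v = z" for w
    using that pcol_nbr[OF assms(1), of v w c] assms(2) f(3) by metis
  show "k \<in> M (delE ed y z) v \<longleftrightarrow> k \<in> (if v = y \<or> v = z then insert c (M ed v) else M ed v)"
  proof (cases "v = y \<or> v = z")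
    case False
    then have "\<not> (v = y \<and> w = z \<or> v = z \<and> w = y)" for w by blast
    then show ?thesis using a False by (simp add: M_def)
  next
    case v: True
    show ?thesis
    proof (cases "k = c")
      case True
      then have "\<not> delE ed y z v w k" for w using t[of w] v b[of w] a[of w] by blast
      then show ?thesis using True v f(1) by (simp add: M_def)
    next
      case False
      then have "ed v w k \<longleftrightarrow> delE ed y z v w k" for w using a[of w] b[of w] u[of w] by blast
      then show ?thesis using False v by (simp add: M_def)
    qed
  qed
qed

lemma notin_comp_sym:
  assumes "pcol ed" "v \<notin> kcomp ed p q w"
  shows "w \<notin> kcomp ed p q v"
  using assms comp_sym by metis

lemma comp_disj: "pcol ed \<Longrightarrow> z \<in> kcomp ed p q v \<Longrightarrow> w \<notin> kcomp ed p q v \<Longrightarrow> z \<notin> kcomp ed p q w"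
  using comp_eq comp_refl by metis

lemma sw_notin:
  assumes "p \<notin> A" "q \<notin> A" shows "sw p q c \<in> A \<longleftrightarrow> c \<in> A"
  using assms by (auto simp: sw_def)

lemma M_K_out: "p < n \<Longrightarrow> q < n \<Longrightarrow> v \<notin> kcomp ed p q w \<Longrightarrow> M (K ed p q w) v = M ed v"
  by (intro set_eqI) (simp add: M_K)

lemma M_K_same: "p < n \<Longrightarrow> q < n \<Longrightarrow> p \<notin> M ed v \<Longrightarrow> q \<notin> M ed v \<Longrightarrow> M (K ed p q w) v = M ed v"
  using sw_notin[of p "M ed v" q] by (intro set_eqI) (simp add: M_K)

lemma M_K_other: "p < n \<Longrightarrow> q < n \<Longrightarrow> c \<noteq> p \<Longrightarrow> c \<noteq> q \<Longrightarrow> c \<in> M (K ed p q w) v \<longleftrightarrow> c \<in> M ed v"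
  by (simp add: M_K)

lemma K_ed_other: "c \<noteq> p \<Longrightarrow> c \<noteq> q \<Longrightarrow> K ed p q w v z c \<longleftrightarrow> ed v z c"
  by (simp add: K_ed)

lemma K_ed_out: "v \<notin> kcomp ed p q w \<Longrightarrow> K ed p q w v z c \<longleftrightarrow> ed v z c"
  by (simp add: K_ed)

lemma M_K_in: "p < n \<Longrightarrow> q < n \<Longrightarrow> v \<in> kcomp ed p q w \<Longrightarrow> q \<in> M ed v \<Longrightarrow> p \<in> M (K ed p q w) v"
  and M_K_in': "p < n \<Longrightarrow> q < n \<Longrightarrow> v \<in> kcomp ed p q w \<Longrightarrow> p \<in> M ed v \<Longrightarrow> q \<in> M (K ed p q w) v"
  by (simp_all add: M_K)

lemma swp_supp: "(\<exists>c. swp ed p q S v w c) \<longleftrightarrow> (\<exists>c. ed v w c)"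
proof
  assume "\<exists>c. swp ed p q S v w c"
  then show "\<exists>c. ed v w c" unfolding swp_def by blast
next
  assume "\<exists>c. ed v w c"
  then obtain c where "ed v w c" by blast
  then have "swp ed p q S v w (if v \<in> S then sw p q c else c)" by (simp add: swp_def)
  then show "\<exists>c. swp ed p q S v w c" by blast
qed

lemma K_supp: "(\<exists>c. K ed p q v y z c) \<longleftrightarrow> (\<exists>c. ed y z c)"
  unfolding K_def by (rule swp_supp)

lemma addE_supp: "(\<exists>k. addE ed y z c v w k) \<longleftrightarrow> (\<exists>k. ed v w k) \<or> {v, w} = {y, z}"
  and delE_supp: "(\<exists>k. delE ed y z v w k) \<longleftrightarrow> (\<exists>k. ed v w k) \<and> {v, w} \<noteq> {y, z}"
  by (auto simp: addE_def delE_def)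

lemma recolour_edge:
  assumes pc: "pcol ed" and e: "ed y z a" and p: "p \<in> M ed y" "p \<in> M ed z"
  shows "pcol (addE (delE ed y z) y z p)"
    and "(\<exists>c. addE (delE ed y z) y z p v w c) \<longleftrightarrow> (\<exists>c. ed v w c)"
    and "M (addE (delE ed y z) y z p) v = (if v = y \<or> v = z then insert a (M ed v) - {p} else M ed v)"
proof -
  note d = pcolD[OF pc e]
  have Md: "M (delE ed y z) v = (if v = y \<or> v = z then insert a (M ed v) else M ed v)" for v
    by (rule M_delE[OF pc e])
  show "pcol (addE (delE ed y z) y z p)"
    by (rule addE_pcol[OF delE_pcol[OF pc]]) (use Md p d in \<open>auto simp: delE_def\<close>)
  show "M (addE (delE ed y z) y z p) v = (if v = y \<or> v = z then insert a (M ed v) - {p} else M ed v)"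
    unfolding M_addE[OF M_less[OF p(1)] d(5)] Md by simp
  have "\<exists>c. ed v w c" if "{v, w} = {y, z}" using that e d(1) by (auto simp: doubleton_eq_iff)
  then show "(\<exists>c. addE (delE ed y z) y z p v w c) \<longleftrightarrow> (\<exists>c. ed v w c)"
    unfolding addE_supp delE_supp by blast
qed

section \<open>Missing colours and degrees; relations versus colourings of edge sets\<close>

lemma card_M:
  assumes pc: "pcol ed" and sp: "\<And>v w. (\<exists>c. ed v w c) \<longleftrightarrow> G v w"
  shows "card (M ed v) + card {w. G v w} = n"
proof -
  let ?S = "{c. c < n \<and> (\<exists>w. ed v w c)}"
  define f where "f w = (THE c. ed v w c)" for w
  have f: "f w = c" if "ed v w c" for w c
    unfolding f_def using that pcol_col[OF pc] by blast
  have "bij_betw f {w. G v w} ?S"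
    unfolding bij_betw_def
  proof
    show "inj_on f {w. G v w}"
    proof (rule inj_onI)
      fix w w' assume h: "w \<in> {w. G v w}" "w' \<in> {w. G v w}" "f w = f w'"
      obtain c c' where "ed v w c" "ed v w' c'" using h(1,2) sp by blast
      then show "w = w'" using f h(3) pcol_nbr[OF pc] by metis
    qed
    show "f ` {w. G v w} = ?S"
    proof (rule set_eqI, rule iffI)
      fix c assume "c \<in> f ` {w. G v w}"
      then obtain w where w: "G v w" "c = f w" by blast
      then obtain k where k: "ed v w k" using sp by blast
      then show "c \<in> ?S" using w f[OF k] pcolD(2)[OF pc k] by auto
    next
      fix c assume "c \<in> ?S"
      then obtain w where w: "ed v w c" by blast
      then have "G v w" using sp by blast
      then show "c \<in> f ` {w. G v w}" using f[OF w] by blast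
    qed
  qed
  then have "card {w. G v w} = card ?S" by (rule bij_betw_same_card)
  moreover have "card (M ed v) + card ?S = card (M ed v \<union> ?S)"
    by (rule card_Un_disjoint[symmetric]) (auto simp: M_def)
  moreover have "M ed v \<union> ?S = {..<n}" by (auto simp: M_def)
  ultimately show ?thesis by simp
qed

lemma colouring_of_col:
  assumes pc: "pcol ed" and sp: "\<And>v w. (\<exists>c. ed v w c) \<longleftrightarrow> {v, w} \<in> E" and E: "\<forall>e\<in>E. card e = 2"
  shows "\<exists>c. proper_edge_colouring E n c"
proof -
  define c where "c e = (THE k. \<exists>v w. e = {v, w} \<and> ed v w k)" for e
  have c: "c {v, w} = k" if "ed v w k" for v w k
    unfolding c_def
  proof (rule the_equality)
    fix j assume "\<exists>v' w'. {v, w} = {v', w'} \<and> ed v' w' j"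
    then have "ed v w j" using pcolD(1)[OF pc] by (metis doubleton_eq_iff)
    then show "j = k" using that pcol_col[OF pc] by blast
  qed (use that in blast)
  have ex: "\<exists>v w k. e = {v, w} \<and> ed v w k" if "e \<in> E" for e
    using that E sp by (metis card_2_iff)
  have "c e < n" if "e \<in> E" for e using ex[OF that] c pcolD(2)[OF pc] by metis
  moreover have "c e \<noteq> c f" if ef: "e \<in> E" "f \<in> E" "e \<noteq> f" "e \<inter> f \<noteq> {}" for e f
  proof
    assume eq: "c e = c f"
    obtain z where z: "z \<in> e" "z \<in> f" using ef(4) by blast
    have at: "\<exists>w k. g = {z, w} \<and> ed z w k \<and> c g = k" if "g \<in> E" "z \<in> g" for g
      using ex[OF that(1)] that(2) c pcolD(1)[OF pc] by (metis insertE insert_commute singletonD)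
    show False using at[OF ef(1) z(1)] at[OF ef(2) z(2)] eq ef(3) pcol_nbr[OF pc] by metis
  qed
  ultimately show ?thesis unfolding proper_edge_colouring_def by blast
qed

lemma col_of_colouring:
  assumes c: "proper_edge_colouring E k c" "k \<le> n" and E: "\<forall>e\<in>E. e \<subseteq> V \<and> card e = 2"
  shows "pcol (\<lambda>v w j. {v, w} \<in> E \<and> c {v, w} = j)"
proof (rule pcolI)
  fix v w j assume h: "{v, w} \<in> E \<and> c {v, w} = j"
  have "{v, w} \<subseteq> V \<and> card {v, w} = 2" using bspec[OF E conjunct1[OF h]] .
  moreover have "\<forall>e\<in>E. c e < k" using c(1) by (simp add: proper_edge_colouring_def)
  then have "c {v, w} < k" using h by blast
  ultimately show "({w, v} \<in> E \<and> c {w, v} = j) \<and> j < n \<and> v \<in> V \<and> v \<noteq> w"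
    using h c(2) by (auto simp: insert_commute)
next
  fix v w w' j assume h: "{v, w} \<in> E \<and> c {v, w} = j" "{v, w'} \<in> E \<and> c {v, w'} = j"
  have *: "\<forall>e\<in>E. \<forall>f\<in>E. e \<noteq> f \<and> e \<inter> f \<noteq> {} \<longrightarrow> c e \<noteq> c f"
    using c(1) by (simp add: proper_edge_colouring_def)
  have "{v, w} \<inter> {v, w'} \<noteq> {}" by blast
  then have "{v, w} = {v, w'}" using * h by metis
  then show "w = w'" by (metis doubleton_eq_iff)
qed simp

end

section \<open>Fans at an uncoloured edge\<close>

text \<open>The restriction to \<open>butlast\<close> and \<open>tl\<close> matters for chains:
  their last colour need not be missing at any vertex of the list, and nothing is demanded of the
  colours missing at their head.\<close>

lemma successively_weaken:
  assumes "successively P xs" "\<And>x y. x \<in> set (butlast xs) \<Longrightarrow> y \<in> set (tl xs) \<Longrightarrow> P x y \<Longrightarrow> Q x y"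
  shows "successively Q xs"
  using assms
proof (induction xs)
  case (Cons a xs)
  show ?case
  proof (cases xs)
    case (Cons b ys)
    have 1: "P a b" "successively P xs" using Cons.prems(1) Cons by simp_all
    have "Q a b" using 1(1) Cons.prems(2)[of a b] Cons by simp
    moreover have "successively Q xs"
    proof (rule Cons.IH[OF 1(2)])
      fix x y assume "x \<in> set (butlast xs)" "y \<in> set (tl xs)" "P x y"
      moreover have "set (tl xs) \<subseteq> set xs" by (cases xs) auto
      ultimately show "Q x y" using Cons.prems(2)[of x y] Cons by auto
    qed
    ultimately show ?thesis using Cons by simp
  qed simp
qed simp

text \<open>\<open>G\<close> is the graph without \<open>rs\<close>. The degree conditions enter as
  numbers of missing colours in every colouring of \<open>G\<close>; for \<open>v\<close> other than
  \<open>r\<close> and \<open>s\<close>, \<open>M ed v = {}\<close> says that \<open>v\<close> has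
  maximum degree.\<close>

locale fans = kempe n V for n :: nat and V :: "'a set" +
  fixes G :: "'a \<Rightarrow> 'a \<Rightarrow> bool" and r s :: 'a
  assumes rs: "r \<noteq> s" "\<not> G r s" "\<not> G s r" "r \<in> V" "s \<in> V"
    and nofull: "pcol ed \<Longrightarrow> (\<And>v w. (\<exists>c. ed v w c) \<longleftrightarrow> G v w \<or> {v, w} = {r, s}) \<Longrightarrow> False"
    and card_r: "pcol ed \<Longrightarrow> (\<And>v w. (\<exists>c. ed v w c) \<longleftrightarrow> G v w) \<Longrightarrow> \<exists>p. M ed r = {p}"
    and card_s: "pcol ed \<Longrightarrow> (\<And>v w. (\<exists>c. ed v w c) \<longleftrightarrow> G v w) \<Longrightarrow> \<exists>a b. a \<noteq> b \<and> M ed s = {a, b}"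
    and light: "pcol ed \<Longrightarrow> (\<And>v w. (\<exists>c. ed v w c) \<longleftrightarrow> G v w) \<Longrightarrow> card {v. G r v \<and> M ed v = {}} \<le> 2"
begin

section \<open>Colourings with \<open>rs\<close> uncoloured, and chains at \<open>r\<close>\<close>

definition valid :: "'a col \<Rightarrow> bool" where
  "valid ed \<longleftrightarrow> pcol ed \<and> (\<forall>v w. (\<exists>c. ed v w c) \<longleftrightarrow> G v w)"

lemma valid_pcol: "valid ed \<Longrightarrow> pcol ed"
  and valid_G: "valid ed \<Longrightarrow> ed v w c \<Longrightarrow> G v w"
  and valid_ex: "valid ed \<Longrightarrow> G v w \<Longrightarrow> \<exists>c. ed v w c"
  unfolding valid_def by blast+

lemma valid_r: "valid ed \<Longrightarrow> \<exists>p. M ed r = {p}"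
  and valid_s: "valid ed \<Longrightarrow> \<exists>a b. a \<noteq> b \<and> M ed s = {a, b}"
  and valid_light: "valid ed \<Longrightarrow> card {v. G r v \<and> M ed v = {}} \<le> 2"
  unfolding valid_def using card_r card_s light by auto

lemma valid_not_s: "valid ed \<Longrightarrow> \<not> ed r s c" "valid ed \<Longrightarrow> \<not> ed s r c"
  using valid_G rs by blast+

lemma valid_swp:
  assumes "valid ed" "p < n" "q < n" "closed ed p q S"
  shows "valid (swp ed p q S)"
proof -
  have "(\<exists>c. swp ed p q S v w c) \<longleftrightarrow> (\<exists>c. ed v w c)" for v w by (rule swp_supp)
  then show ?thesis using assms swp_pcol[of ed p q S] unfolding valid_def by simp
qed

lemma valid_K: "valid ed \<Longrightarrow> p < n \<Longrightarrow> q < n \<Longrightarrow> valid (K ed p q v)"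
  unfolding K_def by (rule valid_swp[OF _ _ _ comp_closed])

text \<open>The common missing colour could be given to \<open>rs\<close>. Most contradictions below
  come down to this.\<close>

lemma nocol:
  assumes v: "valid ed" and c: "c \<in> M ed r" "c \<in> M ed s"
  shows False
proof (rule nofull)
  show "pcol (addE ed r s c)"
    using addE_pcol[OF valid_pcol[OF v] c rs(1,4,5)] valid_not_s[OF v] by blast
  fix x y
  show "(\<exists>k. addE ed r s c x y k) \<longleftrightarrow> G x y \<or> {x, y} = {r, s}"
    using v unfolding addE_def valid_def by blast
qed

text \<open>
  A chain lists neighbours of \<open>r\<close> with the colours of their edges to \<open>r\<close>, each colour being missing at
  the next vertex of the list. If the head misses a colour that is missing at \<open>r\<close>, shifting the
  colours along the list frees the last colour at \<open>r\<close>.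
\<close>
definition chn :: "'a col \<Rightarrow> ('a \<times> nat) list \<Rightarrow> bool" where
  "chn ed L \<longleftrightarrow> L \<noteq> [] \<and> distinct (map fst L) \<and> (\<forall>x\<in>set L. ed r (fst x) (snd x)) \<and>
     successively (\<lambda>x y. snd x \<in> M ed (fst y)) L"

text \<open>Lists are read from the far end towards the source. The source is the colour at which a
  chain is anchored: missing at \<open>s\<close> for a chain inside the fan, otherwise a colour
  missing at \<open>x\<close> or the colour of \<open>ux\<close> or \<open>su\<close>.\<close>

abbreviation src :: "('a \<times> nat) list \<Rightarrow> nat" where "src L \<equiv> snd (last L)"

lemma chn_edge: "chn ed L \<Longrightarrow> x \<in> set L \<Longrightarrow> ed r (fst x) (snd x)"
  by (simp add: chn_def)

lemma chn_Nil: "chn ed L \<Longrightarrow> L \<noteq> []" by (simp add: chn_def)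

lemma chn_single: "ed r v c \<Longrightarrow> chn ed [(v, c)]" by (simp add: chn_def)

lemma chn_append:
  assumes "A \<noteq> []" "B \<noteq> []"
  shows "chn ed (A @ B) \<longleftrightarrow> chn ed A \<and> chn ed B \<and> src A \<in> M ed (fst (hd B)) \<and> fst ` set A \<inter> fst ` set B = {}"
  using assms unfolding chn_def by (auto simp: successively_append_iff)

lemma chn_Cons:
  assumes "B \<noteq> []"
  shows "chn ed (x # B) \<longleftrightarrow> ed r (fst x) (snd x) \<and> chn ed B \<and> snd x \<in> M ed (fst (hd B)) \<and> fst x \<notin> fst ` set B"
  using chn_append[of "[x]" B ed] assms by (auto simp: chn_def)

lemma chn_mono:
  assumes "chn ed L" "\<And>x. x \<in> set L \<Longrightarrow> ed' r (fst x) (snd x)"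
    and "\<And>x y. x \<in> set (butlast L) \<Longrightarrow> y \<in> set (tl L) \<Longrightarrow> snd x \<in> M ed (fst y) \<Longrightarrow> snd x \<in> M ed' (fst y)"
  shows "chn ed' L"
  unfolding chn_def
proof (intro conjI ballI)
  show "L \<noteq> []" "distinct (map fst L)" using assms(1) by (simp_all add: chn_def)
  show "ed' r (fst x) (snd x)" if "x \<in> set L" for x using assms(2) that .
  show "successively (\<lambda>x y. snd x \<in> M ed' (fst y)) L"
    by (rule successively_weaken[of "\<lambda>x y. snd x \<in> M ed (fst y)"])
      (use assms in \<open>simp_all add: chn_def\<close>)
qed

lemma chn_snd_distinct:
  assumes "pcol ed" "chn ed L" shows "distinct (map snd L)"
proof -
  have "inj_on snd (set L)"
  proof (rule inj_onI)
    fix x y assume "x \<in> set L" "y \<in> set L" "snd x = snd y"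
    moreover have "ed r (fst x) (snd x)" "ed r (fst y) (snd y)"
      using chn_edge[OF assms(2)] calculation by blast+
    ultimately show "x = y" using pcol_nbr[OF assms(1), of r "fst x" "snd x" "fst y"]
      by (simp add: prod_eq_iff)
  qed
  moreover have "distinct L" using assms(2) by (simp add: chn_def distinct_map)
  ultimately show ?thesis by (simp add: distinct_map)
qed

lemma chn_butlast_src:
  assumes "pcol ed" "chn ed L" "x \<in> set (butlast L)" shows "snd x \<noteq> src L"
proof -
  have "L = butlast L @ [last L]" using chn_Nil[OF assms(2)] by simp
  then have "distinct (map snd (butlast L @ [last L]))" using chn_snd_distinct[OF assms(1,2)] by simp
  then show ?thesis using assms(3) by (auto simp: image_iff)
qed

lemma chn_recolour:
  assumes "chn ed L" "\<And>y. y \<in> set L \<Longrightarrow> ed' r (fst y) (h (snd y))"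
    and "\<And>y w. y \<in> set (butlast L) \<Longrightarrow> snd y \<in> M ed w \<Longrightarrow> h (snd y) \<in> M ed' w"
  shows "chn ed' (map (map_prod id h) L)"
  unfolding chn_def
proof (intro conjI ballI)
  show "map (map_prod id h) L \<noteq> []" using chn_Nil[OF assms(1)] by simp
  have "map fst (map (map_prod id h) L) = map fst L" by simp
  then show "distinct (map fst (map (map_prod id h) L))" using assms(1) unfolding chn_def by metis
  show "ed' r (fst z) (snd z)" if "z \<in> set (map (map_prod id h) L)" for z
    using that assms(2) by auto
  have "successively (\<lambda>y z. snd y \<in> M ed (fst z)) L" using assms(1) unfolding chn_def by blast
  then have "successively (\<lambda>y z. h (snd y) \<in> M ed' (fst z)) L"
    by (rule successively_weaken) (rule assms(3))
  then show "successively (\<lambda>y z. snd y \<in> M ed' (fst z)) (map (map_prod id h) L)"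
    by (simp add: successively_map)
qed

text \<open>The last clause keeps the recoloured edges out of the fan when neither \<open>k\<close>
  nor a colour of \<open>L\<close> is reachable.\<close>

definition shifted :: "'a col \<Rightarrow> 'a col \<Rightarrow> ('a \<times> nat) list \<Rightarrow> nat \<Rightarrow> bool" where
  "shifted ed ed' L k \<longleftrightarrow> valid ed' \<and> src L \<in> M ed' r \<and>
    (\<forall>v. v \<noteq> r \<longrightarrow> v \<notin> fst ` set L \<longrightarrow> M ed' v = M ed v) \<and>
    (\<forall>v w c. v \<noteq> r \<longrightarrow> w \<noteq> r \<longrightarrow> ed' v w c = ed v w c) \<and>
    (\<forall>v c. v \<notin> fst ` set L \<longrightarrow> ed' r v c = ed r v c) \<and>
    (\<forall>v c. v \<in> fst ` set L \<longrightarrow> ed' r v c \<longrightarrow> c = k \<or> c \<in> snd ` set L)"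

lemma shiftedD:
  assumes "shifted ed ed' L k"
  shows "valid ed'" "src L \<in> M ed' r"
    and "v \<noteq> r \<Longrightarrow> v \<notin> fst ` set L \<Longrightarrow> M ed' v = M ed v"
    and "v \<noteq> r \<Longrightarrow> w \<noteq> r \<Longrightarrow> ed' v w c = ed v w c"
    and "v \<notin> fst ` set L \<Longrightarrow> ed' r v c = ed r v c"
    and "v \<in> fst ` set L \<Longrightarrow> ed' r v c \<Longrightarrow> c = k \<or> c \<in> snd ` set L"
  using assms unfolding shifted_def by simp_all

lemma shiftedI:
  assumes "valid ed'" "src L \<in> M ed' r"
    and "\<And>v. v \<noteq> r \<Longrightarrow> v \<notin> fst ` set L \<Longrightarrow> M ed' v = M ed v"
    and "\<And>v w c. v \<noteq> r \<Longrightarrow> w \<noteq> r \<Longrightarrow> ed' v w c = ed v w c"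
    and "\<And>v c. v \<notin> fst ` set L \<Longrightarrow> ed' r v c = ed r v c"
    and "\<And>v c. v \<in> fst ` set L \<Longrightarrow> ed' r v c \<Longrightarrow> c = k \<or> c \<in> snd ` set L"
  shows "shifted ed ed' L k"
  unfolding shifted_def using assms by simp

lemma shift:
  assumes "valid ed" "chn ed L" "k \<in> M ed (fst (hd L))" "k \<in> M ed r"
  shows "\<exists>ed'. shifted ed ed' L k"
  using assms
proof (induction L arbitrary: ed k)
  case Nil
  then show ?case by (simp add: chn_def)
next
  case (Cons x L)
  obtain w c where x: "x = (w, c)" by (cases x)
  note v = Cons.prems(1) and pc = valid_pcol[OF Cons.prems(1)]
  have e: "ed r w c" using chn_edge[OF Cons.prems(2), of x] x by simp
  have rw: "r \<noteq> w" "r \<in> V" "w \<in> V" "c < n" "ed w r c" using pcolD[OF pc e] by auto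
  have kw: "k \<in> M ed w" and kr: "k \<in> M ed r" and kn: "k < n" using Cons.prems(3,4) x M_less by auto
  have ck: "c \<noteq> k" using e kr by (auto simp: M_def)
  \<comment> \<open>Giving \<open>rw\<close> the colour \<open>k\<close> frees \<open>c\<close> at
    \<open>r\<close>. Since \<open>c\<close> is missing at the next vertex, it takes the role of
    \<open>k\<close> for the tail.\<close>
  define ed1 where "ed1 = addE (delE ed r w) r w k"
  note rc = recolour_edge[OF pc e kr kw, folded ed1_def]
  have M1: "M ed1 v = (if v = r \<or> v = w then insert c (M ed v) - {k} else M ed v)" for v by (rule rc(3))
  have v1: "valid ed1" using rc(1,2) v unfolding valid_def by simp
  have E1: "ed1 v y j \<longleftrightarrow> (if {v, y} = {r, w} then j = k else ed v y j)" for v y j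
    unfolding ed1_def addE_def delE_def by auto
  have c1: "c \<in> M ed1 r" using M1 ck by simp
  have En: "ed1 r y j \<longleftrightarrow> ed r y j" if "y \<noteq> w" for y j
    using that E1 by (auto simp: doubleton_eq_iff)
  have Ew: "ed1 r w j \<longleftrightarrow> j = k" for j using E1 by simp
  have Eo: "ed1 v y j \<longleftrightarrow> ed v y j" if "v \<noteq> r" "y \<noteq> r" for v y j
    using that E1 by (auto simp: doubleton_eq_iff)
  show ?case
  proof (cases "L = []")
    case True
    have "src (x # L) = c" using True x by simp
    have "shifted ed ed1 (x # L) k"
    proof (rule shiftedI)
      show "valid ed1" by (rule v1)
      show "src (x # L) \<in> M ed1 r" using c1 True x by simp
      show "M ed1 v = M ed v" if "v \<noteq> r" "v \<notin> fst ` set (x # L)" for v using that M1 x by simp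
      show "ed1 v y j = ed v y j" if "v \<noteq> r" "y \<noteq> r" for v y j using that Eo by simp
      show "ed1 r v j = ed r v j" if "v \<notin> fst ` set (x # L)" for v j using that En x by simp
      show "j = k \<or> j \<in> snd ` set (x # L)" if "v \<in> fst ` set (x # L)" "ed1 r v j" for v j
        using that Ew x True by simp
    qed
    then show ?thesis by blast
  next
    case False
    have L: "chn ed L" "c \<in> M ed (fst (hd L))" "w \<notin> fst ` set L"
      using Cons.prems(2) x chn_Cons[OF False, of ed x] by auto
    have rL: "r \<notin> fst ` set L" using chn_edge[OF L(1)] pcolD(5)[OF pc] by fastforce
    have hdL: "hd L \<in> set L" using False by simp
    have M1L: "M ed1 (fst y) = M ed (fst y)" if "y \<in> set L" for y
    proof -
      have "fst y \<noteq> r" "fst y \<noteq> w" using that rL L(3) by auto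
      then show ?thesis by (simp add: M1)
    qed
    have "chn ed1 L"
    proof (rule chn_mono[OF L(1)])
      fix y assume "y \<in> set L"
      then have "fst y \<noteq> w" using L(3) by auto
      then show "ed1 r (fst y) (snd y)" using En chn_edge[OF L(1) \<open>y \<in> set L\<close>] by simp
    qed (simp add: M1L list.set_sel(2)[OF False])
    moreover have "c \<in> M ed1 (fst (hd L))" using M1L[OF hdL] L(2) by simp
    ultimately obtain ed' where "shifted ed1 ed' L c" using Cons.IH[OF v1 _ _ c1] by blast
    note ed' = shiftedD[OF this]
    have "shifted ed ed' (x # L) k"
    proof (rule shiftedI)
      show "valid ed'" by (rule ed'(1))
      show "src (x # L) \<in> M ed' r" using ed'(2) False by simp
      show "M ed' v = M ed v" if "v \<noteq> r" "v \<notin> fst ` set (x # L)" for v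
        using that ed'(3) M1 x by simp
      show "ed' v y j = ed v y j" if "v \<noteq> r" "y \<noteq> r" for v y j using that ed'(4) Eo by simp
      show "ed' r v j = ed r v j" if "v \<notin> fst ` set (x # L)" for v j
        using that ed'(5) En x by simp
      fix v j assume h: "v \<in> fst ` set (x # L)" "ed' r v j"
      show "j = k \<or> j \<in> snd ` set (x # L)"
      proof (cases "v \<in> fst ` set L")
        case True
        then show ?thesis using ed'(6)[OF True h(2)] x by auto
      next
        case F: False
        then have "v = w" using h(1) x by auto
        then show ?thesis using ed'(5)[OF F] h(2) Ew by simp
      qed
    qed
    then show ?thesis by blast
  qed
qed

section \<open>The fan and its halves\<close>

text \<open>One half of a maximal multifan at \<open>r\<close> with respect to \<open>rs\<close>,
  recorded by its colours: those reached from the root colour \<open>a\<close>. With colours instead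
  of vertex sequences, maximality and the union over all branches come for free.\<close>

inductive_set D :: "'a col \<Rightarrow> nat \<Rightarrow> nat set" for ed :: "'a col" and a :: nat where
  D0: "a \<in> D ed a"
| D1: "k \<in> D ed a \<Longrightarrow> ed r v k \<Longrightarrow> k' \<in> M ed v \<Longrightarrow> k' \<in> D ed a"

definition C :: "'a col \<Rightarrow> nat set" where "C ed = (\<Union>a\<in>M ed s. D ed a)"

definition Fv :: "'a col \<Rightarrow> 'a \<Rightarrow> bool" where
  "Fv ed y \<longleftrightarrow> y = s \<or> (\<exists>k\<in>C ed. ed r y k)"

lemma D_less: "k \<in> D ed a \<Longrightarrow> a < n \<Longrightarrow> k < n"
  by (induction rule: D.induct) (auto dest: M_less)

text \<open>A step that returns to a vertex already on the list would destroy distinctness. The edge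
  from \<open>r\<close> to that vertex then has the new colour, and the suffix starting there is the
  required chain.\<close>

lemma D_chain:
  assumes "pcol ed" "k \<in> D ed a" "ed r v k"
  shows "\<exists>L. chn ed ((v, k) # L) \<and> src ((v, k) # L) = a \<and> snd ` set L \<subseteq> D ed a"
  using assms(2,3)
proof (induction arbitrary: v rule: D.induct)
  case D0
  then show ?case by (intro exI[of _ "[]"]) (simp add: chn_single)
next
  case (D1 k v0 k')
  obtain L where L: "chn ed ((v0, k) # L)" "src ((v0, k) # L) = a" "snd ` set L \<subseteq> D ed a"
    using D1.IH[OF D1.hyps(2)] by blast
  show ?case
  proof (cases "v \<in> fst ` set ((v0, k) # L)")
    case True
    then obtain x where x: "x \<in> set ((v0, k) # L)" "v = fst x" by (elim imageE)
    have "(v, snd x) \<in> set ((v0, k) # L)" using x by simp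
    then obtain j where j: "(v, j) \<in> set ((v0, k) # L)" by blast
    have "ed r v j" using chn_edge[OF L(1) j] by simp
    then have "j = k'" using D1.prems pcol_col[OF assms(1)] by blast
    then obtain A B where AB: "(v0, k) # L = A @ (v, k') # B" using j split_list by metis
    have "chn ed ((v, k') # B)"
    proof (cases "A = []")
      case True
      then show ?thesis using L(1) AB by simp
    next
      case False
      then show ?thesis using L(1) AB chn_append[of A "(v, k') # B" ed] by simp
    qed
    moreover have "src ((v, k') # B) = a" using L(2) AB by simp
    moreover have "set ((v, k') # B) \<subseteq> set ((v0, k) # L)" unfolding AB by auto
    then have "snd ` set ((v, k') # B) \<subseteq> snd ` set ((v0, k) # L)" by (rule image_mono)
    then have "snd ` set B \<subseteq> insert k (snd ` set L)" by simp
    then have "snd ` set B \<subseteq> D ed a" using L(3) D1.hyps(1) by blast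
    ultimately show ?thesis by blast
  next
    case False
    have "chn ed ((v, k') # (v0, k) # L)"
      using chn_Cons[of "(v0, k) # L" ed "(v, k')"] L(1) D1 False by simp
    then show ?thesis using L D1.hyps(1) by (intro exI[of _ "(v0, k) # L"]) simp
  qed
qed

lemma chain_D:
  assumes "chn ed L"
  shows "snd ` set L \<subseteq> D ed (src L) \<and> M ed (fst (hd L)) \<subseteq> D ed (src L)"
  using assms
proof (induction L)
  case Nil
  then show ?case by (simp add: chn_def)
next
  case (Cons x L)
  have e: "ed r (fst x) (snd x)" using chn_edge[OF Cons.prems] by simp
  show ?case
  proof (cases "L = []")
    case True
    then show ?thesis using e by (auto intro: D.D0 D.D1[OF D.D0])
  next
    case False
    have L: "chn ed L" "snd x \<in> M ed (fst (hd L))" using Cons.prems chn_Cons[OF False] by auto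
    then have IH: "snd ` set L \<subseteq> D ed (src L)" "snd x \<in> D ed (src L)" using Cons.IH by auto
    have "M ed (fst x) \<subseteq> D ed (src L)" using D.D1[OF IH(2) e] by blast
    then show ?thesis using IH False by simp
  qed
qed

lemma C_I: "a \<in> M ed s \<Longrightarrow> k \<in> D ed a \<Longrightarrow> k \<in> C ed" by (auto simp: C_def)
lemma M_s_C: "a \<in> M ed s \<Longrightarrow> a \<in> C ed" by (auto simp: C_def intro: D.D0)
lemma C_step: "k \<in> C ed \<Longrightarrow> ed r v k \<Longrightarrow> k' \<in> M ed v \<Longrightarrow> k' \<in> C ed"
  unfolding C_def by (auto intro: D.D1)
lemma C_less: "k \<in> C ed \<Longrightarrow> k < n" unfolding C_def using D_less M_less by blast
lemma Fv_s [simp]: "Fv ed s" by (simp add: Fv_def)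
lemma Fv_I: "k \<in> C ed \<Longrightarrow> ed r y k \<Longrightarrow> Fv ed y" by (auto simp: Fv_def)
lemma Fv_M: "Fv ed y \<Longrightarrow> M ed y \<subseteq> C ed"
  unfolding Fv_def using C_step M_s_C by blast
lemma C_cases:
  assumes "c \<in> C ed" obtains "c \<in> M ed s" | k v where "k \<in> C ed" "ed r v k" "c \<in> M ed v"
proof -
  obtain a where a: "a \<in> M ed s" "c \<in> D ed a" using assms by (auto simp: C_def)
  from a(2) show ?thesis
  proof cases
    case D0
    then show ?thesis using a(1) that(1) by simp
  next
    case (D1 k v)
    then show ?thesis using a(1) that(2)[of k v] by (auto simp: C_def)
  qed
qed
lemma C_holder: assumes "c \<in> C ed" obtains y where "Fv ed y" "c \<in> M ed y"
  using assms by (cases rule: C_cases) (auto simp: Fv_def)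

text \<open>Shifting along the chain would free its source colour at \<open>r\<close>, and that
  colour is missing at \<open>s\<close>.\<close>

lemma chain_avoids_r:
  assumes "valid ed" "chn ed L" "src L \<in> M ed s" "c \<in> M ed (fst (hd L))" "c \<in> M ed r"
  shows False
proof -
  have "s \<notin> fst ` set L" using chn_edge[OF assms(2)] valid_not_s[OF assms(1)] by fastforce
  obtain ed' where "shifted ed ed' L c" using shift[OF assms(1,2,4,5)] by blast
  note ed' = shiftedD[OF this]
  have "src L \<in> M ed' s" using ed'(3)[of s] assms(3) rs(1) \<open>s \<notin> _\<close> by simp
  then show False by (rule nocol[OF ed'(1,2)])
qed

lemma fan_avoids_r:
  assumes "valid ed" "Fv ed y" "c \<in> M ed y" "c \<in> M ed r"
  shows False
proof (cases "y = s")
  case True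
  then show ?thesis using nocol assms by blast
next
  case False
  then obtain a k where a: "a \<in> M ed s" "k \<in> D ed a" "ed r y k" using assms(2) by (auto simp: Fv_def C_def)
  obtain L where "chn ed ((y, k) # L)" "src ((y, k) # L) = a" using D_chain[OF valid_pcol[OF assms(1)] a(2,3)] by blast
  then show False using chain_avoids_r[OF assms(1), of "(y, k) # L" c] a assms by simp
qed

lemma C_not_r: "valid ed \<Longrightarrow> c \<in> C ed \<Longrightarrow> c \<notin> M ed r"
  using fan_avoids_r C_holder by metis

lemma C_edge: "valid ed \<Longrightarrow> c \<in> C ed \<Longrightarrow> \<exists>v. ed r v c"
  using C_not_r C_less notM by metis

lemma chn_tl:
  assumes "x \<in> set (butlast L)" "chn ed L"
  shows "\<exists>y\<in>set (tl L). snd x \<in> M ed (fst y)"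
proof -
  obtain A B where AB: "butlast L = A @ x # B" using split_list[OF assms(1)] by blast
  define l where "l = last L"
  have "L = butlast L @ [l]" using chn_Nil[OF assms(2)] by (simp add: l_def)
  then have L: "L = (A @ [x]) @ (B @ [l])" using AB by simp
  have "chn ed ((A @ [x]) @ (B @ [l]))" using assms(2) L by simp
  then have "snd x \<in> M ed (fst (hd (B @ [l])))" by (subst (asm) chn_append) simp_all
  moreover have "hd (B @ [l]) \<in> set (B @ [l])" by (intro hd_in_set) simp
  moreover have "tl L = tl (A @ [x]) @ B @ [l]" unfolding L by (cases A) simp_all
  then have "set (B @ [l]) \<subseteq> set (tl L)" by auto
  ultimately show ?thesis by blast
qed

lemma chn_suffix: "chn ed (A @ B) \<Longrightarrow> B \<noteq> [] \<Longrightarrow> chn ed B"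
  using chn_append[of A B ed] by (cases "A = []") auto

lemma chn_hd_tl:
  assumes "chn ed L" "y \<in> set (tl L)" shows "fst y \<noteq> fst (hd L)" "y \<in> set L"
proof -
  have "L = hd L # tl L" using chn_Nil[OF assms(1)] by simp
  then have "distinct (map fst (hd L # tl L))" using assms(1) by (metis chn_def)
  then show "fst y \<noteq> fst (hd L)" using assms(2) by (auto simp: image_iff)
  show "y \<in> set L" using assms(2) by (rule list.set_sel(2)[OF chn_Nil[OF assms(1)]])
qed

lemma chn_r: "pcol ed \<Longrightarrow> chn ed L \<Longrightarrow> x \<in> set L \<Longrightarrow> fst x \<noteq> r"
  using chn_edge pcolD(5) by metis

lemma chn_s: "valid ed \<Longrightarrow> chn ed L \<Longrightarrow> x \<in> set L \<Longrightarrow> fst x \<noteq> s"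
  using chn_edge valid_not_s by metis

section \<open>Components through \<open>r\<close> and elementarity of the fan\<close>

lemma s_linked_r:
  assumes v: "valid ed" and c: "c \<in> M ed s" "p \<in> M ed r"
  shows "s \<in> kcomp ed p c r"
proof (rule ccontr)
  assume "s \<notin> kcomp ed p c r"
  then have r: "r \<notin> kcomp ed p c s" using notin_comp_sym[OF valid_pcol[OF v]] by blast
  have n: "p < n" "c < n" using c M_less by auto
  have "p \<in> M (K ed p c s) s" "p \<in> M (K ed p c s) r" using c r by (simp_all add: M_K[OF n])
  then show False using nocol[OF valid_K[OF v n]] by blast
qed

text \<open>Otherwise an exchange at the head makes it miss \<open>p\<close> while \<open>r\<close>
  keeps missing \<open>p\<close>, against \<open>chain_avoids_r\<close>. The exchange could break
  the chain only where a later vertex is required to miss \<open>c\<close>; that vertex heads a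
  shorter chain, so by induction it lies in the component of \<open>r\<close> and is
  untouched.\<close>

lemma chain_linked_r:
  assumes "valid ed" "chn ed L" "src L \<in> M ed s" "c \<in> M ed (fst (hd L))" "p \<in> M ed r"
  shows "fst (hd L) \<in> kcomp ed p c r"
  using assms
proof (induction "length L" arbitrary: L rule: less_induct)
  case less
  note v = less.prems(1) and L = less.prems(2)
  note pc = valid_pcol[OF v]
  let ?w = "fst (hd L)" let ?S = "kcomp ed p c (fst (hd L))" let ?e = "K ed p c (fst (hd L))"
  have n: "p < n" "c < n" using less.prems(4,5) M_less by auto
  show ?case
  proof (rule ccontr)
    assume nw: "?w \<notin> kcomp ed p c r"
    then have r: "r \<notin> ?S" using notin_comp_sym[OF pc] by blast
    have notS: "z \<notin> ?S" if "z \<in> kcomp ed p c r" for z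
    proof
      assume "z \<in> ?S"
      then have "kcomp ed p c r = ?S" using that comp_eq[OF pc] by metis
      then show False using r by auto
    qed
    have ch: "chn ?e L"
    proof (rule chn_mono[OF L])
      fix x assume x: "x \<in> set L"
      then show "?e r (fst x) (snd x)" using chn_edge[OF L x] r by (simp add: K_ed)
    next
      fix x y assume x: "x \<in> set (butlast L)" and y: "y \<in> set (tl L)" and m: "snd x \<in> M ed (fst y)"
      have "ed r (fst x) (snd x)" using chn_edge[OF L] x by (auto dest: in_set_butlastD)
      then have xp: "snd x \<noteq> p" using less.prems(5) by (auto simp: M_def)
      show "snd x \<in> M ?e (fst y)"
      proof (cases "snd x = c")
        case True
        obtain A B where AB: "tl L = A @ y # B" using split_list[OF y] by blast
        have LL: "L = (hd L # A) @ (y # B)" using AB chn_Nil[OF L] by (metis append_Cons list.collapse)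
        have chB: "chn ed (y # B)" using L LL chn_suffix by (metis list.distinct(1))
        have lB: "length (y # B) < length L" "last (y # B) = last L"
          by (subst LL, simp)+
        have "fst (hd (y # B)) \<in> kcomp ed p c r"
          by (rule less.hyps[OF lB(1) v chB]) (use lB(2) less.prems m True in simp_all)
        then have "fst y \<notin> ?S" using notS by simp
        then show ?thesis using m by (simp add: M_K[OF n])
      next
        case False
        then show ?thesis using m xp by (simp add: M_K[OF n])
      qed
    qed
    have "p \<in> M ?e ?w" using less.prems(4) by (simp add: M_K[OF n])
    moreover have "p \<in> M ?e r" using less.prems(5) r by (simp add: M_K[OF n])
    moreover have "src L \<in> M ?e s"
    proof (cases "src L = c")
      case True
      then have "s \<notin> ?S" using s_linked_r[OF v _ less.prems(5)] less.prems(3) notS by blast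
      then show ?thesis using less.prems(3) by (simp add: M_K[OF n])
    next
      case False
      have "src L \<noteq> p" using nocol[OF v less.prems(5)] less.prems(3) by blast
      then show ?thesis using False less.prems(3) by (simp add: M_K[OF n])
    qed
    ultimately show False using chain_avoids_r[OF valid_K[OF v n] ch] by blast
  qed
qed

lemma Fv_chain:
  assumes "pcol ed" "Fv ed y" "y \<noteq> s"
  obtains a k L where "a \<in> M ed s" "k \<in> D ed a" "ed r y k" "chn ed ((y, k) # L)" "src ((y, k) # L) = a"
proof -
  obtain a k where a: "a \<in> M ed s" "k \<in> D ed a" "ed r y k" using assms(2,3) by (auto simp: Fv_def C_def)
  then show ?thesis using D_chain[OF assms(1) a(2,3)] that by blast
qed

lemma fan_linked_r:
  assumes "valid ed" "Fv ed y" "c \<in> M ed y" "p \<in> M ed r"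
  shows "y \<in> kcomp ed p c r"
proof (cases "y = s")
  case True
  then show ?thesis using s_linked_r assms by blast
next
  case False
  obtain a k L where "a \<in> M ed s" "chn ed ((y, k) # L)" "src ((y, k) # L) = a"
    using Fv_chain[OF valid_pcol[OF assms(1)] assms(2) False] by metis
  then show ?thesis using chain_linked_r[OF assms(1), of "(y, k) # L" c p] assms by simp
qed

lemma Fv_r: "pcol ed \<Longrightarrow> Fv ed y \<Longrightarrow> y \<noteq> r"
  unfolding Fv_def using rs(1) pcolD(5) by metis

text \<open>Two fan vertices missing \<open>c\<close> would, together with \<open>r\<close>, be
  three ends of one component.\<close>

lemma fan_elementary:
  assumes v: "valid ed" and y: "Fv ed y" "c \<in> M ed y" and z: "Fv ed z" "c \<in> M ed z"
  shows "y = z"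
proof (rule ccontr)
  assume ne: "y \<noteq> z"
  note pc = valid_pcol[OF v]
  obtain p where p: "p \<in> M ed r" using valid_r[OF v] by blast
  have "p \<noteq> c" using fan_avoids_r[OF v y] p by blast
  then show False
    using three_ends[OF pc, of p c r r y z] fan_linked_r[OF v y p] fan_linked_r[OF v z p] Fv_r[OF pc] y z p ne by auto
qed

section \<open>Recolourings that leave the fan unchanged\<close>

text \<open>These are exactly the data from which the fan is built, so \<open>D\<close> (for colours
  missing at \<open>s\<close>), \<open>C\<close> and \<open>Fv\<close> are the same in both
  colourings.\<close>

definition stable :: "'a col \<Rightarrow> 'a col \<Rightarrow> bool" where
  "stable ed ed' \<longleftrightarrow> M ed' r = M ed r \<and> (\<forall>y. Fv ed y \<longrightarrow> M ed' y = M ed y) \<and> (\<forall>y k. ed' r y k = ed r y k)"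

lemma stableD:
  assumes "stable ed ed'"
  shows "M ed' r = M ed r" "Fv ed y \<Longrightarrow> M ed' y = M ed y" "ed' r y k = ed r y k" "M ed' s = M ed s"
  using assms unfolding stable_def by simp_all

lemma stable_D:
  assumes st: "stable ed ed'" and a: "a \<in> M ed s"
  shows "D ed' a = D ed a"
proof
  show "D ed' a \<subseteq> D ed a"
  proof
    fix k assume "k \<in> D ed' a"
    then show "k \<in> D ed a"
    proof induction
      case D0
      show ?case by (rule D.D0)
    next
      case (D1 k v k')
      have e: "ed r v k" using D1.hyps(2) stableD(3)[OF st] by simp
      have "Fv ed v" using e D1.IH a by (auto simp: Fv_def C_def)
      then show ?case using D.D1[OF D1.IH e] D1.hyps(3) stableD(2)[OF st] by simp
    qed
  qed
  show "D ed a \<subseteq> D ed' a"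
  proof
    fix k assume "k \<in> D ed a"
    then show "k \<in> D ed' a"
    proof induction
      case D0
      show ?case by (rule D.D0)
    next
      case (D1 k v k')
      have e: "ed' r v k" using D1.hyps(2) stableD(3)[OF st] by simp
      have "Fv ed v" using D1.hyps a by (auto simp: Fv_def C_def)
      then show ?case using D.D1[OF D1.IH e] D1.hyps(3) stableD(2)[OF st] by simp
    qed
  qed
qed

lemma stable_C: "stable ed ed' \<Longrightarrow> C ed' = C ed"
  using stable_D[of ed ed'] stableD(4)[of ed ed'] unfolding C_def by simp

lemma stable_Fv: "stable ed ed' \<Longrightarrow> Fv ed' y = Fv ed y"
  using stable_C[of ed ed'] stableD(3)[of ed ed'] unfolding Fv_def by simp

text \<open>Fan vertices missing \<open>c\<close> lie in the component of \<open>r\<close>, and no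
  fan vertex misses \<open>p\<close>. A component avoiding \<open>r\<close> therefore meets the fan
  only in vertices where both colours are present.\<close>

lemma fan_stable:
  assumes v: "valid ed" and p: "p \<in> M ed r" and c: "c < n" and z: "z \<notin> kcomp ed p c r"
  shows "stable ed (K ed p c z)"
proof -
  note pc = valid_pcol[OF v]
  have n: "p < n" using p M_less by auto
  have r: "r \<notin> kcomp ed p c z" using notin_comp_sym[OF pc z] .
  have "M (K ed p c z) y = M ed y" if y: "Fv ed y" for y
  proof (cases "y \<in> kcomp ed p c z")
    case True
    have "c \<notin> M ed y"
    proof
      assume "c \<in> M ed y"
      then have "y \<in> kcomp ed p c r" using fan_linked_r[OF v y] p by blast
      then have "kcomp ed p c r = kcomp ed p c z" using True comp_eq[OF pc] by metis
      then show False using r by auto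
    qed
    moreover have "p \<notin> M ed y" using fan_avoids_r[OF v y] p by blast
    ultimately show ?thesis using sw_notin by (intro set_eqI) (simp add: M_K[OF n c] True)
  next
    case False
    then show ?thesis by (intro set_eqI) (simp add: M_K[OF n c])
  qed
  moreover have "M (K ed p c z) r = M ed r" using r by (intro set_eqI) (simp add: M_K[OF n c])
  moreover have "K ed p c z r y k = ed r y k" for y k using r by (simp add: K_ed)
  ultimately show ?thesis unfolding stable_def by blast
qed

text \<open>A reachable colour is missing at one fan vertex only, and the edge from \<open>r\<close>
  to it has one colour. So the derivation of a reachable colour can be traced back in a unique way,
  to a single root.\<close>

lemma D_disjoint:
  assumes v: "valid ed" and ab: "a \<in> M ed s" "b \<in> M ed s" "a \<noteq> b"
  shows "D ed a \<inter> D ed b = {}"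
proof -
  have "k \<notin> D ed b" if "k \<in> D ed a" for k
    using that
  proof induction
    case D0
    show ?case
    proof
      assume "a \<in> D ed b"
      then show False
      proof cases
        case D0
        then show False using ab by simp
      next
        case (D1 k v')
        have "Fv ed v'" using D1 ab by (auto simp: Fv_def C_def)
        then show False using fan_elementary[OF v _ D1(3) Fv_s ab(1)] D1(2) valid_not_s[OF v] by metis
      qed
    qed
  next
    case (D1 k v1 k')
    have f1: "Fv ed v1" using D1 ab by (auto simp: Fv_def C_def)
    show ?case
    proof
      assume "k' \<in> D ed b"
      then show False
      proof cases
        case D0
        then show False using fan_elementary[OF v f1 D1.hyps(3) Fv_s] ab(2) D1.hyps(2) valid_not_s[OF v] by metis
      next
        case (D1 k2 v2)
        have "Fv ed v2" using D1 ab by (auto simp: Fv_def C_def)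
        then have "v1 = v2" using fan_elementary[OF v f1 \<open>k' \<in> M ed v1\<close> _ D1(3)] by blast
        then have "k = k2" using \<open>ed r v1 k\<close> D1(2) pcol_col[OF valid_pcol[OF v]] by blast
        then show False using \<open>k \<notin> D ed b\<close> D1(1) by simp
      qed
    qed
  qed
  then show ?thesis by blast
qed

lemma finC: "finite (C ed)"
  using C_less by (intro finite_subset[of "C ed" "{..<n}"]) auto

text \<open>If every colour of the half led to a vertex missing some colour, choosing one there
  would map the half injectively into itself, by elementarity. The root \<open>a\<close> would not
  be hit, because only \<open>s\<close> misses it; this is impossible for a finite set.\<close>

lemma root_end:
  assumes v: "valid ed" and a: "a \<in> M ed s"
  shows "\<exists>k\<in>D ed a. \<exists>w. ed r w k \<and> M ed w = {}"
proof (rule ccontr)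
  assume no: "\<not> ?thesis"
  note pc = valid_pcol[OF v]
  have "\<exists>w k'. ed r w k \<and> k' \<in> M ed w" if "k \<in> D ed a" for k
    using C_edge[OF v C_I[OF a that]] no that by blast
  then obtain W g where g: "\<And>k. k \<in> D ed a \<Longrightarrow> ed r (W k) k \<and> g k \<in> M ed (W k)" by metis
  have F: "Fv ed (W k)" if "k \<in> D ed a" for k using g[OF that] C_I[OF a that] Fv_I by blast
  have "inj_on g (D ed a)"
  proof (rule inj_onI)
    fix k l assume k: "k \<in> D ed a" and l: "l \<in> D ed a" and eq: "g k = g l"
    have "W k = W l" using fan_elementary[OF v F[OF k] _ F[OF l]] g[OF k] g[OF l] eq by metis
    then show "k = l" using g[OF k] g[OF l] pcol_col[OF pc] by metis
  qed
  moreover have "g ` D ed a \<subseteq> D ed a - {a}"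
  proof
    fix x assume "x \<in> g ` D ed a"
    then obtain k where k: "k \<in> D ed a" "x = g k" by blast
    have "x \<in> D ed a" using D.D1[OF k(1)] g[OF k(1)] k(2) by blast
    moreover have "x \<noteq> a"
    proof
      assume "x = a"
      then have "W k = s" using fan_elementary[OF v F[OF k(1)] _ Fv_s] g[OF k(1)] k(2) a by blast
      then show False using g[OF k(1)] valid_not_s[OF v] by simp
    qed
    ultimately show "x \<in> D ed a - {a}" by simp
  qed
  moreover have f: "finite (D ed a)" by (rule finite_subset[OF _ finC]) (use C_I[OF a] in blast)
  ultimately have "card (D ed a) \<le> card (D ed a - {a})" by (intro card_inj_on_le[of g]) auto
  moreover have "card (D ed a - {a}) < card (D ed a)" using f D.D0 by (rule card_Diff1_less)
  ultimately show False by simp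
qed

text \<open>The only use of lightness: both halves of the fan already contain a saturated vertex.\<close>
lemma full_neighbour_C:
  assumes v: "valid ed" and w: "ed r w k" "M ed w = {}"
  shows "k \<in> C ed"
proof -
  note pc = valid_pcol[OF v]
  obtain a b where ab: "a \<noteq> b" "M ed s = {a, b}" using valid_s[OF v] by blast
  obtain ka wa where a: "ka \<in> D ed a" "ed r wa ka" "M ed wa = {}" using root_end[OF v, of a] ab by auto
  obtain kb wb where b: "kb \<in> D ed b" "ed r wb kb" "M ed wb = {}" using root_end[OF v, of b] ab by auto
  have "ka \<noteq> kb" using D_disjoint[OF v, of a b] a(1) b(1) ab by auto
  then have ne: "wa \<noteq> wb" using a(2) b(2) pcol_col[OF pc] by blast
  let ?Z = "{v. G r v \<and> M ed v = {}}"
  have "?Z \<subseteq> V"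
  proof
    fix z assume "z \<in> ?Z"
    then obtain c where "ed r z c" using valid_ex[OF v] by blast
    then show "z \<in> V" by (rule pcolD(4)[OF pc])
  qed
  then have fZ: "finite ?Z" using finV finite_subset by blast
  have sub: "{wa, wb} \<subseteq> ?Z" using a b valid_G[OF v] by auto
  moreover have "card ?Z \<le> card {wa, wb}" using valid_light[OF v] ne by simp
  ultimately have "{wa, wb} = ?Z" using card_seteq[OF fZ] by blast
  moreover have "w \<in> ?Z" using w valid_G[OF v] by auto
  ultimately have "w = wa \<or> w = wb" by blast
  then have "k = ka \<or> k = kb" using w(1) a(2) b(2) pcol_col[OF pc] by blast
  then show ?thesis using a(1) b(1) ab C_I[of a] C_I[of b] by auto
qed

text \<open>Otherwise an exchange of \<open>b\<close> and \<open>c\<close> at \<open>s\<close> makes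
  \<open>s\<close> miss \<open>c\<close>, which the head still misses. The colours of the chain
  avoid \<open>b\<close> and \<open>c\<close>, so the chain survives with root \<open>a\<close>, and
  two fan vertices miss \<open>c\<close>.\<close>

lemma chain_linked_s:
  assumes v: "valid ed" and ab: "a \<in> M ed s" "b \<in> M ed s" "a \<noteq> b"
    and L: "chn ed L" "src L = a" and c: "c \<in> M ed (fst (hd L))"
  shows "fst (hd L) \<in> kcomp ed b c s"
proof (rule ccontr)
  let ?y = "fst (hd L)"
  assume ny: "?y \<notin> kcomp ed b c s"
  note pc = valid_pcol[OF v]
  have Fx: "Fv ed (fst x)" if "x \<in> set L" for x
    using chn_edge[OF L(1) that] chain_D[OF L(1)] that L(2) ab(1) by (intro Fv_I[of "snd x"]) (auto intro: C_I)
  have hdL: "hd L \<in> set L" using chn_Nil[OF L(1)] by simp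
  have ys: "?y \<noteq> s" by (rule chn_s[OF v L(1) hdL])
  have n: "b < n" "c < n" using ab c M_less by auto
  have cs: "c \<notin> M ed s" using fan_elementary[OF v Fx[OF hdL] c Fv_s] ys by blast
  have bt: "b \<notin> M ed (fst x)" if "x \<in> set L" for x
    using fan_elementary[OF v Fx[OF that] _ Fv_s] ab(2) chn_s[OF v L(1) that] by blast
  have ct: "c \<notin> M ed (fst x)" if "x \<in> set (tl L)" for x
    using fan_elementary[OF v Fx _ Fx[OF hdL] c, of x] chn_hd_tl[OF L(1) that] by blast
  have col: "snd x \<noteq> b \<and> snd x \<noteq> c" if x: "x \<in> set L" for x
  proof (cases "x \<in> set (butlast L)")
    case True
    then obtain z where "z \<in> set (tl L)" "snd x \<in> M ed (fst z)" using chn_tl[OF _ L(1)] by blast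
    then show ?thesis using bt[of z] ct[of z] chn_hd_tl[OF L(1)] by metis
  next
    case False
    have "L = butlast L @ [last L]" using chn_Nil[OF L(1)] by simp
    then have "set L = set (butlast L) \<union> {last L}" by (metis list.set(1) list.simps(15) set_append)
    then have "x = last L" using False x by blast
    then have "snd x = a" using L(2) by simp
    then show ?thesis using ab cs by auto
  qed
  let ?e = "K ed b c s"
  have ve: "valid ?e" by (rule valid_K[OF v n])
  have "chn ?e L"
  proof (rule chn_mono[OF L(1)])
    fix x assume x: "x \<in> set L"
    show "?e r (fst x) (snd x)" using chn_edge[OF L(1) x] col[OF x] by (simp add: K_ed)
  next
    fix x y assume "x \<in> set (butlast L)" "snd x \<in> M ed (fst y)"
    then show "snd x \<in> M ?e (fst y)" using col[of x] by (simp add: M_K[OF n] in_set_butlastD)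
  qed
  moreover have "a \<in> M ?e s" using ab cs by (cases "a = c") (simp_all add: M_K[OF n])
  ultimately have "Fv ?e ?y"
    using chain_D[of ?e L] chn_edge[of ?e L "hd L"] hdL L(2) by (intro Fv_I[of "snd (hd L)"]) (auto intro: C_I)
  moreover have "c \<in> M ?e ?y" using c ny by (simp add: M_K[OF n])
  moreover have "c \<in> M ?e s" using ab by (simp add: M_K[OF n])
  ultimately show False using fan_elementary[OF ve _ _ Fv_s] ys by blast
qed

lemma fan_linked_s:
  assumes "valid ed" "a \<in> M ed s" "b \<in> M ed s" "a \<noteq> b" "k \<in> D ed a" "ed r y k" "c \<in> M ed y"
  shows "y \<in> kcomp ed b c s"
proof -
  obtain L where "chn ed ((y, k) # L)" "src ((y, k) # L) = a"
    using D_chain[OF valid_pcol[OF assms(1)] assms(5,6)] by blast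
  then show ?thesis using chain_linked_s[OF assms(1-4), of "(y, k) # L" c] assms(7) by simp
qed

section \<open>Chains of unreachable colours\<close>

definition free_chn :: "'a col \<Rightarrow> ('a \<times> nat) list \<Rightarrow> bool" where
  "free_chn ed L \<longleftrightarrow> chn ed L \<and> snd ` set L \<inter> C ed = {}"

lemma free_chn_append:
  assumes "pcol ed" "free_chn ed (A @ B)" "A \<noteq> []" "B \<noteq> []"
  shows "free_chn ed A" "free_chn ed B" "src A \<in> M ed (fst (hd B))" "y \<in> set B \<Longrightarrow> snd y \<noteq> src A"
    "fst ` set A \<inter> fst ` set B = {}"
proof -
  have ch: "chn ed (A @ B)" using assms(2) by (simp add: free_chn_def)
  then show "free_chn ed A" "free_chn ed B" "src A \<in> M ed (fst (hd B))" "fst ` set A \<inter> fst ` set B = {}"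
    using assms(2) chn_append[OF assms(3,4), of ed] by (auto simp: free_chn_def)
  have "distinct (map snd (A @ B))" by (rule chn_snd_distinct[OF assms(1) ch])
  then have "snd ` set A \<inter> snd ` set B = {}" by simp
  moreover have "src A \<in> snd ` set A" using assms(3) by (intro imageI) simp
  ultimately show "snd y \<noteq> src A" if "y \<in> set B" using imageI[OF that, of snd] by (metis disjoint_iff)
qed

text \<open>Take a longest free chain with source \<open>f\<close>. Its head is not saturated by
  \<open>full_neighbour_C\<close>, so it misses some \<open>k\<close>. If \<open>k\<close> is
  unreachable and present at \<open>r\<close>, maximality forces the edge of colour \<open>k\<close>
  at \<open>r\<close> back into the list. It leads to the last vertex (\<open>cycle\<close>) or to
  an earlier one (\<open>rho\<close>); there the list splits into \<open>A\<close> and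
  \<open>B\<close>, whose heads both miss the same colour.\<close>

lemma greedy:
  assumes v: "valid ed" and f: "f < n" "f \<notin> C ed" "f \<notin> M ed r"
  obtains (hit) L c where "free_chn ed L" "src L = f" "c \<in> M ed (fst (hd L))" "c \<in> C ed \<or> c \<in> M ed r"
  | (cycle) L where "free_chn ed L" "src L = f" "f \<in> M ed (fst (hd L))"
  | (rho) A B e where "free_chn ed (A @ B)" "src (A @ B) = f" "A \<noteq> []" "B \<noteq> []" "src A = e"
      "e \<in> M ed (fst (hd B))" "e \<in> M ed (fst (hd A))" "e \<notin> C ed" "e \<notin> M ed r"
proof -
  note pc = valid_pcol[OF v]
  let ?P = "\<lambda>L. free_chn ed L \<and> src L = f"
  obtain v0 where v0: "ed r v0 f" using notM f by blast
  have P0: "?P [(v0, f)]" using f v0 by (simp add: free_chn_def chn_single)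
  have "length L \<le> card V" if "?P L" for L
  proof -
    have ch: "chn ed L" using that by (simp add: free_chn_def)
    have "fst ` set L \<subseteq> V" using chn_edge[OF ch] pcolD(4)[OF pc] by blast
    moreover have "card (fst ` set L) = length L" using ch by (metis chn_def distinct_card length_map set_map)
    ultimately show ?thesis using card_mono[OF finV] by metis
  qed
  then have "\<forall>L. ?P L \<longrightarrow> length L < Suc (card V)" by (simp add: less_Suc_eq_le)
  from ex_has_greatest_nat[where P = ?P and f = length, OF P0 this]
  obtain L where L: "?P L" and mx: "\<And>L'. ?P L' \<Longrightarrow> length L' \<le> length L" by blast
  have ch: "chn ed L" and fr: "snd ` set L \<inter> C ed = {}" using L by (simp_all add: free_chn_def)
  have hdL: "hd L \<in> set L" using chn_Nil[OF ch] by simp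
  have "snd (hd L) \<notin> C ed" using fr hdL by blast
  then have "M ed (fst (hd L)) \<noteq> {}" using full_neighbour_C[OF v chn_edge[OF ch hdL]] by blast
  then obtain k where k: "k \<in> M ed (fst (hd L))" by blast
  show thesis
  proof (cases "k \<in> C ed \<or> k \<in> M ed r")
    case True
    then show thesis using hit[of L k] L k by blast
  next
    case False
    obtain z where z: "ed r z k" using notM[OF M_less[OF k]] False by blast
    have zin: "z \<in> fst ` set L"
    proof (rule ccontr)
      assume "z \<notin> fst ` set L"
      then have "chn ed ((z, k) # L)" using chn_Cons[OF chn_Nil[OF ch], of ed "(z, k)"] ch z k by simp
      then have "?P ((z, k) # L)" using L fr False chn_Nil[OF ch] by (simp add: free_chn_def)
      then show False using mx by fastforce
    qed
    then obtain x where x: "x \<in> set L" "z = fst x" by (elim imageE)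
    have "snd x = k" using chn_edge[OF ch x(1)] z x(2) pcol_col[OF pc] by blast
    obtain A' B where AB: "L = A' @ x # B" using split_list[OF x(1)] by blast
    show thesis
    proof (cases "B = []")
      case True
      then have "f = k" using L AB \<open>snd x = k\<close> by simp
      then show thesis using cycle[of L] L k by blast
    next
      case B: False
      have e: "L = (A' @ [x]) @ B" using AB by simp
      have c2: "chn ed ((A' @ [x]) @ B)" using ch e by simp
      then have "src (A' @ [x]) \<in> M ed (fst (hd B))" by (subst (asm) chn_append) (simp_all add: B)
      moreover have "hd (A' @ [x]) = hd L" by (subst e) (simp add: hd_append)
      ultimately show thesis using rho[of "A' @ [x]" B k] L e k False B \<open>snd x = k\<close> by simp
    qed
  qed
qed

lemma valid_r_eq: "valid ed \<Longrightarrow> p \<in> M ed r \<Longrightarrow> M ed r = {p}"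
  using valid_r[of ed] by auto

lemma valid_s_eq: "valid ed \<Longrightarrow> a \<in> M ed s \<Longrightarrow> b \<in> M ed s \<Longrightarrow> a \<noteq> b \<Longrightarrow> M ed s = {a, b}"
  using valid_s[of ed] by auto

lemma stable_K:
  assumes "p < n" "q < n" "r \<notin> kcomp ed p q w"
    and "\<And>z. Fv ed z \<Longrightarrow> z \<in> kcomp ed p q w \<Longrightarrow> p \<notin> M ed z \<and> q \<notin> M ed z"
  shows "stable ed (K ed p q w)"
  unfolding stable_def
proof (intro conjI allI impI)
  show "M (K ed p q w) r = M ed r" by (rule M_K_out[OF assms(1-3)])
  show "K ed p q w r y k = ed r y k" for y k using K_ed_out[OF assms(3)] by simp
  show "M (K ed p q w) y = M ed y" if "Fv ed y" for y
    using M_K_out[OF assms(1,2)] M_K_same[OF assms(1,2)] assms(4)[OF that] by metis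
qed

lemma chn_K:
  assumes "chn ed L" "p < n" "q < n"
    and "r \<notin> kcomp ed p q v \<or> p \<notin> snd ` set L \<and> q \<notin> snd ` set L"
    and "\<And>z. z \<in> set (butlast L) \<Longrightarrow> snd z \<noteq> p \<and> snd z \<noteq> q"
  shows "chn (K ed p q v) L"
proof (rule chn_mono[OF assms(1)])
  fix z assume z: "z \<in> set L"
  show "K ed p q v r (fst z) (snd z)"
  proof (cases "r \<in> kcomp ed p q v")
    case True
    then have "snd z \<noteq> p" "snd z \<noteq> q" using assms(4) z by auto
    then show ?thesis using chn_edge[OF assms(1) z] by (simp add: K_ed_other)
  next
    case False
    then show ?thesis using chn_edge[OF assms(1) z] by (simp add: K_ed_out)
  qed
next
  fix z y assume "z \<in> set (butlast L)" "snd z \<in> M ed (fst y)"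
  then show "snd z \<in> M (K ed p q v) (fst y)" using assms(5)[of z] assms(2,3) by (simp add: M_K_other)
qed

lemma chain_Fv:
  assumes "chn ed L" "src L \<in> M ed s" "z \<in> set L" shows "Fv ed (fst z)"
  using chn_edge[OF assms(1,3)] chain_D[OF assms(1)] assms(2,3) by (intro Fv_I[of "snd z"]) (auto intro: C_I)

lemma chain_elem:
  assumes "valid ed" "chn ed L" "src L \<in> M ed s" "c \<in> M ed (fst (hd L))" "c \<in> M ed s"
  shows False
proof -
  have h: "hd L \<in> set L" using chn_Nil[OF assms(2)] by simp
  show False using fan_elementary[OF assms(1) chain_Fv[OF assms(2,3) h] assms(4) Fv_s assms(5)] chn_s[OF assms(1,2) h] by blast
qed

lemma set_butlast_last: "L \<noteq> [] \<Longrightarrow> z \<in> set L \<Longrightarrow> z \<in> set (butlast L) \<or> z = last L"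
  by (metis append_butlast_last_id empty_iff empty_set in_set_butlast_appendI insert_iff list.simps(15) set_append Un_iff)

lemma chain_col:
  assumes v: "valid ed" and L: "chn ed L" "src L \<in> M ed s"
  shows "b \<in> M ed s \<Longrightarrow> b \<noteq> src L \<Longrightarrow> b \<notin> snd ` set L"
    and "c \<in> M ed (fst (hd L)) \<Longrightarrow> c \<notin> snd ` set L"
proof -
  have *: "z \<in> set (tl L) \<Longrightarrow> Fv ed (fst z)" for z using chain_Fv[OF L] chn_hd_tl(2)[OF L(1)] by blast
  have h: "hd L \<in> set L" using chn_Nil[OF L(1)] by simp
  show "b \<notin> snd ` set L" if b: "b \<in> M ed s" "b \<noteq> src L"
  proof
    assume "b \<in> snd ` set L"
    then obtain z where z: "z \<in> set L" "snd z = b" by blast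
    then have "z \<in> set (butlast L)" using set_butlast_last[OF chn_Nil[OF L(1)]] b(2) by blast
    then obtain y where y: "y \<in> set (tl L)" "b \<in> M ed (fst y)" using chn_tl[OF _ L(1)] z(2) by blast
    then show False using fan_elementary[OF v * _ Fv_s b(1)] chn_s[OF v L(1) chn_hd_tl(2)[OF L(1)]] by blast
  qed
  show "c \<notin> snd ` set L" if c: "c \<in> M ed (fst (hd L))"
  proof
    assume "c \<in> snd ` set L"
    then obtain z where z: "z \<in> set L" "snd z = c" by blast
    show False
    proof (cases "z \<in> set (butlast L)")
      case True
      then obtain y where y: "y \<in> set (tl L)" "c \<in> M ed (fst y)" using chn_tl[OF _ L(1)] z(2) by blast
      then show False using fan_elementary[OF v * _ chain_Fv[OF L h] c] chn_hd_tl(1)[OF L(1)] by blast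
    next
      case False
      then have "c = src L" using set_butlast_last[OF chn_Nil[OF L(1)]] z by blast
      then show False using chain_elem[OF v L c] L(2) by simp
    qed
  qed
qed

lemma free_chnD: "free_chn ed L \<Longrightarrow> chn ed L" "free_chn ed L \<Longrightarrow> z \<in> set L \<Longrightarrow> snd z \<notin> C ed"
  unfolding free_chn_def by auto

lemma chn_not_r: "chn ed L \<Longrightarrow> z \<in> set L \<Longrightarrow> snd z \<notin> M ed r"
  using chn_edge by (fastforce simp: M_def)

lemma free_Fv: "valid ed \<Longrightarrow> free_chn ed L \<Longrightarrow> z \<in> set L \<Longrightarrow> \<not> Fv ed (fst z)"
  using free_chnD chn_edge chn_s pcol_col[OF valid_pcol] unfolding Fv_def by metis

lemma free_stable: "free_chn ed L \<Longrightarrow> stable ed ed' \<Longrightarrow> chn ed' L \<Longrightarrow> free_chn ed' L"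
  by (simp add: free_chn_def stable_C)

text \<open>After the exchange \<open>y\<close> misses \<open>k\<close>, which leads along
  \<open>rw\<close> to \<open>w\<close>, and \<open>w\<close> still misses \<open>t\<close>. Old
  derivations can be replayed, with a detour through \<open>k\<close> wherever they obtained
  \<open>t\<close> from \<open>y\<close>.\<close>

lemma C_grow:
  assumes v: "valid ed" and y: "Fv ed y" "t \<in> M ed y" and k: "k \<notin> C ed" "ed r w k" "t \<in> M ed w"
    and rn: "r \<notin> kcomp ed t k y"
  shows "C ed \<subseteq> C (K ed t k y)" "k \<in> C (K ed t k y)"
proof -
  note pc = valid_pcol[OF v]
  let ?e = "K ed t k y"
  have n: "t < n" "k < n" using y M_less pcolD(2)[OF pc k(2)] by auto
  have tk: "t \<noteq> k" using y Fv_M[OF y(1)] k by blast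
  have wn: "w \<notin> kcomp ed t k y" using rn comp_edge[OF pc, of r w t k y] k(2) by blast
  have tw: "t \<in> M ?e w" using k(3) M_K_out[OF n wn] by simp
  have er: "?e r z j \<longleftrightarrow> ed r z j" for z j by (rule K_ed_out[OF rn])
  have ky: "k \<in> M ?e y" using y n by (simp add: M_K)
  have step: "t \<in> C ?e" if "k \<in> C ?e" using C_step[OF that _ tw] er k(2) by blast
  have main: "c \<in> C ?e" if "c \<in> D ed a" "a \<in> M ed s" for c a
    using that
  proof (induction rule: D.induct)
    case D0
    show ?case
    proof (cases "a = t")
      case True
      then have "y = s" using fan_elementary[OF v y Fv_s] D0 by blast
      then have "k \<in> C ?e" using ky M_s_C by blast
      then show ?thesis using step True by simp
    next
      case False
      moreover have "a \<noteq> k" using D0 k(1) M_s_C by blast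
      ultimately have "a \<in> M ?e s" using D0 by (simp add: M_K_other[OF n])
      then show ?thesis by (rule M_s_C)
    qed
  next
    case (D1 j z j')
    have jC: "j \<in> C ed" "j' \<in> C ed" using D1 C_I D.D1 by blast+
    have e: "?e r z j" using D1 er by simp
    show ?case
    proof (cases "j' = t")
      case True
      then have "z = y" using fan_elementary[OF v Fv_I[OF jC(1) D1(2)] _ y] D1 by blast
      then have "k \<in> C ?e" using C_step[OF D1.IH[OF D1.prems] e] ky by blast
      then show ?thesis using step True by simp
    next
      case False
      moreover have "j' \<noteq> k" using jC k(1) by blast
      ultimately have "j' \<in> M ?e z" using D1 by (simp add: M_K_other[OF n])
      then show ?thesis by (rule C_step[OF D1.IH[OF D1.prems] e])
    qed
  qed
  then show sub: "C ed \<subseteq> C ?e" by (auto simp: C_def)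
  show "k \<in> C ?e"
  proof (cases "y = s")
    case True
    then show ?thesis using ky M_s_C by blast
  next
    case False
    then obtain j where "j \<in> C ed" "ed r y j" using y(1) by (auto simp: Fv_def)
    then show ?thesis using C_step[of j ?e y k] sub er ky by blast
  qed
qed

text \<open>The vertices of a free chain are outside the fan, and after the shift their edges to
  \<open>r\<close> have the colour \<open>p\<close> or unreachable colours. So no derivation of a
  reachable colour gains or loses a step.\<close>

lemma shift_D:
  assumes v: "valid ed" and L: "free_chn ed L" and p: "p \<in> M ed r" and sh: "shifted ed ed' L p"
  shows "M ed' s = M ed s" "a \<in> M ed s \<Longrightarrow> D ed' a = D ed a" "C ed' = C ed" "M ed' r = {src L}"
proof -
  note ch = free_chnD(1)[OF L] and s' = shiftedD[OF sh]
  have "s \<notin> fst ` set L" using chn_s[OF v ch] by blast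
  then show Ms: "M ed' s = M ed s" using s'(3)[of s] rs(1) by simp
  show "M ed' r = {src L}" by (rule valid_r_eq[OF s'(1,2)])
  have nF: "y \<notin> fst ` set L" if "Fv ed y" for y using free_Fv[OF v L] that by blast
  have nr: "y \<noteq> r" if "Fv ed y" for y using Fv_r[OF valid_pcol[OF v] that] .
  show Da: "D ed' a = D ed a" if a: "a \<in> M ed s" for a
  proof
    show "D ed' a \<subseteq> D ed a"
    proof
      fix k assume "k \<in> D ed' a"
      then show "k \<in> D ed a"
      proof induction
        case D0
        show ?case by (rule D.D0)
      next
        case (D1 k y k')
        have kC: "k \<in> C ed" by (rule C_I[OF a D1.IH])
        have yL: "y \<notin> fst ` set L"
        proof
          assume "y \<in> fst ` set L"
          then have "k = p \<or> k \<in> snd ` set L" using s'(6) D1.hyps(2) by blast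
          then show False using C_not_r[OF v kC] p free_chnD(2)[OF L] kC by blast
        qed
        then have e: "ed r y k" using s'(5) D1.hyps(2) by blast
        have "k' \<in> M ed y" using s'(3)[OF nr[OF Fv_I[OF kC e]] yL] D1.hyps(3) by simp
        then show ?case by (rule D.D1[OF D1.IH e])
      qed
    qed
    show "D ed a \<subseteq> D ed' a"
    proof
      fix k assume "k \<in> D ed a"
      then show "k \<in> D ed' a"
      proof induction
        case D0
        show ?case by (rule D.D0)
      next
        case (D1 k y k')
        have F: "Fv ed y" using Fv_I[OF C_I[OF a D1.hyps(1)] D1.hyps(2)] .
        have "ed' r y k" using s'(5)[OF nF[OF F]] D1.hyps(2) by simp
        moreover have "k' \<in> M ed' y" using s'(3)[OF nr[OF F] nF[OF F]] D1.hyps(3) by simp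
        ultimately show ?case by (rule D.D1[OF D1.IH])
      qed
    qed
  qed
  show "C ed' = C ed" unfolding C_def Ms using Da by simp
qed

text \<open>The source colour may be \<open>t\<close>: no vertex of the list is required to miss it,
  and the edges at \<open>r\<close> keep their colours because \<open>r\<close> is outside the
  component.\<close>

lemma free_swap:
  assumes v: "valid ed" and p: "p \<in> M ed r" and L: "free_chn ed L" and t: "t < n"
    and z: "z \<notin> kcomp ed p t r" and b: "\<forall>y\<in>set (butlast L). snd y \<noteq> t"
  shows "valid (K ed p t z)" "stable ed (K ed p t z)" "free_chn (K ed p t z) L"
proof -
  note pc = valid_pcol[OF v] and ch = free_chnD(1)[OF L]
  have n: "p < n" using p M_less by blast
  show "valid (K ed p t z)" by (rule valid_K[OF v n t])
  show st: "stable ed (K ed p t z)" by (rule fan_stable[OF v p t z])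
  have "snd y \<noteq> p" if "y \<in> set L" for y using chn_not_r[OF ch that] p by metis
  then have "chn (K ed p t z) L"
    by (intro chn_K[OF ch n t]) (use notin_comp_sym[OF pc z] b in_set_butlastD in fast)+
  then show "free_chn (K ed p t z) L" by (rule free_stable[OF L st])
qed

text \<open>The ends of the component of \<open>r\<close> are already known: \<open>r\<close> itself
  and the fan vertex missing \<open>t\<close>.\<close>

lemma hit_out:
  assumes v: "valid ed" and p: "p \<in> M ed r" and L: "free_chn ed L" and t: "t \<in> M ed (fst (hd L))" "t \<in> C ed"
  shows "fst (hd L) \<notin> kcomp ed p t r"
proof
  assume w: "fst (hd L) \<in> kcomp ed p t r"
  note pc = valid_pcol[OF v] and ch = free_chnD(1)[OF L]
  have h: "hd L \<in> set L" using chn_Nil[OF ch] by simp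
  obtain y where y: "Fv ed y" "t \<in> M ed y" using C_holder[OF t(2)] .
  have "p \<noteq> t" using C_not_r[OF v t(2)] p by blast
  moreover have "y \<noteq> fst (hd L)" using free_Fv[OF v L h] y(1) by blast
  ultimately show False
    using three_ends[OF pc, of p t r r y "fst (hd L)"] fan_linked_r[OF v y p] w Fv_r[OF pc y(1)] chn_r[OF pc ch h] p y(2) t(1) by auto
qed

text \<open>Only one of the two heads missing \<open>e\<close> can be the second end of the
  component of \<open>r\<close>; an exchange at another one makes it miss \<open>p\<close>. If
  \<open>B\<close> has its head in that component, this head is untouched, so the link from
  \<open>A\<close> to \<open>B\<close> survives and the whole list is used.\<close>

lemma rho_free:
  assumes v: "valid ed" and p: "p \<in> M ed r" and L: "free_chn ed (A @ B)" "A \<noteq> []" "B \<noteq> []" "src A = e"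
    and m: "e \<in> M ed (fst (hd B))" "e \<in> M ed (fst (hd A))"
  obtains z L where "z \<notin> kcomp ed p e r" "free_chn (K ed p e z) L" "src L = src (A @ B)"
    "p \<in> M (K ed p e z) (fst (hd L))" "valid (K ed p e z)" "stable ed (K ed p e z)" "e \<noteq> src (A @ B)" "p \<noteq> e" "e < n"
proof -
  note pc = valid_pcol[OF v] and ch = free_chnD(1)[OF L(1)]
  have chA: "chn ed A" "chn ed B" "fst ` set A \<inter> fst ` set B = {}" using ch chn_append[OF L(2,3)] by auto
  let ?w = "fst (hd A)" let ?z = "fst (hd B)"
  have lA: "last A \<in> set (A @ B)" using L(2) by simp
  have e: "e < n" "p \<noteq> e" using m M_less chn_not_r[OF ch lA] L(4) p by auto
  have n: "p < n" using p M_less by blast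
  note fa = free_chn_append[OF pc L(1-3)]
  have eB': "snd y \<noteq> e" if "y \<in> set B" for y using fa(4)[OF that] L(4) by simp
  have eA: "\<forall>y\<in>set (butlast A). snd y \<noteq> e" using chn_butlast_src[OF pc chA(1)] L(4) by simp
  have eB2: "\<forall>y\<in>set (butlast B). snd y \<noteq> e" using eB' in_set_butlastD by fast
  have ne: "e \<noteq> src (A @ B)" using eB'[of "last B"] L(3) by auto
  note fA = fa(1) and fB = fa(2)
  have hA: "hd A \<in> set A" "hd B \<in> set B" using L by simp_all
  have wz: "?w \<noteq> ?z" using chA(3) hA by blast
  have nr: "?w \<noteq> r" "?z \<noteq> r" using chn_r[OF pc] chA hA by blast+
  show thesis
  proof (cases "?z \<in> kcomp ed p e r")
    case False
    note ps = free_swap[OF v p fB e(1) False eB2]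
    have "p \<in> M (K ed p e ?z) ?z" by (rule M_K_in[OF n e(1) comp_refl m(1)])
    then show thesis using that[OF False ps(3)] ps e ne L(3) by simp
  next
    case True
    have w: "?w \<notin> kcomp ed p e r"
      using three_ends[OF pc e(2), of r r ?z ?w] True nr wz p m by auto
    let ?e = "K ed p e ?w"
    note pA = free_swap[OF v p fA e(1) w eA] and pB = free_swap[OF v p fB e(1) w eB2]
    have "e \<in> M ?e ?z" using m(1) M_K_out[OF n e(1) comp_disj[OF pc True w]] by simp
    then have "chn ?e (A @ B)"
      using chn_append[OF L(2,3), of ?e] free_chnD(1)[OF pA(3)] free_chnD(1)[OF pB(3)] chA(3) L(4) by simp
    then have "free_chn ?e (A @ B)" by (rule free_stable[OF L(1) pA(2)])
    moreover have "p \<in> M ?e ?w" by (rule M_K_in[OF n e(1) comp_refl m(2)])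
    ultimately show thesis using that[OF w, of "A @ B"] pA e ne L(2) by simp
  qed
qed

end

section \<open>A path from the uncoloured edge to a vertex missing three colours\<close>

text \<open>Locates the place where two chains with the same head part.\<close>

lemma common_prefix: "\<exists>A B B'. L = A @ B \<and> L' = A @ B' \<and> (B = [] \<or> B' = [] \<or> hd B \<noteq> hd B')"
proof (induction L arbitrary: L')
  case (Cons y L)
  show ?case
  proof (cases "L' \<noteq> [] \<and> hd L' = y")
    case True
    then obtain L'' where L': "L' = y # L''" by (cases L') auto
    obtain A B B' where "L = A @ B \<and> L'' = A @ B' \<and> (B = [] \<or> B' = [] \<or> hd B \<noteq> hd B')" using Cons.IH by blast
    then show ?thesis using L' by (intro exI[of _ "y # A"] exI[of _ B] exI[of _ B']) simp
  next
    case False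
    then show ?thesis by (intro exI[of _ "[]"] exI[of _ "y # L"] exI[of _ L']) auto
  qed
qed simp

locale target = fans n V G r s for n :: nat and V :: "'a set" and G r s +
  fixes u x :: 'a
  assumes xu: "u \<noteq> r" "x \<noteq> r" "x \<noteq> s" "G s u" "G u x" "\<not> G r x"
    and card_x: "pcol ed \<Longrightarrow> (\<And>v w. (\<exists>c. ed v w c) \<longleftrightarrow> G v w) \<Longrightarrow> 3 \<le> card (M ed x)"
begin

lemma valid_x: "valid ed \<Longrightarrow> 3 \<le> card (M ed x)"
  unfolding valid_def using card_x by blast

lemma u_ne: "valid ed \<Longrightarrow> u \<noteq> s" "valid ed \<Longrightarrow> u \<noteq> x"
  using valid_ex[of ed] xu pcolD(5)[OF valid_pcol] by metis+

lemma not_rx: "valid ed \<Longrightarrow> \<not> ed r x k"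
  using valid_G xu(6) by blast

lemma Fv_x: "valid ed \<Longrightarrow> \<not> Fv ed x"
  using not_rx xu(3) unfolding Fv_def by blast

lemma chn_x: "valid ed \<Longrightarrow> chn ed L \<Longrightarrow> z \<in> set L \<Longrightarrow> fst z \<noteq> x"
  using chn_edge not_rx by metis

text \<open>
  The configuration to be excluded first: \<open>s u x\<close> is a path with colours \<open>p\<close>, \<open>a\<close>.
\<close>
definition Kst :: "'a col \<Rightarrow> nat \<Rightarrow> nat \<Rightarrow> nat \<Rightarrow> bool" where
  "Kst ed p a b \<longleftrightarrow> valid ed \<and> M ed r = {p} \<and> M ed s = {a, b} \<and> a \<noteq> b \<and> ed s u p \<and> ed u x a"

lemma KstD:
  assumes "Kst ed p a b"
  shows "valid ed" "pcol ed" "M ed r = {p}" "M ed s = {a, b}" "a \<noteq> b" "ed s u p" "ed u x a"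
    "p < n" "a < n" "b < n" "p \<noteq> a" "p \<noteq> b" "ed u s p" "ed x u a"
proof -
  show *: "valid ed" "M ed r = {p}" "M ed s = {a, b}" "a \<noteq> b" "ed s u p" "ed u x a"
    using assms by (simp_all add: Kst_def)
  show pc: "pcol ed" by (rule valid_pcol[OF *(1)])
  show "p < n" "a < n" "b < n" using *(2,3) M_less by blast+
  show "p \<noteq> a" "p \<noteq> b" using nocol[OF *(1), of p] *(2,3) by auto
  show "ed u s p" "ed x u a" using pcolD(1)[OF pc] *(5,6) by auto
qed

section \<open>The path \<open>s u x\<close> with colours \<open>p\<close> and
  \<open>a\<close>\<close>

lemma path_closed:
  assumes pc: "pcol ed" and e: "ed s u p" "ed u x a" and m: "p \<in> M ed x" "a \<in> M ed s"
  shows "closed ed p a {x, u, s}"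
  unfolding closed_def
proof (intro ballI allI impI)
  fix v w assume vS: "v \<in> {x, u, s}" and h: "ed v w p \<or> ed v w a"
  have "w = u" if "ed x w a" for w using pcol_nbr[OF pc that pcolD(1)[OF pc e(2)]] .
  moreover have "\<not> ed x w p" for w using M_not[OF m(1)] .
  moreover have "w = x" if "ed u w a" for w using pcol_nbr[OF pc that e(2)] .
  moreover have "w = s" if "ed u w p" for w using pcol_nbr[OF pc that pcolD(1)[OF pc e(1)]] .
  moreover have "w = u" if "ed s w p" for w using pcol_nbr[OF pc that e(1)] .
  moreover have "\<not> ed s w a" for w using M_not[OF m(2)] .
  ultimately show "w \<in> {x, u, s}" using vS h by blast
qed

text \<open>The three vertices of the path would contain the whole \<open>p\<close>-\<open>a\<close>
  component of \<open>s\<close>, but that component contains \<open>r\<close>.\<close>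

lemma Kst_p:
  assumes "Kst ed p a b" "p \<in> M ed x" shows False
proof -
  note k = KstD[OF assms(1)]
  have "a \<in> M ed s" using k(4) by simp
  then have "closed ed p a {x, u, s}" by (rule path_closed[OF k(2,6,7) assms(2)])
  then have "kcomp ed p a s \<subseteq> {x, u, s}" by (rule comp_min) simp
  moreover have "r \<in> kcomp ed p a s" using comp_sym[OF k(2) s_linked_r[OF k(1)]] k(3,4) by blast
  ultimately show False using xu rs by blast
qed

text \<open>The ends of the \<open>p\<close>-\<open>b\<close> component of \<open>r\<close> are
  \<open>r\<close> and \<open>s\<close>, so an exchange at \<open>x\<close> keeps the configuration
  and makes \<open>x\<close> miss \<open>p\<close>.\<close>

lemma Kst_b:
  assumes "Kst ed p a b" "b \<in> M ed x" shows False
proof -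
  note k = KstD[OF assms(1)]
  let ?e = "K ed p b x"
  have sr: "s \<in> kcomp ed p b r" using s_linked_r[OF k(1)] k(3,4) by blast
  have xr: "x \<notin> kcomp ed p b r"
    using three_ends[OF k(2) k(12), of r r s x] sr xu rs k(3,4) assms(2) by auto
  have st: "stable ed ?e" using fan_stable[OF k(1) _ k(10) xr] k(3) by simp
  have "s \<notin> kcomp ed p b x" by (rule comp_disj[OF k(2) sr xr])
  then have "?e s u p" using k(6) by (simp add: K_ed_out)
  moreover have "?e u x a" using k(5,7,11) by (simp add: K_ed_other)
  ultimately have "Kst ?e p a b"
    using valid_K[OF k(1,8,10)] stableD[OF st] k(3-5) by (simp add: Kst_def)
  moreover have "p \<in> M ?e x" using assms(2) k(8,10) by (simp add: M_K)
  ultimately show False by (rule Kst_p)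
qed

lemma Kst_x:
  assumes "Kst ed p a b" shows "p \<notin> M ed x" "a \<notin> M ed x" "b \<notin> M ed x"
  using Kst_p[OF assms] Kst_b[OF assms] M_not[of a ed x u] KstD(14)[OF assms] by blast+

text \<open>Otherwise an exchange at \<open>x\<close> would keep the configuration and make
  \<open>x\<close> miss \<open>b\<close>.\<close>

lemma Kst_linked_s:
  assumes "Kst ed p a b" "c \<in> M ed x" shows "x \<in> kcomp ed b c s"
proof (rule ccontr)
  note k = KstD[OF assms(1)]
  assume nx: "x \<notin> kcomp ed b c s"
  have c: "c < n" "c \<noteq> p" "c \<noteq> a" "c \<noteq> b" using assms Kst_x M_less by auto
  let ?e = "K ed b c x"
  have s: "s \<notin> kcomp ed b c x" using nx comp_sym[OF k(2)] by blast
  have "p \<in> M ?e r" using k(3,12) c by (simp add: M_K_other[OF k(10) c(1)])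
  then have "M ?e r = {p}" by (rule valid_r_eq[OF valid_K[OF k(1,10) c(1)]])
  then have "Kst ?e p a b" using valid_K[OF k(1,10) c(1)] M_K_out[OF k(10) c(1) s] k c
    by (simp add: Kst_def K_ed_other)
  moreover have "b \<in> M ?e x" using assms(2) k(10) c by (simp add: M_K)
  ultimately show False by (rule Kst_b)
qed

text \<open>The vertex missing \<open>c\<close> in the half of \<open>a\<close> is linked to
  \<open>s\<close> by \<open>b\<close> and \<open>c\<close>, and so is \<open>x\<close>: three
  ends.\<close>

lemma Kst_avoids_D:
  assumes "Kst ed p a b" "c \<in> M ed x" shows "c \<notin> D ed a"
proof
  note k = KstD[OF assms(1)]
  assume "c \<in> D ed a"
  then show False
  proof cases
    case D0
    then show False using Kst_x assms by blast
  next
    case (D1 j y)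
    have "y \<in> kcomp ed b c s" using fan_linked_s[OF k(1) _ _ k(5) D1(1,2,3)] k(4) by blast
    moreover have "y \<noteq> x" "y \<noteq> s" using D1(2) not_rx[OF k(1)] valid_not_s[OF k(1)] by auto
    moreover have "b \<noteq> c" using Kst_x assms by blast
    ultimately show False using three_ends[OF k(2), of b c s s y x] Kst_linked_s[OF assms] xu(3) D1(3) assms(2) k(4) by auto
  qed
qed

lemma C_D: "M ed s = {a, b} \<Longrightarrow> C ed = D ed a \<union> D ed b"
  by (auto simp: C_def)

text \<open>
  After exchanging \<open>p\<close> and \<open>c\<close> at \<open>r\<close>, the path \<open>s u x\<close> is a whole component for \<open>p\<close> and \<open>a\<close>; exchanging
  these makes \<open>s\<close> miss \<open>p\<close>, which is also missing at the fan vertex that missed \<open>c\<close>.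
\<close>
lemma su_other_root:
  assumes v: "valid ed" and m: "M ed r = {p}" "M ed s = {a, b}" "a \<noteq> b"
    and e: "ed u x a" "ed s u c" and c: "c \<in> D ed b" "c \<noteq> b" and p: "p \<in> M ed x"
    and s: "s \<in> kcomp ed p c r"
  shows False
proof -
  note pc = valid_pcol[OF v]
  obtain k y where y: "k \<in> D ed b" "ed r y k" "c \<in> M ed y" using c by (auto elim: D.cases)
  obtain L where L: "chn ed ((y, k) # L)" "src ((y, k) # L) = b" using D_chain[OF pc y(1,2)] by blast
  let ?L = "(y, k) # L"
  have n: "p < n" "c < n" "a < n" "b < n" using m y M_less by blast+
  have bs: "b \<in> M ed s" "a \<in> M ed s" using m by auto
  have Fy: "Fv ed y" using chain_Fv[OF L(1), of "(y, k)"] L(2) bs by simp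
  have yr: "y \<in> kcomp ed p c r" using fan_linked_r[OF v Fy y(3)] m by blast
  have ne: "p \<noteq> c" "p \<noteq> a" "p \<noteq> b" "c \<noteq> a"
    using fan_avoids_r[OF v Fy y(3)] nocol[OF v] m e(2) bs by (auto simp: M_def)
  have yne: "y \<noteq> r" "y \<noteq> x" "y \<noteq> s" "y \<noteq> u"
    using pcolD(5)[OF pc y(2)] not_rx[OF v] valid_not_s[OF v] y pcolD(1)[OF pc e(2)] by (auto simp: M_def)
  have xr: "x \<notin> kcomp ed p c r"
    using three_ends[OF pc ne(1), of r r y x] yr xu yne m y p by auto
  have sL: "src ?L \<in> M ed s" using L(2) bs by simp
  have col: "p \<notin> snd ` set ?L" "c \<notin> snd ` set ?L" "a \<notin> snd ` set ?L"
    using chn_not_r[OF L(1)] m(1) chain_col(2)[OF v L(1) sL, of c] chain_col(1)[OF v L(1) sL bs(2)] L(2) y(3) \<open>a \<noteq> b\<close>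
    by (metis imageE insertI1, simp_all)
  let ?e = "K ed p c r"
  have ve: "valid ?e" by (rule valid_K[OF v n(1,2)])
  note pe = valid_pcol[OF ve]
  have e4: "?e s u p" using s e(2) by (simp add: K_ed)
  have e4x: "?e u x a" using e(1) ne by (simp add: K_ed_other)
  have m4: "a \<in> M ?e s" "b \<in> M ?e s" using bs ne c by (simp_all add: M_K_other[OF n(1,2)])
  have p4: "p \<in> M ?e y" "p \<in> M ?e x" using y(3) yr p xr by (simp_all add: M_K[OF n(1,2)])
  have colz: "snd z \<noteq> p \<and> snd z \<noteq> c \<and> snd z \<noteq> a" if "z \<in> set (butlast ?L)" for z
    using col imageI[OF in_set_butlastD[OF that], of snd] by blast
  have L4: "chn ?e ?L"
    by (rule chn_K[OF L(1) n(1,2)]) (use col colz in blast)+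
  let ?S = "{x, u, s}"
  have cl: "closed ?e p a ?S" by (rule path_closed[OF pe e4 e4x p4(2) m4(1)])
  let ?f = "swp ?e p a ?S"
  have vf: "valid ?f" by (rule valid_swp[OF ve n(1,3) cl])
  have rS: "r \<notin> ?S" using xu rs by blast
  have "chn ?f ?L"
  proof (rule chn_mono[OF L4])
    fix z assume "z \<in> set ?L"
    then show "?f r (fst z) (snd z)" using chn_edge[OF L4] rS by (simp add: swp_def)
  next
    fix z w assume z: "z \<in> set (butlast ?L)" and mz: "snd z \<in> M ?e (fst w)"
    have "snd z \<noteq> p" "snd z \<noteq> a" using colz[OF z] by auto
    then show "snd z \<in> M ?f (fst w)" using mz by (simp add: M_swp[OF n(1,3)])
  qed
  moreover have "src ?L \<in> M ?f s" using L(2) m4 ne \<open>a \<noteq> b\<close> by (simp add: M_swp[OF n(1,3)])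
  moreover have "p \<in> M ?f (fst (hd ?L))" using p4(1) yne by (simp add: M_swp[OF n(1,3)])
  moreover have "p \<in> M ?f s" using m4 by (simp add: M_swp[OF n(1,3)])
  ultimately show False by (rule chain_elem[OF vf])
qed

text \<open>The basic move at \<open>x\<close>. The component of \<open>r\<close> ends at the fan
  vertex missing \<open>c\<close>, so \<open>x\<close> cannot be a further end of it.\<close>

lemma x_swap:
  assumes v: "valid ed" and p: "p \<in> M ed r" and c: "c \<in> C ed" and x: "p \<in> M ed x \<or> c \<in> M ed x"
  shows "x \<notin> kcomp ed p c r" "stable ed (K ed p c x)" "valid (K ed p c x)" "p \<noteq> c" "p < n" "c < n"
proof -
  obtain y where y: "Fv ed y" "c \<in> M ed y" using C_holder[OF c] .
  show ne: "p \<noteq> c" using fan_avoids_r[OF v y] p by blast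
  show n: "p < n" "c < n" using p y M_less by auto
  have "y \<noteq> r" "y \<noteq> x" using y Fv_r[OF valid_pcol[OF v]] Fv_x[OF v] by auto
  then show xr: "x \<notin> kcomp ed p c r"
    using three_ends[OF valid_pcol[OF v] ne, of r r y x] fan_linked_r[OF v y p] xu(2) p y x by auto
  show "stable ed (K ed p c x)" by (rule fan_stable[OF v p n(2) xr])
  show "valid (K ed p c x)" by (rule valid_K[OF v n])
qed

lemma x_swap_s:
  assumes v: "valid ed" and p: "p \<in> M ed r" and c: "c \<in> M ed s" and x: "p \<in> M ed x \<or> c \<in> M ed x"
  shows "s \<notin> kcomp ed p c x"
  using comp_disj[OF valid_pcol[OF v] s_linked_r[OF v c p] x_swap(1)[OF v p M_s_C[OF c] x]] .

lemma Kst_stable: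
  assumes "Kst ed p a b" "valid ed'" "stable ed ed'" "ed' s u p" "ed' u x a"
  shows "Kst ed' p a b"
  using assms(2,4,5) KstD[OF assms(1)] stableD[OF assms(3)] by (simp add: Kst_def)

text \<open>Exchanges at \<open>x\<close> lead to \<open>su\<close> of colour \<open>c\<close> with
  both \<open>p\<close> and \<open>b\<close> missing at \<open>x\<close>. If \<open>s\<close> is in
  the \<open>p\<close>-\<open>c\<close> component of \<open>r\<close>, \<open>su_other_root\<close>
  applies. If not, an exchange at \<open>r\<close> restores the configuration with \<open>c\<close>
  in place of \<open>p\<close>, and \<open>Kst_b\<close> applies.\<close>

lemma Kst_one_D:
  assumes K: "Kst ed p a b" and c: "c \<in> M ed x" "c \<in> D ed b" and d: "d \<in> M ed x" "d \<in> D ed b" and cd: "c \<noteq> d"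
  shows False
proof -
  note k = KstD[OF K]
  have CC: "c \<in> C ed" "d \<in> C ed" "b \<in> C ed" using c d C_D[OF k(4)] D.D0 by blast+
  have ne: "c \<noteq> p" "c \<noteq> a" "c \<noteq> b" "d \<noteq> p" "d \<noteq> a" "d \<noteq> b" using Kst_x[OF K] c d by auto
  have pr: "p \<in> M ed r" using k(3) by simp
  let ?e = "K ed p c x"
  note x1 = x_swap[OF k(1) pr CC(1) disjI2[OF c(1)]]
  \<comment> \<open>If the exchange did not reach \<open>s\<close>, the configuration would survive
    with \<open>p\<close> missing at \<open>x\<close>.\<close>
  have su: "?e s u c"
  proof (cases "s \<in> kcomp ed p c x")
    case True
    then show ?thesis using k(6) by (simp add: K_ed)
  next
    case False
    then have "Kst ?e p a b"
      using Kst_stable[OF K x1(3,2)] k(5-7) ne by (simp add: K_ed_out K_ed_other k(11)[symmetric])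
    moreover have "p \<in> M ?e x" using c x1(5,6) by (simp add: M_K)
    ultimately show ?thesis using Kst_p by blast
  qed
  have ux1: "?e u x a" using k(7,11) ne by (simp add: K_ed_other)
  have px1: "p \<in> M ?e x" "d \<in> M ?e x" using c d ne cd x1(5,6) by (simp_all add: M_K)
  have M1: "M ?e r = {p}" "M ?e s = {a, b}" using stableD[OF x1(2)] k by simp_all
  \<comment> \<open>Here \<open>p\<close> is traded for \<open>b\<close>; afterwards
    \<open>d\<close> is traded for a new \<open>p\<close>. This is where the second colour is
    spent.\<close>
  let ?f = "K ?e p b x"
  have b1: "b \<in> C ?e" using M1 M_s_C by blast
  have pr1: "p \<in> M ?e r" using M1 by simp
  note x2 = x_swap[OF x1(3) pr1 b1 disjI1[OF px1(1)]]
  have su2: "?f s u c" "?f u x a" using su ux1 ne k(5,11) by (simp_all add: K_ed_other)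
  have px2: "b \<in> M ?f x" "d \<in> M ?f x" using px1 ne x2 by (simp_all add: M_K)
  have M2: "M ?f r = {p}" "M ?f s = {a, b}" using stableD[OF x2(2)] M1 by simp_all
  let ?g = "K ?f p d x"
  have d2: "d \<in> C ?f" using CC stable_C[OF x1(2)] stable_C[OF x2(2)] by simp
  have pr2: "p \<in> M ?f r" using M2 by simp
  note x3 = x_swap[OF x2(3) pr2 d2 disjI2[OF px2(2)]]
  have su3: "?g s u c" "?g u x a" using su2 ne cd k(11) by (simp_all add: K_ed_other)
  have px3: "p \<in> M ?g x" "b \<in> M ?g x" using px2 ne x3(5,6) k(12) by (simp_all add: M_K)
  have M3: "M ?g r = {p}" "M ?g s = {a, b}" using stableD[OF x3(2)] M2 by simp_all
  have cD: "c \<in> D ?g b"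
    using c(2) stable_D[OF x1(2), of b] stable_D[OF x2(2), of b] stable_D[OF x3(2), of b] k(4) M1 M2 by simp
  show False
  proof (cases "s \<in> kcomp ?g p c r")
    case True
    show False by (rule su_other_root[OF x3(3) M3 k(5) su3(2,1) cD ne(3) px3(1) True])
  next
    case False
    let ?h = "K ?g p c r"
    have vh: "valid ?h" by (rule valid_K[OF x3(3) x1(5,6)])
    have "c \<in> M ?h r" using M3 x1(5,6) by (simp add: M_K)
    then have "M ?h r = {c}" by (rule valid_r_eq[OF vh])
    then have "Kst ?h c a b"
      using vh M3 su3 M_K_out[OF x1(5,6) False] K_ed_out[OF False] k(5,11) ne by (simp add: Kst_def K_ed_other)
    moreover have "b \<in> M ?h x" using px3(2) k(12) ne x1(5,6) by (simp add: M_K_other)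
    ultimately show False by (rule Kst_b)
  qed
qed

section \<open>Making more colours missing at \<open>x\<close> reachable\<close>

definition tokens :: "'a col \<Rightarrow> nat" where "tokens ed = card (M ed x \<inter> C ed)"

text \<open>Only \<open>p\<close> and \<open>a\<close> are fixed, since an exchange at
  \<open>s\<close> may replace \<open>b\<close> by another colour.\<close>

definition gain :: "'a col \<Rightarrow> nat \<Rightarrow> nat \<Rightarrow> bool" where
  "gain ed p a \<longleftrightarrow> (\<exists>ed' b. Kst ed' p a b \<and> tokens ed < tokens ed')"

lemma gainI: "Kst ed' p a b \<Longrightarrow> tokens ed < tokens ed' \<Longrightarrow> gain ed p a"
  unfolding gain_def by blast

lemma gain_le: "gain ed' p a \<Longrightarrow> tokens ed \<le> tokens ed' \<Longrightarrow> gain ed p a"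
  unfolding gain_def using le_less_trans by blast

lemma tokens_less:
  assumes "M ed x \<inter> C ed \<subseteq> M ed' x \<inter> C ed'" "c \<in> M ed' x" "c \<in> C ed'" "\<not> (c \<in> M ed x \<and> c \<in> C ed)"
  shows "tokens ed < tokens ed'"
  unfolding tokens_def using assms by (intro psubset_card_mono) auto

lemma tokens_le:
  assumes "M ed x \<inter> C ed \<subseteq> M ed' x \<inter> C ed'" shows "tokens ed \<le> tokens ed'"
  unfolding tokens_def using assms by (intro card_mono) auto

text \<open>The reachable colour at the head is carried along the list towards the source, which
  \<open>x\<close> misses. If the \<open>t\<close>-\<open>j\<close> component of \<open>y\<close>
  avoids \<open>r\<close>, an exchange at \<open>y\<close> makes \<open>j\<close> reachable by
  \<open>C_grow\<close>. If it contains \<open>r\<close>, then \<open>y\<close> and \<open>w\<close>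
  are its ends, and exchanges elsewhere turn \<open>j\<close> into \<open>t\<close> at
  \<open>x\<close> or at the next vertex without touching the fan. The colour \<open>a\<close> is
  kept out because exchanging it could recolour \<open>ux\<close>.\<close>

lemma gain_fan:
  assumes "Kst ed p a b" "chn ed L" "src L \<in> M ed x" "t \<in> M ed (fst (hd L))" "t \<in> C ed" "t \<notin> M ed x" "t \<noteq> a"
    "a \<notin> snd ` set L" "snd ` set L \<inter> C ed \<inter> M ed x = {}"
  shows "gain ed p a"
  using assms
proof (induction "length L" arbitrary: ed b L t rule: less_induct)
  case less
  note K = less.prems(1) and L = less.prems(2) and sx = less.prems(3) and tw = less.prems(4) and tC = less.prems(5)
    and tx = less.prems(6) and ta = less.prems(7) and aL = less.prems(8) and disj = less.prems(9)
  note k = KstD[OF K]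
  have LN: "L \<noteq> []" by (rule chn_Nil[OF L])
  show ?case
  proof (cases "\<exists>z\<in>set L. snd z \<in> C ed")
    case True
    \<comment> \<open>A reachable colour on the list is missing at the next vertex, so the rest of
      the list is a shorter instance.\<close>
    then obtain z where z: "z \<in> set L" "snd z \<in> C ed" by blast
    obtain A B where AB: "L = A @ z # B" using split_list[OF z(1)] by blast
    have zx: "snd z \<notin> M ed x" using disj z by blast
    then have B: "B \<noteq> []" using sx AB by auto
    have "chn ed (z # B)" using L AB chn_suffix by blast
    then have cB: "chn ed B" "snd z \<in> M ed (fst (hd B))" using chn_Cons[OF B] by auto
    show ?thesis
    proof (rule less.hyps[OF _ K cB(1) _ cB(2) z(2) zx])
      show "length B < length L" "src B \<in> M ed x" using AB B sx by auto
      show "snd z \<noteq> a" "a \<notin> snd ` set B" "snd ` set B \<inter> C ed \<inter> M ed x = {}" using aL disj AB z by auto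
    qed
  next
    case noC: False
    obtain w j L1 where L1: "L = (w, j) # L1" using LN by (metis list.exhaust surj_pair)
    have e: "ed r w j" using chn_edge[OF L, of "(w, j)"] L1 by simp
    have jC: "j \<notin> C ed" using noC L1 by auto
    have tw: "t \<in> M ed w" using tw L1 by simp
    obtain y where y: "Fv ed y" "t \<in> M ed y" using C_holder[OF tC] .
    have fw: "\<not> Fv ed w" using e jC valid_not_s[OF k(1)] pcol_col[OF k(2)] unfolding Fv_def by metis
    then have wy: "w \<noteq> y" using y by blast
    have n: "t < n" "j < n" using tw M_less pcolD(2)[OF k(2) e] by auto
    have tj: "t \<noteq> j" using tC jC by blast
    have pj: "p \<noteq> j" using k(3) e M_not[of p ed r] by auto
    have pt: "p \<noteq> t" using fan_avoids_r[OF k(1) y] k(3) by auto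
    have aj: "a \<noteq> j" "b \<noteq> j" using jC M_s_C k(4) by blast+
    have wx: "w \<noteq> x" "w \<noteq> s" "w \<noteq> r" using e not_rx[OF k(1)] valid_not_s[OF k(1)] pcolD(5)[OF k(2) e] by auto
    have yx: "y \<noteq> x" using y Fv_x[OF k(1)] by blast
    let ?S = "kcomp ed t j y" let ?e = "K ed t j y"
    have wS: "w \<in> ?S \<longleftrightarrow> r \<in> ?S" using comp_edge[OF k(2), of r w t j y] e by blast
    have Fvj: "j \<notin> M ed z" if "Fv ed z" for z using Fv_M[OF that] jC by blast
    have jL1: "z \<in> set L1 \<Longrightarrow> snd z \<noteq> j" for z using chn_snd_distinct[OF k(2) L] L1 by force
    have tL1: "z \<in> set L1 \<Longrightarrow> snd z \<noteq> t" for z using noC tC L1 by auto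
    have chL1: "L1 \<noteq> [] \<Longrightarrow> chn ed L1 \<and> j \<in> M ed (fst (hd L1))" using L L1 chn_Cons[of L1 ed "(w, j)"] by auto
    show ?thesis
    proof (cases "r \<in> ?S")
      case rn: False
      note g = C_grow[OF k(1) y jC e tw rn]
      have ve: "valid ?e" by (rule valid_K[OF k(1) n])
      have Mr: "M ?e r = {p}" using M_K_out[OF n rn] k(3) by simp
      \<comment> \<open>For \<open>y = s\<close> the colour \<open>t\<close> is \<open>b\<close>,
        and the exchange replaces it by \<open>j\<close>.\<close>
      obtain b' where Ms: "M ?e s = {a, b'}" "a \<noteq> b'"
      proof (cases "y = s")
        case True
        then have "t = b" using y(2) ta k(4) by auto
        then have "a \<in> M ?e s" "j \<in> M ?e s" using True k(4) aj ta n by (simp_all add: M_K)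
        then show ?thesis using that[of j] valid_s_eq[OF ve _ _ aj(1)] aj by blast
      next
        case False
        then have "t \<notin> M ed s" using fan_elementary[OF k(1) y Fv_s] by blast
        then have "M ?e s = {a, b}" using M_K_same[OF n, of ed s] Fvj[OF Fv_s] k(4) by simp
        then show ?thesis using that k(5) by blast
      qed
      have K': "Kst ?e p a b'"
        using ve Mr Ms k(6,7) pt pj ta aj by (simp add: Kst_def K_ed_other)
      show ?thesis
      proof (cases "j \<in> M ed x")
        case jx: True
        show ?thesis
        proof (cases "x \<in> ?S")
          case True
          have "tokens ed < tokens ?e"
          proof (rule tokens_less[of _ _ t])
            show "t \<in> M ?e x" using jx True n by (simp add: M_K)
            show "t \<in> C ?e" using g tC by blast
            show "M ed x \<inter> C ed \<subseteq> M ?e x \<inter> C ?e"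
            proof
              fix c assume c: "c \<in> M ed x \<inter> C ed"
              then have "c \<noteq> t" "c \<noteq> j" using tx jC by blast+
              then show "c \<in> M ?e x \<inter> C ?e" using c g by (auto simp: M_K_other[OF n])
            qed
          qed (use tx in blast)
          then show ?thesis by (rule gainI[OF K'])
        next
          case False
          have "tokens ed < tokens ?e"
            by (rule tokens_less[of _ _ j]) (use g jx jC M_K_out[OF n False] in auto)
          then show ?thesis by (rule gainI[OF K'])
        qed
      next
        case jx: False
        have Mx: "M ?e x = M ed x" by (rule M_K_same[OF n tx jx])
        have kle: "tokens ed \<le> tokens ?e" by (rule tokens_le) (use Mx g in auto)
        have L1N: "L1 \<noteq> []" using sx jx L1 by auto
        show ?thesis
        proof (cases "\<exists>z\<in>set L1. snd z \<in> C ?e \<inter> M ed x")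
          case True
          then obtain z where z: "z \<in> set L1" "snd z \<in> C ?e" "snd z \<in> M ed x" by blast
          have "snd z \<notin> C ed" using noC L1 z by auto
          then have "tokens ed < tokens ?e" by (intro tokens_less[of _ _ "snd z"]) (use g z Mx in auto)
          then show ?thesis by (rule gainI[OF K'])
        next
          case False
          \<comment> \<open>The next vertex missed \<open>j\<close>. Inside the component it now
            misses \<open>t\<close> instead; both colours are reachable after the exchange.\<close>
          define t' where "t' = (if fst (hd L1) \<in> ?S then t else j)"
          have "gain ?e p a"
          proof (rule less.hyps[OF _ K'])
            show "length L1 < length L" using L1 by simp
            show "chn ?e L1"
              by (rule chn_K[OF conjunct1[OF chL1[OF L1N]] n]) (use rn jL1 tL1 in_set_butlastD in fast)+
            show "src L1 \<in> M ?e x" using sx L1 L1N Mx by simp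
            show "t' \<in> M ?e (fst (hd L1))" using chL1[OF L1N] n by (simp add: t'_def M_K)
            show "t' \<in> C ?e" using g tC by (auto simp: t'_def)
            show "t' \<notin> M ?e x" using Mx tx jx by (simp add: t'_def)
            show "t' \<noteq> a" using ta aj by (simp add: t'_def)
            show "a \<notin> snd ` set L1" using aL L1 by simp
            show "snd ` set L1 \<inter> C ?e \<inter> M ?e x = {}" using False Mx by blast
          qed
          then show ?thesis by (rule gain_le[OF _ kle])
        qed
      qed
    next
      case rS: True
      have stab: "stable ed (K ed t j z)" if "z \<notin> ?S" for z
      proof (rule stable_K[OF n])
        show "r \<notin> kcomp ed t j z" by (rule comp_disj[OF k(2) rS that])
        fix z' assume z': "Fv ed z'" "z' \<in> kcomp ed t j z"
        have "y \<notin> kcomp ed t j z" by (rule comp_disj[OF k(2) comp_refl that])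
        then have "z' \<noteq> y" using z'(2) by blast
        then show "t \<notin> M ed z' \<and> j \<notin> M ed z'" using fan_elementary[OF k(1) z'(1) _ y] Fvj[OF z'(1)] by blast
      qed
      have Kz: "Kst (K ed t j z) p a b" if "z \<notin> ?S" for z
        using Kst_stable[OF K valid_K[OF k(1) n] stab[OF that]] k(6,7) pt pj ta aj by (simp add: K_ed_other)
      show ?thesis
      proof (cases "j \<in> M ed x")
        case jx: True
        show ?thesis
        proof (cases "x \<in> ?S")
          case True
          then show ?thesis using three_ends[OF k(2) tj, of y y w x] wS rS wy yx wx y(2) tw jx by auto
        next
          case False
          have "tokens ed < tokens (K ed t j x)"
          proof (rule tokens_less[of _ _ t])
            show "t \<in> M (K ed t j x) x" using jx n by (simp add: M_K)
            show "t \<in> C (K ed t j x)" using stable_C[OF stab[OF False]] tC by simp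
            show "M ed x \<inter> C ed \<subseteq> M (K ed t j x) x \<inter> C (K ed t j x)"
            proof
              fix c assume c: "c \<in> M ed x \<inter> C ed"
              then have "c \<noteq> t" "c \<noteq> j" using tx jC by blast+
              then show "c \<in> M (K ed t j x) x \<inter> C (K ed t j x)"
                using c stable_C[OF stab[OF False]] by (simp add: M_K_other[OF n])
            qed
          qed (use tx in blast)
          then show ?thesis by (rule gainI[OF Kz[OF False]])
        qed
      next
        case jx: False
        have L1N: "L1 \<noteq> []" using sx jx L1 by auto
        let ?z = "fst (hd L1)"
        have zL: "hd L1 \<in> set L1" using L1N by simp
        have jz: "j \<in> M ed ?z" using chL1[OF L1N] by blast
        have "?z \<noteq> y" using jz Fvj y by blast
        moreover have "?z \<noteq> w" using chn_hd_tl(1)[OF L, of "hd L1"] L1 zL by simp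
        ultimately have zS: "?z \<notin> ?S"
          using three_ends[OF k(2) tj, of y y w ?z] wS rS wy y(2) tw jz by auto
        let ?f = "K ed t j ?z"
        have Mx: "M ?f x = M ed x" by (rule M_K_same[OF n tx jx])
        have Cf: "C ?f = C ed" by (rule stable_C[OF stab[OF zS]])
        have "gain ?f p a"
        proof (rule less.hyps[OF _ Kz[OF zS]])
          show "length L1 < length L" using L1 by simp
          show "chn ?f L1"
            by (rule chn_K[OF conjunct1[OF chL1[OF L1N]] n])
              (use comp_disj[OF k(2) rS zS] jL1 tL1 in_set_butlastD in fast)+
          show "src L1 \<in> M ?f x" using sx L1 L1N Mx by simp
          show "t \<in> M ?f ?z" using jz n by (simp add: M_K)
          show "t \<in> C ?f" "t \<notin> M ?f x" "t \<noteq> a" "a \<notin> snd ` set L1" using Cf tC Mx tx ta aL L1 by simp_all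
          show "snd ` set L1 \<inter> C ?f \<inter> M ?f x = {}" using Cf Mx disj L1 by auto
        qed
        moreover have "tokens ed \<le> tokens ?f" by (rule tokens_le) (use Mx Cf in auto)
        ultimately show ?thesis by (rule gain_le)
      qed
    qed
  qed
qed

lemma free_col: "Kst ed p a b \<Longrightarrow> free_chn ed L \<Longrightarrow> z \<in> set L \<Longrightarrow> snd z \<noteq> p \<and> snd z \<noteq> a \<and> snd z \<noteq> b"
  using chn_not_r[OF free_chnD(1)] free_chnD(2) M_s_C KstD(3,4) by (metis insertCI)

lemma hd_ne:
  assumes "Kst ed p a b" "chn ed L"
  shows "fst (hd L) \<noteq> r" "fst (hd L) \<noteq> s" "fst (hd L) \<noteq> x"
proof -
  have h: "hd L \<in> set L" using chn_Nil[OF assms(2)] by simp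
  show "fst (hd L) \<noteq> r" "fst (hd L) \<noteq> s" "fst (hd L) \<noteq> x"
    using chn_r[OF KstD(2)[OF assms(1)] assms(2) h] chn_s[OF KstD(1)[OF assms(1)] assms(2) h]
      chn_x[OF KstD(1)[OF assms(1)] assms(2) h] by auto
qed

text \<open>The \<open>p\<close>-\<open>b\<close> component of \<open>r\<close> has the ends
  \<open>r\<close> and \<open>s\<close>, so an exchange at the head is harmless and turns
  \<open>p\<close> into \<open>b\<close>, a reachable colour present at \<open>x\<close>.\<close>

lemma gain_hit_p:
  assumes K: "Kst ed p a b" and L: "free_chn ed L" "src L \<in> M ed x" "p \<in> M ed (fst (hd L))"
  shows "gain ed p a"
proof -
  note k = KstD[OF K] and ch = free_chnD(1)[OF L(1)]
  let ?w = "fst (hd L)" let ?e = "K ed p b ?w"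
  have sr: "s \<in> kcomp ed p b r" using s_linked_r[OF k(1)] k(3,4) by blast
  have wr: "?w \<notin> kcomp ed p b r"
    using three_ends[OF k(2) k(12), of r r s ?w] sr hd_ne[OF K ch] rs k(3,4) L(3) by auto
  have st: "stable ed ?e" using fan_stable[OF k(1) _ k(10) wr] k(3) by simp
  have sw: "s \<notin> kcomp ed p b ?w" by (rule comp_disj[OF k(2) sr wr])
  have K': "Kst ?e p a b"
    using Kst_stable[OF K valid_K[OF k(1,8,10)] st] k(5,6,7,11) sw by (simp add: K_ed_out K_ed_other)
  have Mx: "M ?e x = M ed x" by (rule M_K_same[OF k(8,10)]) (use Kst_x[OF K] in auto)
  have "gain ?e p a"
  proof (rule gain_fan[OF K'])
    show "chn ?e L"
      by (rule chn_K[OF ch k(8,10)]) (use notin_comp_sym[OF k(2) wr] free_col[OF K L(1)] in_set_butlastD in fast)+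
    show "src L \<in> M ?e x" using L(2) Mx by simp
    show "b \<in> M ?e ?w" using L(3) k(8,10) by (simp add: M_K)
    show "b \<in> C ?e" using M_s_C KstD(4)[OF K'] by blast
    show "b \<notin> M ?e x" using Kst_x[OF K'] by simp
    show "b \<noteq> a" using k(5) by simp
    show "a \<notin> snd ` set L" using free_col[OF K L(1)] by blast
    show "snd ` set L \<inter> C ?e \<inter> M ?e x = {}" using stable_C[OF st] free_chnD(2)[OF L(1)] by blast
  qed
  moreover have "tokens ed \<le> tokens ?e" by (rule tokens_le) (simp add: Mx stable_C[OF st])
  ultimately show ?thesis by (rule gain_le)
qed

text \<open>The whole path \<open>s u x\<close> lies in the \<open>p\<close>-\<open>a\<close>
  component of \<open>r\<close>, whose ends include \<open>r\<close> and \<open>s\<close>. An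
  exchange at the head avoids it and turns \<open>a\<close> into \<open>p\<close>.\<close>

lemma gain_hit_a:
  assumes K: "Kst ed p a b" and L: "free_chn ed L" "src L \<in> M ed x" "a \<in> M ed (fst (hd L))"
  shows "gain ed p a"
proof -
  note k = KstD[OF K] and ch = free_chnD(1)[OF L(1)]
  let ?w = "fst (hd L)" let ?e = "K ed p a ?w"
  have sr: "s \<in> kcomp ed p a r" using s_linked_r[OF k(1)] k(3,4) by blast
  then have ur: "u \<in> kcomp ed p a r" using k(6) by (intro comp_step[of ed s u]) auto
  then have xr: "x \<in> kcomp ed p a r" using k(7) by (intro comp_step[of ed u x]) auto
  have wr: "?w \<notin> kcomp ed p a r"
    using three_ends[OF k(2) k(11), of r r s ?w] sr hd_ne[OF K ch] rs k(3,4) L(3) by auto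
  have st: "stable ed ?e" using fan_stable[OF k(1) _ k(9) wr] k(3) by simp
  note out = comp_disj[OF k(2) sr wr] comp_disj[OF k(2) ur wr] comp_disj[OF k(2) xr wr]
  have K': "Kst ?e p a b"
    using Kst_stable[OF K valid_K[OF k(1,8,9)] st] k(6,7) out by (simp add: K_ed_out)
  have Mx: "M ?e x = M ed x" by (rule M_K_out[OF k(8,9) out(3)])
  have "gain ?e p a"
  proof (rule gain_hit_p[OF K'])
    have "chn ?e L"
      by (rule chn_K[OF ch k(8,9)]) (use notin_comp_sym[OF k(2) wr] free_col[OF K L(1)] in_set_butlastD in fast)+
    then show "free_chn ?e L" by (rule free_stable[OF L(1) st])
    show "src L \<in> M ?e x" using L(2) Mx by simp
    show "p \<in> M ?e ?w" using L(3) k(8,9) by (simp add: M_K)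
  qed
  moreover have "tokens ed \<le> tokens ?e" by (rule tokens_le) (simp add: Mx stable_C[OF st])
  ultimately show ?thesis by (rule gain_le)
qed

lemma gain_hit:
  assumes K: "Kst ed p a b" and L: "chn ed L" "src L \<in> M ed x" and t: "t \<in> M ed (fst (hd L))" "t \<in> C ed \<or> t = p" "t \<notin> M ed x"
    and aL: "a \<notin> snd ` set L" and disj: "snd ` set L \<inter> C ed \<inter> M ed x = {}"
  shows "gain ed p a"
proof (cases "\<exists>z\<in>set L. snd z \<in> C ed")
  case True
  then obtain z where z: "z \<in> set L" "snd z \<in> C ed" by blast
  obtain A B where AB: "L = A @ z # B" using split_list[OF z(1)] by blast
  have zx: "snd z \<notin> M ed x" using disj z by blast
  then have B: "B \<noteq> []" using L(2) AB by auto
  have "chn ed (z # B)" using L AB chn_suffix by blast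
  then have cB: "chn ed B" "snd z \<in> M ed (fst (hd B))" using chn_Cons[OF B] by auto
  show ?thesis
    by (rule gain_fan[OF K cB(1) _ cB(2) z(2) zx]) (use AB B L(2) aL disj z in auto)
next
  case False
  then have fL: "free_chn ed L" using L(1) by (auto simp: free_chn_def)
  show ?thesis
  proof (cases "t = p \<or> t = a")
    case True
    then show ?thesis using gain_hit_p[OF K fL L(2)] gain_hit_a[OF K fL L(2)] t by blast
  next
    case False
    show ?thesis by (rule gain_fan[OF K L t(1) _ t(3) _ aL disj]) (use False t in auto)
  qed
qed

lemma gain_hit_free:
  assumes "Kst ed p a b" "free_chn ed L" "src L \<in> M ed x" "t \<in> M ed (fst (hd L))" "t \<in> C ed \<or> t = p" "t \<notin> M ed x"
  shows "gain ed p a"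
  by (rule gain_hit[OF assms(1) free_chnD(1)[OF assms(2)] assms(3-6)])
    (use free_col[OF assms(1,2)] free_chnD(2)[OF assms(2)] in blast)+

text \<open>Among fan vertices only \<open>s\<close> misses \<open>b\<close>, and none misses the
  unreachable \<open>e\<close>. So if \<open>r\<close> lies in the component of \<open>s\<close>,
  the other components do not concern the fan. In the opposite case \<open>e\<close> replaces
  \<open>b\<close> as a root, which is \<open>Kst_swap_s\<close>.\<close>

lemma Kst_swap_b:
  assumes K: "Kst ed p a b" and e: "e \<notin> C ed" "e \<noteq> p" "e < n" and S: "r \<in> kcomp ed b e s" "z \<notin> kcomp ed b e s"
  shows "Kst (K ed b e z) p a b" "stable ed (K ed b e z)"
proof -
  note k = KstD[OF K]
  show st: "stable ed (K ed b e z)"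
  proof (rule stable_K[OF k(10) e(3)])
    show "r \<notin> kcomp ed b e z" by (rule comp_disj[OF k(2) S])
    fix y assume y: "Fv ed y" "y \<in> kcomp ed b e z"
    have "s \<notin> kcomp ed b e z" by (rule comp_disj[OF k(2) comp_refl S(2)])
    then have "y \<noteq> s" using y by blast
    then show "b \<notin> M ed y \<and> e \<notin> M ed y" using fan_elementary[OF k(1) y(1) _ Fv_s] k(4) Fv_M[OF y(1)] e(1) by blast
  qed
  have "a \<noteq> e" using M_s_C k(4) e by blast
  then show "Kst (K ed b e z) p a b"
    using Kst_stable[OF K valid_K[OF k(1,10) e(3)] st] k e by (simp add: K_ed_other)
qed

lemma Kst_swap_s:
  assumes K: "Kst ed p a b" and e: "e \<notin> C ed" "e \<noteq> p" "e < n" and S: "r \<notin> kcomp ed b e s"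
  shows "Kst (K ed b e s) p a e"
proof -
  note k = KstD[OF K]
  have ae: "a \<noteq> e" using M_s_C k(4) e by blast
  have v: "valid (K ed b e s)" by (rule valid_K[OF k(1,10) e(3)])
  have "a \<in> M (K ed b e s) s" "e \<in> M (K ed b e s) s" using k e ae by (simp_all add: M_K)
  then have "M (K ed b e s) s = {a, e}" by (rule valid_s_eq[OF v _ _ ae])
  then show ?thesis using v k e ae M_K_out[OF k(10) e(3) S] by (simp add: Kst_def K_ed_other)
qed

text \<open>The \<open>b\<close>-\<open>f\<close> component of \<open>s\<close> has \<open>s\<close>
  and \<open>x\<close> as ends, so the head is outside. Either an exchange at the head makes it miss
  \<open>b\<close>, or an exchange at \<open>s\<close> makes \<open>f\<close> a root; then
  \<open>s\<close> and the head of a chain rooted at \<open>f\<close> would both miss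
  \<open>f\<close>.\<close>

lemma gain_cycle:
  assumes K: "Kst ed p a b" and L: "free_chn ed L" "src L = f" "f \<in> M ed x" "f \<in> M ed (fst (hd L))"
  shows "gain ed p a"
proof -
  note k = KstD[OF K] and ch = free_chnD(1)[OF L(1)]
  let ?w = "fst (hd L)" let ?S = "kcomp ed b f s"
  have lL: "last L \<in> set L" using chn_Nil[OF ch] by simp
  have f: "f \<notin> C ed" "f \<noteq> p" "f \<noteq> a" "f \<noteq> b" "f < n"
    using L free_chnD(2)[OF L(1) lL] free_col[OF K L(1) lL] M_less by auto
  have bl: "z \<in> set (butlast L) \<Longrightarrow> snd z \<noteq> b \<and> snd z \<noteq> f" for z
    using chn_butlast_src[OF k(2) ch] L(2) free_col[OF K L(1)] in_set_butlastD by fast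
  have xS: "x \<in> ?S" by (rule Kst_linked_s[OF K L(3)])
  have wS: "?w \<notin> ?S"
    using three_ends[OF k(2) f(4)[symmetric], of s s x ?w] xS hd_ne[OF K ch] xu k(4) L(3,4) by auto
  show ?thesis
  proof (cases "r \<in> ?S")
    case True
    note e = Kst_swap_b[OF K f(1,2,5) True wS]
    let ?e = "K ed b f ?w"
    have Mx: "M ?e x = M ed x" by (rule M_K_out[OF k(10) f(5) comp_disj[OF k(2) xS wS]])
    have "chn ?e L" by (rule chn_K[OF ch k(10) f(5)]) (use comp_disj[OF k(2) True wS] bl in fast)+
    then have "free_chn ?e L" by (rule free_stable[OF L(1) e(2)])
    moreover have "b \<in> M ?e ?w" using L(4) k(10) f(5) by (simp add: M_K)
    ultimately have "gain ?e p a"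
      using gain_hit_free[OF e(1), of L b] L Mx M_s_C[of b ?e] KstD(4)[OF e(1)] Kst_x[OF e(1)] by simp
    moreover have "tokens ed \<le> tokens ?e" by (rule tokens_le) (simp add: Mx stable_C[OF e(2)])
    ultimately show ?thesis by (rule gain_le)
  next
    case False
    note K' = Kst_swap_s[OF K f(1,2,5) False]
    let ?e = "K ed b f s"
    have "chn ?e L" by (rule chn_K[OF ch k(10) f(5)]) (use False bl in fast)+
    moreover have "src L \<in> M ?e s" "f \<in> M ?e s" using KstD(4)[OF K'] L(2) by simp_all
    moreover have "f \<in> M ?e ?w" using L(4) M_K_out[OF k(10) f(5) wS] by simp
    ultimately show ?thesis using chain_elem[OF KstD(1)[OF K']] by blast
  qed
qed

text \<open>If \<open>r\<close> is in the component of \<open>s\<close>, one of the two heads can be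
  made to miss \<open>b\<close>. If not, the exchange at \<open>s\<close> makes \<open>e\<close> a
  root with \<open>A\<close> rooted there. Elementarity forces the head of \<open>A\<close> into the
  component, so this head now misses \<open>b\<close> and keeps \<open>b\<close> reachable; the head
  of \<open>B\<close> still misses \<open>e\<close>, now a reachable colour.\<close>

lemma gain_rho:
  assumes K: "Kst ed p a b" and L: "free_chn ed (A @ B)" "A \<noteq> []" "B \<noteq> []" "src A = e" "src B \<in> M ed x"
    and m: "e \<in> M ed (fst (hd A))" "e \<in> M ed (fst (hd B))"
  shows "gain ed p a"
proof -
  note k = KstD[OF K] and ch = free_chnD(1)[OF L(1)]
  have chA: "chn ed A" "chn ed B" "fst ` set A \<inter> fst ` set B = {}" using ch chn_append[OF L(2,3)] by auto
  let ?w = "fst (hd A)" let ?z = "fst (hd B)" let ?S = "kcomp ed b e s"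
  have lA: "last A \<in> set (A @ B)" using L(2) by simp
  have e: "e \<notin> C ed" "e \<noteq> p" "e \<noteq> a" "e \<noteq> b" "e < n"
    using L(4) lA free_chnD(2)[OF L(1) lA] free_col[OF K L(1) lA] m M_less by auto
  note fa = free_chn_append[OF k(2) L(1-3)]
  have bA: "y \<in> set (butlast A) \<Longrightarrow> snd y \<noteq> b \<and> snd y \<noteq> e" for y
    using chn_butlast_src[OF k(2) chA(1)] L(4) free_col[OF K L(1)] in_set_butlastD[of y A] by auto
  have bB: "snd y \<noteq> b \<and> snd y \<noteq> e" if "y \<in> set B" for y
    using fa(4)[OF that] L(4) free_col[OF K L(1), of y] that by simp
  note fB = fa(2)
  have hA: "hd A \<in> set A" "hd B \<in> set B" using L by simp_all
  have wz: "?w \<noteq> ?z" using chA(3) hA by blast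
  note ne = hd_ne[OF K chA(1)] hd_ne[OF K chA(2)]
  have via_z: "gain ed p a" if "r \<in> ?S" "?z \<notin> ?S" "x \<in> ?S \<or> e \<notin> M ed x"
  proof -
    let ?e = "K ed b e ?z"
    note e1 = Kst_swap_b[OF K e(1,2,5) that(1,2)]
    have Mx: "M ?e x = M ed x"
      using that(3) M_K_out[OF k(10) e(5) comp_disj[OF k(2) _ that(2)]] M_K_same[OF k(10) e(5)] Kst_x[OF K] by blast
    have "chn ?e B" by (rule chn_K[OF chA(2) k(10) e(5)]) (use comp_disj[OF k(2) that(1,2)] bB in_set_butlastD in fast)+
    then have "free_chn ?e B" by (rule free_stable[OF fB e1(2)])
    moreover have "b \<in> M ?e ?z" using m k(10) e(5) by (simp add: M_K)
    ultimately have "gain ?e p a"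
      using gain_hit_free[OF e1(1), of B b] L Mx M_s_C[of b ?e] KstD(4)[OF e1(1)] Kst_x[OF e1(1)] by simp
    moreover have "tokens ed \<le> tokens ?e" by (rule tokens_le) (simp add: Mx stable_C[OF e1(2)])
    ultimately show ?thesis by (rule gain_le)
  qed
  show ?thesis
  proof (cases "r \<in> ?S")
    case rS: True
    show ?thesis
    proof (cases "e \<in> M ed x")
      case True
      have xS: "x \<in> ?S" by (rule Kst_linked_s[OF K True])
      have "?z \<notin> ?S"
        using three_ends[OF k(2) e(4)[symmetric], of s s x ?z] xS ne xu k(4) m True by auto
      then show ?thesis using via_z rS xS by blast
    next
      case ex: False
      show ?thesis
      proof (cases "?z \<in> ?S")
        case False
        then show ?thesis using via_z rS ex by blast
      next
        case zS: True
        have wS: "?w \<notin> ?S" using three_ends[OF k(2) e(4)[symmetric], of s s ?z ?w] zS ne wz k(4) m by auto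
        let ?e = "K ed b e ?w"
        note e1 = Kst_swap_b[OF K e(1,2,5) rS wS]
        have Mx: "M ?e x = M ed x" using M_K_same[OF k(10) e(5)] Kst_x[OF K] ex by blast
        have cA: "chn ?e A" by (rule chn_K[OF chA(1) k(10) e(5)]) (use comp_disj[OF k(2) rS wS] bA in fast)+
        have cB: "chn ?e B" by (rule chn_K[OF chA(2) k(10) e(5)]) (use comp_disj[OF k(2) rS wS] bB in_set_butlastD in fast)+
        have "e \<in> M ?e ?z" using m(2) M_K_out[OF k(10) e(5) comp_disj[OF k(2) zS wS]] by simp
        then have "chn ?e (A @ B)" using chn_append[OF L(2,3), of ?e] cA cB chA(3) L(4) by simp
        then have "free_chn ?e (A @ B)" by (rule free_stable[OF L(1) e1(2)])
        moreover have "b \<in> M ?e ?w" using m k(10) e(5) by (simp add: M_K)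
        ultimately have "gain ?e p a"
          using gain_hit_free[OF e1(1), of "A @ B" b] L Mx M_s_C[of b ?e] KstD(4)[OF e1(1)] Kst_x[OF e1(1)] by simp
        moreover have "tokens ed \<le> tokens ?e" by (rule tokens_le) (simp add: Mx stable_C[OF e1(2)])
        ultimately show ?thesis by (rule gain_le)
      qed
    qed
  next
    case rS: False
    let ?e = "K ed b e s"
    note K' = Kst_swap_s[OF K e(1,2,5) rS]
    note k' = KstD[OF K']
    have cA: "chn ?e A" by (rule chn_K[OF chA(1) k(10) e(5)]) (use rS bA in fast)+
    have cB: "chn ?e B" by (rule chn_K[OF chA(2) k(10) e(5)]) (use rS bB in_set_butlastD in fast)+
    have sA: "src A \<in> M ?e s" "e \<in> M ?e s" using k'(4) L(4) by simp_all
    have wS: "?w \<in> ?S"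
    proof (rule ccontr)
      assume "?w \<notin> ?S"
      then have "e \<in> M ?e ?w" using m(1) M_K_out[OF k(10) e(5)] by simp
      then show False using chain_elem[OF k'(1) cA sA(1) _ sA(2)] by blast
    qed
    have zS: "?z \<notin> ?S" using three_ends[OF k(2) e(4)[symmetric], of s s ?w ?z] wS ne wz k(4) m by auto
    have ex: "e \<notin> M ed x"
    proof
      assume ex: "e \<in> M ed x"
      show False using three_ends[OF k(2) e(4)[symmetric], of s s x ?w] Kst_linked_s[OF K ex] wS ne xu k(4) m ex by auto
    qed
    have Mx: "M ?e x = M ed x" using M_K_same[OF k(10) e(5)] Kst_x[OF K] ex by blast
    have "b \<in> M ?e ?w" using m(1) wS k(10) e(5) by (simp add: M_K)
    then have bC: "b \<in> C ?e" using chain_D[OF cA] sA(1) C_I by blast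
    have CC: "c \<in> C ?e" if "c \<in> D ed d" "d \<in> M ed s" for c d
      using that
    proof (induction rule: D.induct)
      case D0
      then show ?case using k(4) k'(4) bC M_s_C by blast
    next
      case (D1 i y i')
      have i: "i \<in> C ed" "i' \<in> C ed" using D1 C_I D.D1 by blast+
      have "y \<noteq> s" using D1(2) valid_not_s[OF k(1)] by blast
      then have "i' \<noteq> b" using fan_elementary[OF k(1) Fv_I[OF i(1) D1(2)] _ Fv_s] D1(3) k(4) by blast
      moreover have "i' \<noteq> e" using i e(1) by blast
      ultimately have "i' \<in> M ?e y" using D1 by (simp add: M_K_other[OF k(10) e(5)])
      moreover have "?e r y i" using D1 rS by (simp add: K_ed_out)
      ultimately show ?case using C_step D1 by blast
    qed
    then have sub: "C ed \<subseteq> C ?e" by (auto simp: C_def)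
    have kle: "tokens ed \<le> tokens ?e" by (rule tokens_le) (use Mx sub in auto)
    have "e \<in> M ?e ?z" using m(2) M_K_out[OF k(10) e(5) zS] by simp
    moreover have "e \<in> C ?e" using sA M_s_C by blast
    ultimately have h: "gain ?e p a" if "snd ` set B \<inter> C ?e \<inter> M ?e x = {}"
      using gain_hit[OF K' cB, of e] L(5) Mx ex free_col[OF K fB] that by (metis imageE)
    show ?thesis
    proof (cases "snd ` set B \<inter> C ?e \<inter> M ?e x = {}")
      case True
      then show ?thesis using h gain_le kle by blast
    next
      case False
      then obtain y where y: "y \<in> set B" "snd y \<in> C ?e" "snd y \<in> M ?e x" by blast
      have "tokens ed < tokens ?e" by (rule tokens_less[of _ _ "snd y"]) (use y Mx sub free_chnD(2)[OF fB] in auto)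
      then show ?thesis unfolding gain_def using K' by blast
    qed
  qed
qed

text \<open>Of the outcomes of \<open>greedy\<close>, only a hit on a colour that \<open>x\<close>
  itself misses fails to produce a gain.\<close>

lemma gain_or_token_chain:
  assumes K: "Kst ed p a b" and f: "f \<in> M ed x" "f \<notin> C ed"
  shows "gain ed p a \<or> (\<exists>L c. free_chn ed L \<and> src L = f \<and> c \<in> M ed (fst (hd L)) \<and> c \<in> C ed \<inter> M ed x)"
proof -
  note k = KstD[OF K]
  have fr: "f \<notin> M ed r" "f < n" using k(3) f(1) Kst_x[OF K] M_less by auto
  show ?thesis
  proof (rule greedy[OF k(1) fr(2) f(2) fr(1)])
    fix L c assume h: "free_chn ed L" "src L = f" "c \<in> M ed (fst (hd L))" "c \<in> C ed \<or> c \<in> M ed r"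
    show ?thesis
    proof (cases "c \<in> M ed x")
      case True
      then have "c \<in> C ed" using h(4) k(3) Kst_x[OF K] by auto
      then show ?thesis using h True by blast
    next
      case False
      then show ?thesis using gain_hit_free[OF K h(1) _ h(3)] h f k(3) by auto
    qed
  next
    fix L assume "free_chn ed L" "src L = f" "f \<in> M ed (fst (hd L))"
    then show ?thesis using gain_cycle[OF K] f by blast
  next
    fix A B e assume "free_chn ed (A @ B)" "src (A @ B) = f" "A \<noteq> []" "B \<noteq> []" "src A = e"
      "e \<in> M ed (fst (hd B))" "e \<in> M ed (fst (hd A))" "e \<notin> C ed" "e \<notin> M ed r"
    then show ?thesis using gain_rho[OF K, of A B e] f by simp
  qed
qed

text \<open>Such colours avoid the half of \<open>a\<close>, and the half of \<open>b\<close>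
  contains at most one.\<close>

lemma tokens_le1: assumes K: "Kst ed p a b" shows "tokens ed \<le> 1"
proof -
  note k = KstD[OF K]
  have "c = d" if "c \<in> M ed x \<inter> C ed" "d \<in> M ed x \<inter> C ed" for c d
    using that Kst_avoids_D[OF K] Kst_one_D[OF K] C_D[OF k(4)] by blast
  then show ?thesis unfolding tokens_def by (simp add: card_le_Suc0_iff_eq)
qed

lemma tokens_ge1: "c \<in> M ed x \<Longrightarrow> c \<in> C ed \<Longrightarrow> 1 \<le> tokens ed"
  unfolding tokens_def by (simp add: Suc_le_eq card_gt_0_iff) blast

lemma gain_False: "gain ed p a \<Longrightarrow> c \<in> M ed x \<Longrightarrow> c \<in> C ed \<Longrightarrow> False"
  unfolding gain_def using tokens_le1 tokens_ge1 by (meson leD le_less_trans)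

lemma one_token:
  assumes "Kst ed p a b" "c \<in> M ed x" "c \<in> C ed" "d \<in> M ed x" "d \<in> C ed" shows "c = d"
  using assms Kst_avoids_D[OF assms(1)] Kst_one_D[OF assms(1)] C_D[OF KstD(4)[OF assms(1)]] by blast

text \<open>Otherwise consider the exchange of \<open>a\<close> and \<open>c\<close> at the head.
  Its component avoids \<open>x\<close> and \<open>u\<close>, which are joined by colour
  \<open>a\<close>, and also \<open>s\<close> and the fan vertex missing \<open>c\<close>, the ends
  of another component. So the configuration and the reachable colour \<open>c\<close> survive,
  while the head misses \<open>a\<close>: a gain, which is impossible.\<close>

lemma one_holder:
  assumes K: "Kst ed p a b" and c: "c \<in> M ed x" "c \<in> C ed"
    and L: "free_chn ed L" "src L \<in> M ed x" "c \<in> M ed (fst (hd L))"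
  shows "fst (hd L) \<in> kcomp ed a c x"
proof (rule ccontr)
  note k = KstD[OF K] and ch = free_chnD(1)[OF L(1)]
  let ?w = "fst (hd L)" let ?e = "K ed a c ?w"
  assume "?w \<notin> kcomp ed a c x"
  then have xw: "x \<notin> kcomp ed a c ?w" using comp_sym[OF k(2)] by blast
  have uw: "u \<notin> kcomp ed a c ?w" using comp_edge[OF k(2), of x u a c ?w] xw k(14) by blast
  have n: "a < n" "c < n" using k(9) c M_less by auto
  have ne: "c \<noteq> a" "c \<noteq> b" "c \<noteq> p" using Kst_x[OF K] c by auto
  have cD: "c \<in> D ed b" using Kst_avoids_D[OF K c(1)] c(2) C_D[OF k(4)] by blast
  then obtain j y where y: "j \<in> D ed b" "ed r y j" "c \<in> M ed y" using ne by (auto elim: D.cases)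
  obtain L0 where L0: "chn ed ((y, j) # L0)" "src ((y, j) # L0) = b" using D_chain[OF k(2) y(1,2)] by blast
  have bs: "b \<in> M ed s" "a \<in> M ed s" using k(4) by auto
  have ys: "y \<in> kcomp ed a c s" using fan_linked_s[OF k(1) bs _ y] k(5) by blast
  have Fy: "Fv ed y" using chain_Fv[OF L0(1), of "(y, j)"] L0(2) bs by simp
  have yne: "y \<noteq> s" "y \<noteq> ?w"
    using y(2) valid_not_s[OF k(1)] free_Fv[OF k(1) L(1), of "hd L"] chn_Nil[OF ch] Fy by auto
  have ws: "?w \<notin> kcomp ed a c s"
    using three_ends[OF k(2) ne(1)[symmetric], of s s y ?w] ys yne hd_ne[OF K ch] bs y(3) L(3) by auto
  have sw: "s \<notin> kcomp ed a c ?w" by (rule comp_disj[OF k(2) comp_refl ws])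
  have yw: "y \<notin> kcomp ed a c ?w" by (rule comp_disj[OF k(2) ys ws])
  have v: "valid ?e" by (rule valid_K[OF k(1) n])
  have "p \<in> M ?e r" using k ne by (simp add: M_K_other[OF n])
  then have "M ?e r = {p}" by (rule valid_r_eq[OF v])
  then have K': "Kst ?e p a b"
    using v k M_K_out[OF n sw] K_ed_out[OF uw] ne by (simp add: Kst_def K_ed_other)
  have Mx: "M ?e x = M ed x" by (rule M_K_out[OF n xw])
  have col0: "a \<notin> snd ` set ((y, j) # L0)" "c \<notin> snd ` set ((y, j) # L0)"
    using chain_col[OF k(1) L0(1)] L0(2) bs k(5) y(3) by auto
  have "chn ?e ((y, j) # L0)"
    by (rule chn_K[OF L0(1) n]) (use col0 imageI[OF in_set_butlastD, of _ "(y, j) # L0" snd] in fast)+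
  moreover have "c \<in> M ?e y" using y(3) M_K_out[OF n yw] by simp
  ultimately have "c \<in> D ?e b" using chain_D[of ?e "(y, j) # L0"] L0(2) by auto
  then have cC: "c \<in> C ?e" using C_D[OF KstD(4)[OF K']] by blast
  have colL: "snd z \<noteq> a \<and> snd z \<noteq> c" if "z \<in> set L" for z
    using free_col[OF K L(1) that] free_chnD(2)[OF L(1) that] c(2) by blast
  have "chn ?e L" by (rule chn_K[OF ch n]) (use colL in_set_butlastD in fast)+
  moreover have "a \<in> M ?e ?w" using L(3) n by (simp add: M_K)
  moreover have "snd ` set L \<inter> C ?e \<inter> M ?e x = {}"
  proof (rule ccontr)
    assume "\<not> ?thesis"
    then obtain z where "z \<in> set L" "snd z \<in> C ?e" "snd z \<in> M ?e x" by blast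
    then show False using one_token[OF K' _ cC] c(1) Mx colL by metis
  qed
  moreover have "a \<in> C ?e" using M_s_C KstD(4)[OF K'] by blast
  ultimately have "gain ?e p a"
    using gain_hit[OF K', of L a] L(2) Mx Kst_x[OF K'] colL by (metis imageE)
  then show False using gain_False cC c(1) Mx by blast
qed

text \<open>Exchange \<open>b\<close> with \<open>src A\<close>. If this is done at the head of
  \<open>B\<close>, that head misses \<open>b\<close>. If it is done at \<open>s\<close>, then
  \<open>A\<close> becomes a chain rooted at \<open>s\<close>, which keeps \<open>c\<close>
  reachable, and the head of \<open>B\<close> misses the new root colour. Either way
  \<open>B\<close> produces an impossible gain.\<close>

lemma merge_tail:
  assumes K: "Kst ed p a b" and L: "free_chn ed (A @ B)" "A \<noteq> []" "B \<noteq> []" and s: "src B \<in> M ed x"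
    and z: "fst (hd B) \<notin> kcomp ed b (src A) s" and c: "c \<in> M ed (fst (hd A))" "c \<in> M ed x" "c \<in> C ed"
  shows False
proof -
  note k = KstD[OF K] and fa = free_chn_append[OF k(2) L]
  note chA = free_chnD(1)[OF fa(1)] free_chnD(1)[OF fa(2)] fa(3)
  let ?z = "fst (hd B)" let ?g = "src A" let ?S = "kcomp ed b ?g s"
  have lA: "last A \<in> set (A @ B)" using L(2) by simp
  have g: "?g \<notin> C ed" "?g \<noteq> p" "?g \<noteq> a" "?g \<noteq> b" "?g < n"
    using free_chnD(2)[OF L(1) lA] free_col[OF K L(1) lA] fa(3) M_less by auto
  have bA: "snd y \<noteq> b \<and> snd y \<noteq> ?g" if "y \<in> set (butlast A)" for y
  proof -
    have "y \<in> set (A @ B)" using in_set_butlastD[OF that] by simp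
    then show ?thesis using chn_butlast_src[OF k(2) chA(1) that] free_col[OF K L(1), of y] by blast
  qed
  have bB: "snd y \<noteq> b \<and> snd y \<noteq> ?g" if "y \<in> set B" for y
    using fa(4)[OF that] free_col[OF K L(1), of y] that by simp
  show False
  proof (cases "r \<in> ?S")
    case True
    let ?e = "K ed b ?g ?z"
    note e1 = Kst_swap_b[OF K g(1,2,5) True z]
    have Mx: "M ?e x = M ed x"
    proof (cases "?g \<in> M ed x")
      case gx: True
      show ?thesis by (rule M_K_out[OF k(10) g(5) comp_disj[OF k(2) Kst_linked_s[OF K gx] z]])
    next
      case False
      then show ?thesis by (intro M_K_same[OF k(10) g(5)]) (use Kst_x[OF K] in auto)
    qed
    have "chn ?e B" by (rule chn_K[OF chA(2) k(10) g(5)]) (use comp_disj[OF k(2) True z] bB in_set_butlastD in fast)+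
    then have "free_chn ?e B" by (rule free_stable[OF fa(2) e1(2)])
    moreover have "b \<in> M ?e ?z" using chA(3) k(10) g(5) by (simp add: M_K)
    ultimately have "gain ?e p a"
      using gain_hit_free[OF e1(1), of B b] s Mx M_s_C[of b ?e] KstD(4)[OF e1(1)] Kst_x[OF e1(1)] by simp
    then show False using gain_False c Mx stable_C[OF e1(2)] by blast
  next
    case rS: False
    let ?e = "K ed b ?g s"
    note K' = Kst_swap_s[OF K g(1,2,5) rS]
    note k' = KstD[OF K']
    have cA: "chn ?e A" by (rule chn_K[OF chA(1) k(10) g(5)]) (use rS bA in fast)+
    have cB: "chn ?e B" by (rule chn_K[OF chA(2) k(10) g(5)]) (use rS bB in_set_butlastD in fast)+
    have cg: "c \<noteq> b" "c \<noteq> ?g" using c g Kst_x[OF K] by auto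
    have cx: "c \<in> M ?e x" "c \<in> M ?e (fst (hd A))" using c cg by (simp_all add: M_K_other[OF k(10) g(5)])
    have cC: "c \<in> C ?e" using chain_D[OF cA] k'(4) cx(2) C_I[of ?g ?e c] by auto
    have gx: "?g \<notin> M ?e x" by (rule Kst_x(3)[OF K'])
    have sB: "src B \<in> M ?e x" using s bB[of "last B"] L(3) by (simp add: M_K_other[OF k(10) g(5)])
    have "?g \<in> M ?e ?z" using chA(3) M_K_out[OF k(10) g(5) z] by simp
    moreover have "snd ` set B \<inter> C ?e \<inter> M ?e x = {}"
    proof (rule ccontr)
      assume "\<not> ?thesis"
      then obtain y where y: "y \<in> set B" "snd y \<in> C ?e" "snd y \<in> M ?e x" by blast
      then have "snd y = c" using one_token[OF K' cx(1) cC] by metis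
      then show False using y free_chnD(2)[OF fa(2) y(1)] c by simp
    qed
    moreover have "?g \<in> C ?e" using k'(4) M_s_C by blast
    ultimately have "gain ?e p a"
      using gain_hit[OF K' cB sB, of ?g] gx free_col[OF K fa(2)] by (metis imageE)
    then show False using gain_False cx(1) cC by blast
  qed
qed

text \<open>One chain stops where the other continues: \<open>x\<close> misses \<open>src A\<close>
  and occupies the second end of the component of \<open>s\<close>.\<close>

lemma merge_at_x:
  assumes K: "Kst ed p a b" and L: "free_chn ed (A @ B)" "A \<noteq> []" "B \<noteq> []"
    and s: "src A \<in> M ed x" "src B \<in> M ed x" and c: "c \<in> M ed (fst (hd A))" "c \<in> M ed x" "c \<in> C ed"
  shows False
proof (rule merge_tail[OF K L s(2) _ c], rule notI)
  note k = KstD[OF K] and fa = free_chn_append[OF k(2) L]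
  assume z: "fst (hd B) \<in> kcomp ed b (src A) s"
  have "b \<noteq> src A" using Kst_x[OF K] s by auto
  then show False using three_ends[OF k(2), of b "src A" s s x "fst (hd B)"] Kst_linked_s[OF K s(1)] z
      hd_ne[OF K free_chnD(1)[OF fa(2)]] xu k(4) s fa(3) by auto
qed

text \<open>The heads of \<open>B\<close> and \<open>B'\<close> both miss \<open>src A\<close>, but
  only one of them can share the component of \<open>s\<close>.\<close>

lemma merge_apart:
  assumes K: "Kst ed p a b" and L: "free_chn ed (A @ B)" "free_chn ed (A @ B')" "A \<noteq> []" "B \<noteq> []" "B' \<noteq> []"
    "fst (hd B) \<noteq> fst (hd B')"
    and s: "src B \<in> M ed x" "src B' \<in> M ed x" and c: "c \<in> M ed (fst (hd A))" "c \<in> M ed x" "c \<in> C ed"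
  shows False
proof -
  note k = KstD[OF K] and fB = free_chn_append[OF k(2) L(1,3,4)] and fB' = free_chn_append[OF k(2) L(2,3,5)]
  have "last A \<in> set (A @ B)" using L(3) by simp
  then have bg: "b \<noteq> src A" using free_col[OF K L(1)] by metis
  have "fst (hd B) \<notin> kcomp ed b (src A) s \<or> fst (hd B') \<notin> kcomp ed b (src A) s"
    using three_ends[OF k(2) bg, of s s "fst (hd B)" "fst (hd B')"] L(6) k(4) fB(3) fB'(3)
      hd_ne[OF K free_chnD(1)[OF fB(2)]] hd_ne[OF K free_chnD(1)[OF fB'(2)]] by auto
  then show False using merge_tail[OF K L(1,3,4) s(1) _ c] merge_tail[OF K L(2,3,5) s(2) _ c] by blast
qed

text \<open>Arrange that \<open>x\<close> misses a reachable \<open>c\<close>. Two further missing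
  colours are unreachable, and each is the source of a free chain whose head misses
  \<open>c\<close>. By \<open>one_holder\<close> both heads are ends of the
  \<open>a\<close>-\<open>c\<close> component of \<open>x\<close>, hence equal, and the chains can
  be compared where they part.\<close>

lemma Kst_False:
  assumes "Kst ed0 p a b0" shows False
proof -
  have "\<exists>ed b. Kst ed p a b \<and> 1 \<le> tokens ed"
  proof (cases "M ed0 x \<inter> C ed0 = {}")
    case False
    then show ?thesis using assms tokens_ge1 by blast
  next
    case True
    have "M ed0 x \<noteq> {}" using valid_x[OF KstD(1)[OF assms]] by auto
    then obtain f where f: "f \<in> M ed0 x" by blast
    have "gain ed0 p a" using gain_or_token_chain[OF assms f] f True by blast
    then show ?thesis unfolding gain_def by (metis One_nat_def Suc_leI le_zero_eq not_gr_zero not_less_zero)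
  qed
  then obtain ed b where K: "Kst ed p a b" and kt: "1 \<le> tokens ed" by blast
  note k = KstD[OF K]
  obtain c where c: "c \<in> M ed x" "c \<in> C ed" 
  proof -
    have "M ed x \<inter> C ed \<noteq> {}" using kt unfolding tokens_def by (metis card.empty not_one_le_zero)
    then show thesis using that by blast
  qed
  have ng: "\<not> gain ed p a" using gain_False c by blast
  have "card (M ed x - {c}) \<ge> 2" using valid_x[OF k(1)] c(1) by (simp add: card_Diff_singleton)
  then obtain f g where fg: "f \<in> M ed x - {c}" "g \<in> M ed x - {c}" "f \<noteq> g"
    by (metis card_le_Suc0_iff_eq finM finite_Diff not_less_eq_eq numeral_2_eq_2)
  have nC: "f \<notin> C ed" "g \<notin> C ed" using one_token[OF K c] fg by blast+
  have ld: "\<exists>L. free_chn ed L \<and> src L = h \<and> c \<in> M ed (fst (hd L))" if "h \<in> M ed x" "h \<notin> C ed" for h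
    using gain_or_token_chain[OF K that] ng one_token[OF K c] by blast
  obtain L where L: "free_chn ed L" "src L = f" "c \<in> M ed (fst (hd L))" using ld fg nC by blast
  obtain L' where L': "free_chn ed L'" "src L' = g" "c \<in> M ed (fst (hd L'))" using ld fg nC by blast
  note ch = free_chnD(1)[OF L(1)] free_chnD(1)[OF L'(1)]
  have h: "hd L \<in> set L" "hd L' \<in> set L'" using chn_Nil ch by auto
  have "fst (hd L) \<in> kcomp ed a c x" "fst (hd L') \<in> kcomp ed a c x"
    using one_holder[OF K c] L L' fg by auto
  moreover have "a \<noteq> c" using Kst_x[OF K] c by blast
  ultimately have "fst (hd L) = fst (hd L')"
    using three_ends[OF k(2), of a c x x "fst (hd L)" "fst (hd L')"] hd_ne[OF K ch(1)] hd_ne[OF K ch(2)] c L L' by auto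
  then have heq: "hd L = hd L'"
    using chn_edge[OF ch(1) h(1)] chn_edge[OF ch(2) h(2)] pcol_col[OF k(2)] by (simp add: prod_eq_iff)
  obtain A B B' where AB: "L = A @ B" "L' = A @ B'" "B = [] \<or> B' = [] \<or> hd B \<noteq> hd B'"
    using common_prefix[of L L'] by blast
  have A: "A \<noteq> []" using AB heq h by (cases "B = [] \<or> B' = []") auto
  have cA: "c \<in> M ed (fst (hd A))" using L(3) AB A by simp
  consider "B = []" "B' = []" | "B = []" "B' \<noteq> []" | "B \<noteq> []" "B' = []" | "B \<noteq> []" "B' \<noteq> []" "hd B \<noteq> hd B'"
    using AB(3) by blast
  then show False
  proof cases
    case 1
    then show False using AB L(2) L'(2) fg(3) by simp
  next
    case 2
    then show False using merge_at_x[OF K, of A B' c] L' L(2) AB A cA c fg by simp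
  next
    case 3
    then show False using merge_at_x[OF K, of A B c] L L'(2) AB A cA c fg by simp
  next
    case 4
    have "fst (hd B) \<noteq> fst (hd B')"
    proof
      assume eq: "fst (hd B) = fst (hd B')"
      have "hd B \<in> set L" "hd B' \<in> set L'" using AB 4 by simp_all
      then have "snd (hd B) = snd (hd B')"
        using chn_edge[OF ch(1)] chn_edge[OF ch(2)] eq pcol_col[OF k(2)] by metis
      then show False using eq 4(3) by (simp add: prod_eq_iff)
    qed
    then show False using merge_apart[OF K, of A B B' c] L L' AB A 4 cA c fg by simp
  qed
qed

section \<open>The colour of \<open>su\<close> when the colour of \<open>ux\<close> is missing at
  \<open>s\<close>\<close>

text \<open>Otherwise an exchange at \<open>s\<close> gives \<open>su\<close> the colour
  \<open>p\<close> while \<open>r\<close> keeps missing it, which is the excluded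
  configuration.\<close>

lemma su_linked_r:
  assumes v: "valid ed" and m: "M ed r = {p}" "M ed s = {a, b}" "a \<noteq> b" and e: "ed u x a" "ed s u c"
    and s: "c = p \<or> s \<notin> kcomp ed p c r"
  shows False
proof (cases "c = p")
  case True
  then have "Kst ed p a b" using assms by (simp add: Kst_def)
  then show False by (rule Kst_False)
next
  case False
  note pc = valid_pcol[OF v]
  have n: "p < n" "c < n" using m M_less pcolD(2)[OF pc e(2)] by blast+
  have ne: "p \<noteq> a" "p \<noteq> b" "c \<noteq> a" "c \<noteq> b" using nocol[OF v, of p] m e(2) M_not[of _ ed s u] by auto
  let ?e = "K ed p c s"
  have r: "r \<notin> kcomp ed p c s" using notin_comp_sym[OF pc] s False by blast
  have "?e s u p" using e(2) by (simp add: K_ed)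
  then have "Kst ?e p a b" using valid_K[OF v n] M_K_out[OF n r] M_K_same[OF n, of ed s] m e ne
    by (simp add: Kst_def K_ed_other)
  then show False by (rule Kst_False)
qed

lemma shift_target:
  assumes v: "valid ed" and p: "p \<in> M ed r" and L: "free_chn ed L" "p \<in> M ed (fst (hd L))"
  obtains ed' where "valid ed'" "M ed' r = {src L}" "M ed' s = M ed s" "\<And>a. a \<in> M ed s \<Longrightarrow> D ed' a = D ed a"
    "C ed' = C ed" "M ed' x = M ed x" "\<And>c. ed' s u c = ed s u c" "\<And>c. ed' u x c = ed u x c"
proof -
  note ch = free_chnD(1)[OF L(1)]
  obtain ed' where sh: "shifted ed ed' L p" using shift[OF v ch L(2) p] by blast
  note s' = shiftedD[OF sh] and d = shift_D[OF v L(1) p sh]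
  have "x \<notin> fst ` set L" using chn_x[OF v ch] by blast
  then have "M ed' x = M ed x" using s'(3) xu(2) by blast
  then show thesis using that[of ed'] s'(1,4) d xu rs by metis
qed

lemma shift_Kst:
  assumes v: "valid ed" and m: "M ed r = {p}" "M ed s = {a, b}" "a \<noteq> b" and e: "ed u x a" "ed s u c"
    and L: "free_chn ed L" "src L = c" "p \<in> M ed (fst (hd L))"
  shows False
proof -
  have p: "p \<in> M ed r" using m by simp
  from shift_target[OF v p L(1,3)] obtain ed' where "valid ed'" "M ed' r = {src L}" "M ed' s = M ed s"
    "ed' s u c = ed s u c" "ed' u x a = ed u x a" by metis
  then have "Kst ed' c a b" using m e L(2) by (simp add: Kst_def)
  then show False by (rule Kst_False)
qed

lemma valid_su: "valid ed \<Longrightarrow> s \<in> V \<and> u \<in> V \<and> x \<in> V"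
  using valid_ex[of ed] xu pcolD(3,4)[OF valid_pcol] by metis

text \<open>An exchange at \<open>r\<close> gives \<open>su\<close> and the last edge of the chain
  the colour \<open>p\<close> and makes the head miss \<open>p\<close>. Then \<open>s u x\<close> is
  a \<open>p\<close>-\<open>a\<close> component; exchanging it makes \<open>s\<close> miss
  \<open>p\<close>. So the recoloured chain is rooted at \<open>s\<close> while its head misses
  \<open>p\<close> too, against elementarity.\<close>

lemma su_cycle:
  assumes v: "valid ed" and m: "M ed r = {p}" "M ed s = {a, b}" "a \<noteq> b" and e: "ed u x a" "ed s u c"
    and p: "p \<in> M ed x" and s: "s \<in> kcomp ed p c r"
    and L: "free_chn ed L" "src L = c" "c \<in> M ed (fst (hd L))" "fst (hd L) \<in> kcomp ed p c r"
  shows False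
proof -
  note pc = valid_pcol[OF v] and ch = free_chnD(1)[OF L(1)]
  let ?w = "fst (hd L)" let ?e = "K ed p c r" let ?S = "{x, u, s}"
  have h: "hd L \<in> set L" and lL: "last L \<in> set L" using chn_Nil[OF ch] by simp_all
  have n: "p < n" "c < n" "a < n" using m M_less pcolD(2)[OF pc e(2)] by blast+
  have col: "snd y \<noteq> p \<and> snd y \<noteq> a \<and> snd y \<noteq> b" if "y \<in> set L" for y
    using free_chnD(2)[OF L(1) that] chn_not_r[OF ch that] M_s_C m by blast
  then have ne: "p \<noteq> c" "p \<noteq> a" "p \<noteq> b" "c \<noteq> a" "c \<noteq> b" using col[OF lL] L(2) nocol[OF v, of p] m by auto
  have wne: "?w \<noteq> r" "?w \<noteq> x" "?w \<noteq> s" "?w \<noteq> u"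
    using chn_r[OF pc ch h] chn_x[OF v ch h] chn_s[OF v ch h] M_not[OF L(3), of s] pcolD(1)[OF pc e(2)] by auto
  have xr: "x \<notin> kcomp ed p c r" using three_ends[OF pc ne(1), of r r ?w x] L(3,4) wne xu m p by auto
  have ve: "valid ?e" by (rule valid_K[OF v n(1,2)])
  note pe = valid_pcol[OF ve]
  have e1: "?e s u p" "?e u x a" using e s ne by (simp_all add: K_ed)
  have m1: "a \<in> M ?e s" "b \<in> M ?e s" "p \<in> M ?e x" "p \<in> M ?e ?w"
    using m ne p M_K_out[OF n(1,2) xr] M_K_in[OF n(1,2) L(4,3)] by (simp_all add: M_K_other[OF n(1,2)])
  have cl: "closed ?e p a ?S" by (rule path_closed[OF pe e1 m1(3,1)])
  let ?f = "swp ?e p a ?S"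
  have vf: "valid ?f" by (rule valid_swp[OF ve n(1,3) cl])
  have rS: "r \<notin> ?S" using xu rs by blast
  \<comment> \<open>The colour \<open>c\<close> occurs on the chain only at its last edge, which the
    exchange at \<open>r\<close> recolours with \<open>p\<close>.\<close>
  let ?h = "\<lambda>k. if k = c then p else k"
  let ?L = "map (map_prod id ?h) L"
  have bc: "snd y \<noteq> c" if "y \<in> set (butlast L)" for y using chn_butlast_src[OF pc ch that] L(2) by simp
  have "chn ?f ?L"
  proof (rule chn_recolour[OF ch])
    fix y assume y: "y \<in> set L"
    show "?f r (fst y) (?h (snd y))" using chn_edge[OF ch y] rS col[OF y]
      by (cases "snd y = c") (simp_all add: swp_def K_ed)
  next
    fix y w assume y: "y \<in> set (butlast L)" "snd y \<in> M ed w"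
    have "snd y \<noteq> p" "snd y \<noteq> a" using col[OF in_set_butlastD[OF y(1)]] by auto
    then show "?h (snd y) \<in> M ?f w" using y(2) bc[OF y(1)]
      by (simp add: M_swp[OF n(1,3)] M_K_other[OF n(1,2)])
  qed
  moreover have "src ?L \<in> M ?f s" using L(2) chn_Nil[OF ch] m1 by (simp add: last_map M_swp[OF n(1,3)])
  moreover have "p \<in> M ?f (fst (hd ?L))" using m1(4) wne chn_Nil[OF ch] by (simp add: hd_map M_swp[OF n(1,3)])
  moreover have "p \<in> M ?f s" using m1 by (simp add: M_swp[OF n(1,3)])
  ultimately show False by (rule chain_elem[OF vf])
qed

text \<open>Here \<open>rs\<close> is coloured and \<open>su\<close> is the uncoloured edge instead.\<close>
lemma two_uncoloured:
  assumes pc: "pcol ed" and sp: "\<And>v w. (\<exists>k. ed v w k) \<longleftrightarrow> (G v w \<or> {v, w} = {r, s}) \<and> {v, w} \<noteq> {s, u}"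
    and G: "G u s" and S: "s \<in> V" "u \<in> V" "s \<noteq> u"
    and m: "a \<in> M ed s" "p \<in> M ed s" "c \<in> M ed u" "p \<in> M ed x" and e: "ed u x a"
    and ne: "a \<noteq> p" "a \<noteq> c" "p \<noteq> c"
  shows False
proof -
  have full: False if "pcol f" "\<And>v w. (\<exists>k. f v w k) \<longleftrightarrow> (\<exists>k. ed v w k)" "k \<in> M f s" "k \<in> M f u" for f k
  proof (rule nofull)
    have "\<not> f s u j" for j using that(2)[of s u] sp[of s u] by blast
    then show "pcol (addE f s u k)" by (rule addE_pcol[OF that(1,3,4) S(3,1,2)])
    fix v w
    have "G v w \<or> {v, w} = {r, s}" if "{v, w} = {s, u}"
      using that G xu(4) by (auto simp: doubleton_eq_iff)
    then show "(\<exists>j. addE f s u k v w j) \<longleftrightarrow> G v w \<or> {v, w} = {r, s}"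
      unfolding addE_supp that(2) sp by blast
  qed
  have n: "c < n" "p < n" using m M_less by blast+
  have d: "u \<noteq> x" "ed x u a" using pcolD[OF pc e] by auto
  show False
  proof (cases "s \<in> kcomp ed c p u")
    case False
    show False
    proof (rule full)
      show "pcol (K ed c p u)" by (rule K_pcol[OF pc n])
      show "(\<exists>k. K ed c p u v w k) \<longleftrightarrow> (\<exists>k. ed v w k)" for v w by (rule K_supp)
      show "p \<in> M (K ed c p u) s" using m M_K_out[OF n False] by simp
      show "p \<in> M (K ed c p u) u" by (rule M_K_in'[OF n comp_refl m(3)])
    qed
  next
    case True
    \<comment> \<open>The ends of this component are \<open>u\<close> and \<open>s\<close>. An
      exchange at \<open>x\<close> avoids them and makes \<open>c\<close> available for
      \<open>ux\<close>, which frees \<open>a\<close> for \<open>su\<close>.\<close>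
    have xn: "x \<notin> kcomp ed c p u"
      using three_ends[OF pc ne(3)[symmetric], of u u s x] True S d xu m by auto
    let ?e = "K ed c p x"
    have pe: "pcol ?e" by (rule K_pcol[OF pc n])
    have un: "u \<notin> kcomp ed c p x" "s \<notin> kcomp ed c p x" using comp_disj[OF pc _ xn] True by auto
    have ex: "?e u x a" using e un by (simp add: K_ed_out)
    have mm: "c \<in> M ?e u" "c \<in> M ?e x" "a \<in> M ?e s"
      using M_K_out[OF n un(1)] M_K_out[OF n un(2)] m M_K_in[OF n comp_refl m(4)] by simp_all
    note rc = recolour_edge[OF pe ex mm(1,2)]
    show False
    proof (rule full[OF rc(1)])
      show "(\<exists>k. addE (delE ?e u x) u x c v w k) \<longleftrightarrow> (\<exists>k. ed v w k)" for v w using rc(2) K_supp by metis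
      show "a \<in> M (addE (delE ?e u x) u x c) s" unfolding rc(3) using mm xu S by auto
      show "a \<in> M (addE (delE ?e u x) u x c) u" unfolding rc(3) using ne by auto
    qed
  qed
qed

text \<open>
  Uncolour \<open>su\<close> as well. Then \<open>u\<close> may be joined by a \<open>p\<close>-\<open>c\<close> path to \<open>r\<close>, in which case an exchange and
  a recolouring of \<open>ux\<close> allow \<open>su\<close> to take \<open>a\<close>; otherwise either \<open>su\<close> can take \<open>b\<close>, or \<open>rs\<close> can be coloured
  and \<open>su\<close> remains, which is the situation of \<open>two_uncoloured\<close>.
\<close>
lemma su_hits_root:
  assumes v: "valid ed" and m: "M ed r = {p}" "M ed s = {a, b}" "a \<noteq> b" and e: "ed u x a" "ed s u c"
    and p: "p \<in> M ed x" and s: "s \<in> kcomp ed p c r"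
    and L: "free_chn ed L" "src L = c" "a \<in> M ed (fst (hd L))"
  shows False
proof -
  note pc = valid_pcol[OF v] and ch = free_chnD(1)[OF L(1)] and VV = valid_su[OF v]
  let ?w = "fst (hd L)" let ?d = "delE ed s u" let ?e = "K (delE ed s u) p c r"
  have h: "hd L \<in> set L" and lL: "last L \<in> set L" using chn_Nil[OF ch] by simp_all
  have n: "p < n" "c < n" "a < n" "b < n" using m M_less pcolD(2)[OF pc e(2)] by blast+
  have col: "snd y \<noteq> p \<and> snd y \<noteq> a \<and> snd y \<noteq> b" if "y \<in> set L" for y
    using free_chnD(2)[OF L(1) that] chn_not_r[OF ch that] M_s_C m by blast
  then have ne: "p \<noteq> c" "p \<noteq> a" "p \<noteq> b" "c \<noteq> a" "c \<noteq> b" using col[OF lL] L(2) nocol[OF v, of p] m by auto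
  have su: "s \<noteq> u" "u \<noteq> x" using u_ne[OF v] by auto
  have eu: "ed u s c" by (rule pcolD(1)[OF pc e(2)])
  have Guv: "G u s" using valid_G[OF v eu] .
  have wne: "?w \<noteq> r" "?w \<noteq> x" "?w \<noteq> s" "?w \<noteq> u"
    using chn_r[OF pc ch h] chn_x[OF v ch h] chn_s[OF v ch h] M_not[OF L(3), of x] e(1) by auto
  have pd: "pcol ?d" by (rule delE_pcol[OF pc])
  have Md: "M ?d y = (if y = s \<or> y = u then insert c (M ed y) else M ed y)" for y by (rule M_delE[OF pc e(2)])
  have pe: "pcol ?e" by (rule K_pcol[OF pd n(1,2)])
  have spe: "(\<exists>k. ?e y z k) \<longleftrightarrow> G y z \<and> {y, z} \<noteq> {s, u}" for y z
    unfolding K_supp delE_supp using v unfolding valid_def by blast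
  have ux: "?e u x a" using e(1) ne su xu by (simp add: K_ed_other delE_def doubleton_eq_iff)
  have rM: "c \<in> M ?e r" by (rule M_K_in'[OF n(1,2) comp_refl]) (use Md m in simp)
  show False
  proof (cases "s \<in> kcomp ?d p c r")
    case False
    \<comment> \<open>If the component of \<open>r\<close> contained neither end of
      \<open>su\<close>, restoring that edge would not enlarge it, although \<open>s\<close> is then
      known to belong to it.\<close>
    have ur: "u \<in> kcomp ?d p c r"
    proof (rule ccontr)
      assume nu: "u \<notin> kcomp ?d p c r"
      have "closed ed p c (kcomp ?d p c r)"
        unfolding closed_def
      proof (intro ballI allI impI)
        fix y z assume y: "y \<in> kcomp ?d p c r" and yz: "ed y z p \<or> ed y z c"
        have "{y, z} \<noteq> {s, u}" using y nu False by (auto simp: doubleton_eq_iff)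
        then have "?d y z p \<or> ?d y z c" using yz by (simp add: delE_def)
        then show "z \<in> kcomp ?d p c r" by (rule comp_step[OF _ y])
      qed
      then have "kcomp ed p c r \<subseteq> kcomp ?d p c r" by (rule comp_min) simp
      then show False using s False by blast
    qed
    have xr: "x \<notin> kcomp ?d p c r"
      using three_ends[OF pd ne(1), of r r u x] ur xu su rs Md m p by auto
    have mu: "p \<in> M ?e u" by (rule M_K_in[OF n(1,2) ur]) (use Md in simp)
    have mx: "p \<in> M ?e x" using M_K_out[OF n(1,2) xr] Md p xu su by auto
    have ms: "a \<in> M ?e s" "c \<in> M ?e s" using M_K_out[OF n(1,2) False] Md m by auto
    note rc = recolour_edge[OF pe ux mu mx]
    let ?f = "addE (delE ?e u x) u x p" let ?g = "addE ?f s u a"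
    have f: "a \<in> M ?f s" "a \<in> M ?f u" "c \<in> M ?f s" "c \<in> M ?f r"
      unfolding rc(3) using ms rM ne su xu rs by auto
    have nsu: "\<not> ?f s u k" for k using rc(2)[of s u] spe[of s u] by blast
    have pg: "pcol ?g" by (rule addE_pcol[OF rc(1) f(1,2) su(1)]) (use VV nsu in auto)
    have "(\<exists>k. ?g y z k) \<longleftrightarrow> G y z" for y z
      unfolding addE_supp[of ?f] rc(2) spe using Guv xu(4) by (auto simp: doubleton_eq_iff)
    then have vg: "valid ?g" using pg by (simp add: valid_def)
    have "c \<in> M ?g r" "c \<in> M ?g s" unfolding M_addE[OF n(3) su(1)] using f ne xu rs by auto
    then show False by (rule nocol[OF vg])
  next
    case sr: True
    have ur: "u \<notin> kcomp ?d p c r"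
      using three_ends[OF pd ne(1), of r r s u] sr xu su rs Md m by auto
    have xr: "x \<notin> kcomp ?d p c r"
      using three_ends[OF pd ne(1), of r r s x] sr xu su rs Md m p by auto
    have mu: "c \<in> M ?e u" using M_K_out[OF n(1,2) ur] Md by simp
    have mx: "p \<in> M ?e x" using M_K_out[OF n(1,2) xr] Md p xu su by auto
    have ms: "p \<in> M ?e s" "a \<in> M ?e s" "b \<in> M ?e s"
      using M_K_in[OF n(1,2) sr] Md m ne by (auto simp: M_K_other[OF n(1,2)])
    have nrs: "\<not> K ?e c b z r s k" for z k
      using K_supp[of ?e c b z r s] spe[of r s] rs by blast
    have fin: False if "pcol f" "\<And>y z. (\<exists>k. f y z k) \<longleftrightarrow> G y z \<and> {y, z} \<noteq> {s, u}" "k \<in> M f r" "k \<in> M f s"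
        "p \<in> M f s" "a \<in> M f s" "c \<in> M f u" "p \<in> M f x" "f u x a" "k \<noteq> p" "k \<noteq> a" for f k
    proof -
      have nf: "\<not> f r s j" for j using that(2)[of r s] rs by blast
      have kn: "k < n" using that M_less by blast
      show False
      proof (rule two_uncoloured)
        show "pcol (addE f r s k)" by (rule addE_pcol[OF that(1,3,4) rs(1,4,5) nf])
        have "{r, s} \<noteq> {s, u}" using rs xu by (auto simp: doubleton_eq_iff)
        then show "(\<exists>j. addE f r s k y z j) \<longleftrightarrow> (G y z \<or> {y, z} = {r, s}) \<and> {y, z} \<noteq> {s, u}" for y z
          unfolding addE_supp that(2) by blast
        show "a \<in> M (addE f r s k) s" "p \<in> M (addE f r s k) s" "c \<in> M (addE f r s k) u" "p \<in> M (addE f r s k) x"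
          unfolding M_addE[OF kn rs(1)] using that xu su by auto
        show "addE f r s k u x a" using that(9) by (simp add: addE_def)
      qed (use Guv VV su ne in auto)
    qed
    have spK: "(\<exists>k. K ?e c b z y w k) \<longleftrightarrow> G y w \<and> {y, w} \<noteq> {s, u}" for z y w
      unfolding K_supp[of ?e] by (rule spe)
    have pK: "pcol (K ?e c b z)" for z by (rule K_pcol[OF pe n(2,4)])
    have oth: "p \<in> M (K ?e c b z) s" "a \<in> M (K ?e c b z) s" "p \<in> M (K ?e c b z) x" "K ?e c b z u x a" for z
      using ms mx ux ne m(3) by (simp_all add: M_K_other[OF n(2,4)] K_ed_other)
    \<comment> \<open>Now \<open>r\<close> and \<open>u\<close> miss \<open>c\<close>, and
      \<open>s\<close> misses \<open>b\<close>, so no \<open>c\<close>-\<open>b\<close> component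
      contains all three. If it joins \<open>r\<close> and \<open>u\<close>, an exchange at
      \<open>s\<close> frees \<open>c\<close> for \<open>rs\<close>; if it joins \<open>u\<close>
      and \<open>s\<close>, an exchange at \<open>r\<close> frees \<open>b\<close> for
      \<open>rs\<close>; otherwise an exchange at \<open>u\<close> frees \<open>b\<close> for
      \<open>su\<close>.\<close>
    show False
    proof (cases "u \<in> kcomp ?e c b r")
      case True
      have sn: "s \<notin> kcomp ?e c b r"
        using three_ends[OF pe ne(5), of r r u s] True xu su rs rM mu ms by auto
      note out = comp_disj[OF pe comp_refl sn] comp_disj[OF pe True sn]
      show False
      proof (rule fin[OF pK spK])
        show "c \<in> M (K ?e c b s) r" using M_K_out[OF n(2,4) out(1)] rM by simp
        show "c \<in> M (K ?e c b s) s" by (rule M_K_in[OF n(2,4) comp_refl ms(3)])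
        show "c \<in> M (K ?e c b s) u" using M_K_out[OF n(2,4) out(2)] mu by simp
      qed (use oth ne in auto)
    next
      case ur2: False
      show False
      proof (cases "s \<in> kcomp ?e c b u")
        case True
        have rn: "r \<notin> kcomp ?e c b u" using ur2 comp_sym[OF pe] by blast
        note out = comp_disj[OF pe True rn]
        show False
        proof (rule fin[OF pK spK])
          show "b \<in> M (K ?e c b r) r" by (rule M_K_in'[OF n(2,4) comp_refl rM])
          show "b \<in> M (K ?e c b r) s" using M_K_out[OF n(2,4) out] ms by simp
          show "c \<in> M (K ?e c b r) u" using M_K_out[OF n(2,4) ur2] mu by simp
        qed (use oth ne m(3) in auto)
      next
        case sn: False
        have rn: "r \<notin> kcomp ?e c b u" using ur2 comp_sym[OF pe] by blast
        let ?f = "K ?e c b u" let ?g = "addE ?f s u b"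
        have f: "b \<in> M ?f u" "b \<in> M ?f s" "p \<in> M ?f s" "a \<in> M ?f s"
          using M_K_in'[OF n(2,4) comp_refl mu] M_K_out[OF n(2,4) sn] ms by auto
        have nsu: "\<not> ?f s u k" for k using spK[of u s u] by blast
        have pg: "pcol ?g" by (rule addE_pcol[OF pK f(2,1) su(1)]) (use VV nsu in auto)
        have "(\<exists>k. ?g y z k) \<longleftrightarrow> G y z" for y z
          unfolding addE_supp[of ?f] spK using Guv xu(4) by (auto simp: doubleton_eq_iff)
        then have vg: "valid ?g" using pg by (simp add: valid_def)
        have Mg: "M ?g y = (if y = s \<or> y = u then M ?f y - {b} else M ?f y)" for y
          by (rule M_addE[OF n(4) su(1)])
        let ?h = "\<lambda>k. if k = c then p else k"
        let ?L = "map (map_prod id ?h) L"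
        have bc: "snd y \<noteq> c" if "y \<in> set (butlast L)" for y using chn_butlast_src[OF pc ch that] L(2) by simp
        have keep: "k \<in> M ?g y" if "k \<in> M ed y" "k \<noteq> p" "k \<noteq> c" "k \<noteq> b" for k y
        proof -
          have "k \<in> M ?d y" using that(1) Md by simp
          then have "k \<in> M ?f y" using that by (simp add: M_K_other[OF n(2,4)] M_K_other[OF n(1,2)])
          then show ?thesis using Mg that(4) by simp
        qed
        have "chn ?g ?L"
        proof (rule chn_recolour[OF ch])
          fix y assume y: "y \<in> set L"
          have "?d r (fst y) (snd y)" using chn_edge[OF ch y] rs xu by (simp add: delE_def doubleton_eq_iff)
          then have "?e r (fst y) (?h (snd y))" using col[OF y] by (cases "snd y = c") (simp_all add: K_ed)
          then show "?g r (fst y) (?h (snd y))" using rn by (simp add: K_ed_out addE_def)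
        next
          fix y w assume y: "y \<in> set (butlast L)" "snd y \<in> M ed w"
          have "snd y \<noteq> p" "snd y \<noteq> b" using col[OF in_set_butlastD[OF y(1)]] by auto
          then show "?h (snd y) \<in> M ?g w" using keep[OF y(2)] bc[OF y(1)] by simp
        qed
        moreover have "src ?L \<in> M ?g s" using L(2) chn_Nil[OF ch] f(3) Mg ne by (simp add: last_map)
        moreover have "a \<in> M ?g (fst (hd ?L))" using keep[OF L(3)] ne m(3) chn_Nil[OF ch] by (simp add: hd_map)
        moreover have "a \<in> M ?g s" using f(4) Mg m(3) by simp
        ultimately show False by (rule chain_elem[OF vg])
      qed
    qed
  qed
qed

text \<open>The half of \<open>b\<close> is excluded by \<open>su_other_root\<close>. If
  \<open>c\<close> is unreachable, a free chain with source \<open>c\<close> can in general be given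
  a head missing \<open>p\<close>, and the shift makes \<open>c\<close> the colour missing at
  \<open>r\<close>. The exceptions are a head missing \<open>a\<close>, since exchanging
  \<open>p\<close> and \<open>a\<close> might recolour \<open>ux\<close>, and a head linked to
  \<open>r\<close> by \<open>p\<close> and \<open>c\<close>.\<close>

lemma su_in_D:
  assumes v: "valid ed" and m: "M ed r = {p}" "M ed s = {a, b}" "a \<noteq> b" and e: "ed u x a" "ed s u c"
    and p: "p \<in> M ed x"
  shows "c \<in> D ed a"
proof (rule ccontr)
  assume nc: "c \<notin> D ed a"
  note pc = valid_pcol[OF v]
  have pr: "p \<in> M ed r" using m by simp
  have cp: "c \<noteq> p" and s: "s \<in> kcomp ed p c r" using su_linked_r[OF v m e] by blast+
  have n: "c < n" "p < n" using pcolD(2)[OF pc e(2)] m M_less by blast+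
  have cab: "c \<noteq> a" "c \<noteq> b" using M_not[of _ ed s u] m(2) e(2) by auto
  have pab: "p \<noteq> a" "p \<noteq> b" using nocol[OF v, of p] m by auto
  have "c \<notin> D ed b" using su_other_root[OF v m e _ cab(2) p s] by blast
  then have cC: "c \<notin> C ed" using nc C_D[OF m(2)] by blast
  have sw: False if t: "t \<noteq> c" "t \<noteq> a" "t \<noteq> p" and z: "stable ed (K ed p t z)" "valid (K ed p t z)"
    and L: "free_chn (K ed p t z) L" "src L = c" "p \<in> M (K ed p t z) (fst (hd L))" for t z L
  proof -
    have "K ed p t z u x a" "K ed p t z s u c" using e t cp pab by (simp_all add: K_ed_other)
    then show False using shift_Kst[OF z(2) _ _ m(3) _ _ L] stableD[OF z(1)] m by simp
  qed
  show False
  proof (rule greedy[OF v n(1) cC])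
    show "c \<notin> M ed r" using m cp by simp
  next
    fix L t assume L: "free_chn ed L" "src L = c" and t: "t \<in> M ed (fst (hd L))" "t \<in> C ed \<or> t \<in> M ed r"
    show False
    proof (cases "t = p")
      case True
      then show False using shift_Kst[OF v m e L] t by blast
    next
      case False
      then have tC: "t \<in> C ed" using t m by simp
      show False
      proof (cases "t = a")
        case True
        then show False using su_hits_root[OF v m e p s L] t by blast
      next
        case ta: False
        have tn: "t < n" and tc: "t \<noteq> c" using t M_less tC cC by blast+
        have "\<forall>y\<in>set (butlast L). snd y \<noteq> t" using free_chnD(2)[OF L(1)] tC in_set_butlastD by fast
        note ps = free_swap[OF v pr L(1) tn hit_out[OF v pr L(1) t(1) tC] this]
        show False by (rule sw[OF tc ta False ps(2,1,3) L(2) M_K_in[OF n(2) tn comp_refl t(1)]])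
      qed
    qed
  next
    fix L assume L: "free_chn ed L" "src L = c" "c \<in> M ed (fst (hd L))"
    let ?w = "fst (hd L)"
    show False
    proof (cases "?w \<in> kcomp ed p c r")
      case True
      show False by (rule su_cycle[OF v m e p s L True])
    next
      case False
      have "\<forall>y\<in>set (butlast L). snd y \<noteq> c" using chn_butlast_src[OF pc free_chnD(1)[OF L(1)]] L(2) by simp
      note ps = free_swap[OF v pr L(1) n(1) False this]
      let ?e = "K ed p c ?w"
      have "?e u x a" "?e s u c" using e cab pab K_ed_out[OF comp_disj[OF pc s False]] by (simp_all add: K_ed_other)
      then show False
        using shift_Kst[OF ps(1) _ _ m(3) _ _ ps(3) L(2) M_K_in[OF n(2,1) comp_refl L(3)]] stableD[OF ps(2)] m by simp
    qed
  next
    fix A B t assume L: "free_chn ed (A @ B)" "src (A @ B) = c" "A \<noteq> []" "B \<noteq> []" "src A = t"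
      "t \<in> M ed (fst (hd B))" "t \<in> M ed (fst (hd A))" "t \<notin> C ed" "t \<notin> M ed r"
    have ta: "t \<noteq> a" using L(8) M_s_C m(2) by blast
    show False
    proof (rule rho_free[OF v pr L(1,3-7)])
      fix z L' assume h: "z \<notin> kcomp ed p t r" "free_chn (K ed p t z) L'" "src L' = src (A @ B)"
        "p \<in> M (K ed p t z) (fst (hd L'))" "valid (K ed p t z)" "stable ed (K ed p t z)" "t \<noteq> src (A @ B)" "p \<noteq> t" "t < n"
      show False
        by (rule sw[OF _ ta _ h(6,5,2) _ h(4)]) (use h L(2) in auto)
    qed
  qed
qed

section \<open>Two controllable colours missing at \<open>x\<close>\<close>

text \<open>The colour missing at \<open>r\<close> counts as well, since an exchange at
  \<open>x\<close> can trade it for any reachable colour.\<close>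

definition two_tokens :: "'a col \<Rightarrow> bool" where
  "two_tokens ed \<longleftrightarrow> valid ed \<and> (\<exists>c d. c \<noteq> d \<and> {c, d} \<subseteq> M ed x \<and> {c, d} \<subseteq> C ed \<union> M ed r)"

lemma two_tokensI:
  assumes "valid ed" "c \<in> M ed x" "c \<in> C ed" "k \<in> M ed x" "k \<in> M ed r"
  shows "two_tokens ed"
proof -
  have "c \<noteq> k" using C_not_r[OF assms(1,3)] assms(5) by blast
  then show ?thesis using assms unfolding two_tokens_def by blast
qed

lemma shift_token:
  assumes v: "valid ed" and p: "p \<in> M ed r" and L: "free_chn ed L" "p \<in> M ed (fst (hd L))" "src L \<in> M ed x"
  obtains ed' where "valid ed'" "src L \<in> M ed' r" "src L \<in> M ed' x" "C ed' = C ed" "M ed' x = M ed x"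
proof -
  from shift_target[OF v p L(1,2)] obtain ed' where "valid ed'" "M ed' r = {src L}" "C ed' = C ed" "M ed' x = M ed x" by metis
  then show thesis using that[of ed'] L(3) by simp
qed

text \<open>A shift along a free chain with source \<open>f\<close> makes \<open>f\<close> the
  colour missing at \<open>r\<close>; in one case an exchange at \<open>x\<close> gives it
  \<open>p\<close> instead. The colour \<open>c\<close> is to be spared, so a head at which only an
  exchange of \<open>p\<close> with \<open>c\<close> would help is left as the second
  outcome.\<close>

lemma token_step:
  assumes v: "valid ed" and m: "M ed r = {p}" and f: "f \<in> M ed x" "f \<notin> C ed" "f \<noteq> p"
  obtains (new) ed' k where "valid ed'" "k \<in> M ed' r" "k \<in> M ed' x" "C ed' = C ed"
      "c \<in> C ed \<Longrightarrow> c \<in> M ed x \<Longrightarrow> c \<in> M ed' x"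
  | (chain) L where "free_chn ed L" "src L = f" "c \<in> M ed (fst (hd L))" "c \<in> C ed"
proof -
  note pc = valid_pcol[OF v]
  have p: "p \<in> M ed r" "p < n" and fn: "f < n" using m f M_less by auto
  have sw: thesis if "stable ed e" "valid e" "free_chn e L" "src L = f" "p \<in> M e (fst (hd L))" "f \<in> M e x"
      "c \<in> C ed \<Longrightarrow> c \<in> M ed x \<Longrightarrow> c \<in> M e x" for e L
  proof -
    note h = that
    have "p \<in> M e r" using stableD(1)[OF that(1)] p by simp
    from shift_token[OF that(2) this that(3,5)] obtain ed' where
      "valid ed'" "f \<in> M ed' r" "f \<in> M ed' x" "C ed' = C e" "M ed' x = M e x" using h(4,6) by metis
    then show thesis using new[of ed' f] h(7) stable_C[OF h(1)] by simp
  qed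
  show thesis
  proof (rule greedy[OF v fn f(2)])
    show "f \<notin> M ed r" using m f by simp
  next
    fix L t assume L: "free_chn ed L" "src L = f" and t: "t \<in> M ed (fst (hd L))" "t \<in> C ed \<or> t \<in> M ed r"
    show thesis
    proof (cases "t = p")
      case True
      have "stable ed ed" by (simp add: stable_def)
      then show thesis using sw[OF _ v L _ f(1)] t True by blast
    next
      case False
      then have tC: "t \<in> C ed" using t m by simp
      have tn: "t < n" using t M_less by blast
      show thesis
      proof (cases "t = c")
        case True
        then show thesis using chain[OF L] t tC by blast
      next
        case tc: False
        have "\<forall>y\<in>set (butlast L). snd y \<noteq> t" using free_chnD(2)[OF L(1)] tC in_set_butlastD by fast
        note ps = free_swap[OF v p(1) L(1) tn hit_out[OF v p(1) L(1) t(1) tC] this]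
        have tf: "f \<noteq> t" using tC f(2) by blast
        show thesis
        proof (rule sw[OF ps(2,1,3) L(2)])
          show "p \<in> M (K ed p t (fst (hd L))) (fst (hd L))" by (rule M_K_in[OF p(2) tn comp_refl t(1)])
          show "f \<in> M (K ed p t (fst (hd L))) x" using f tf by (simp add: M_K_other[OF p(2) tn])
          assume c: "c \<in> C ed" "c \<in> M ed x"
          have "c \<noteq> p" using C_not_r[OF v c(1)] p(1) by blast
          then show "c \<in> M (K ed p t (fst (hd L))) x" using c tc by (simp add: M_K_other[OF p(2) tn])
        qed
      qed
    qed
  next
    fix L assume L: "free_chn ed L" "src L = f" "f \<in> M ed (fst (hd L))"
    let ?w = "fst (hd L)"
    note ch = free_chnD(1)[OF L(1)]
    have h: "hd L \<in> set L" using chn_Nil[OF ch] by simp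
    have b: "\<forall>y\<in>set (butlast L). snd y \<noteq> f" using chn_butlast_src[OF pc ch] L(2) by simp
    show thesis
    proof (cases "x \<in> kcomp ed p f r")
      case False
      note ps = free_swap[OF v p(1) L(1) fn False b]
      show thesis
      proof (rule new[OF ps(1) _ _ stable_C[OF ps(2)]])
        show "p \<in> M (K ed p f x) r" using stableD(1)[OF ps(2)] p by simp
        show "p \<in> M (K ed p f x) x" by (rule M_K_in[OF p(2) fn comp_refl f(1)])
        assume c: "c \<in> C ed" "c \<in> M ed x"
        have "c \<noteq> p" "c \<noteq> f" using C_not_r[OF v c(1)] p(1) c f by auto
        then show "c \<in> M (K ed p f x) x" using c by (simp add: M_K_other[OF p(2) fn])
      qed
    next
      case True
      have w: "?w \<notin> kcomp ed p f r"
        using three_ends[OF pc f(3)[symmetric], of r r x ?w] True chn_r[OF pc ch h] chn_x[OF v ch h] xu p f(1) L(3) by auto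
      note ps = free_swap[OF v p(1) L(1) fn w b]
      have "M (K ed p f ?w) x = M ed x" by (rule M_K_out[OF p(2) fn comp_disj[OF pc True w]])
      then show thesis using sw[OF ps(2,1,3) L(2) M_K_in[OF p(2) fn comp_refl L(3)]] f(1) by simp
    qed
  next
    fix A B t assume L: "free_chn ed (A @ B)" "src (A @ B) = f" "A \<noteq> []" "B \<noteq> []" "src A = t"
      "t \<in> M ed (fst (hd B))" "t \<in> M ed (fst (hd A))" "t \<notin> C ed" "t \<notin> M ed r"
    show thesis
    proof (rule rho_free[OF v p(1) L(1,3-7)])
      fix z L' assume h: "z \<notin> kcomp ed p t r" "free_chn (K ed p t z) L'" "src L' = src (A @ B)"
        "p \<in> M (K ed p t z) (fst (hd L'))" "valid (K ed p t z)" "stable ed (K ed p t z)" "t \<noteq> src (A @ B)" "p \<noteq> t" "t < n"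
      have ft: "f \<noteq> t" using h(7) L(2) by simp
      show thesis
      proof (rule sw[OF h(6,5,2) _ h(4)])
        show "src L' = f" using h L(2) by simp
        show "f \<in> M (K ed p t z) x" using f ft by (simp add: M_K_other[OF p(2) h(9)])
        assume c: "c \<in> C ed" "c \<in> M ed x"
        have "c \<noteq> p" "c \<noteq> t" using C_not_r[OF v c(1)] p(1) c L(8) by auto
        then show "c \<in> M (K ed p t z) x" using c by (simp add: M_K_other[OF p(2) h(9)])
      qed
    qed
  qed
qed

text \<open>The comparison of two chains from \<open>Kst_False\<close>, with exchanges of
  \<open>p\<close> against components of \<open>r\<close> instead of exchanges of \<open>b\<close>
  against components of \<open>s\<close>. A head that can be made to miss \<open>p\<close> without
  disturbing \<open>x\<close> yields a shift after which the source is the second colour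
  wanted.\<close>

lemma two_tokens_fan:
  assumes v: "valid ed" and m: "M ed r = {p}" and c: "c \<in> M ed x" "c \<in> C ed"
  shows "\<exists>ed'. two_tokens ed'"
proof -
  note pc = valid_pcol[OF v]
  have p: "p \<in> M ed r" "p < n" and cn: "c < n" using m c M_less by auto
  have cp: "c \<noteq> p" using C_not_r[OF v c(2)] p(1) by blast
  have "card (M ed x - {c}) \<ge> 2" using valid_x[OF v] c(1) by (simp add: card_Diff_singleton)
  then obtain f g where fg: "f \<in> M ed x - {c}" "g \<in> M ed x - {c}" "f \<noteq> g"
    by (metis card_le_Suc0_iff_eq finM finite_Diff not_less_eq_eq numeral_2_eq_2)
  have sh: "\<exists>ed'. two_tokens ed'" if "stable ed e" "valid e" "free_chn e L" "p \<in> M e (fst (hd L))" "src L \<in> M e x" "c \<in> M e x" for e L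
  proof -
    note h = that
    have "p \<in> M e r" using stableD(1)[OF that(1)] p by simp
    from shift_token[OF that(2) this that(3,4,5)] obtain ed' where
      "valid ed'" "src L \<in> M ed' r" "src L \<in> M ed' x" "C ed' = C e" "M ed' x = M e x" by metis
    then have "two_tokens ed'" using two_tokensI[of ed' c "src L"] h c stable_C[OF h(1)] by simp
    then show ?thesis by blast
  qed
  show ?thesis
  proof (cases "f \<in> C ed \<or> f = p \<or> g \<in> C ed \<or> g = p")
    case True
    then have "two_tokens ed" unfolding two_tokens_def using v c fg m by blast
    then show ?thesis by blast
  next
    case no: False
    show ?thesis
    proof (rule ccontr)
      assume n2: "\<not> ?thesis"
      have ld: "\<exists>L. free_chn ed L \<and> src L = h \<and> c \<in> M ed (fst (hd L))" if "h \<in> M ed x" "h \<notin> C ed" "h \<noteq> p" for h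
      proof (rule token_step[OF v m that, of c])
        fix ed' k assume h: "valid ed'" "k \<in> M ed' r" "k \<in> M ed' x" "C ed' = C ed"
          "c \<in> C ed \<Longrightarrow> c \<in> M ed x \<Longrightarrow> c \<in> M ed' x"
        have "two_tokens ed'" by (rule two_tokensI[OF h(1) h(5)[OF c(2,1)] _ h(3,2)]) (use h(4) c in simp)
        then show ?thesis using n2 by blast
      qed blast
      obtain L where L: "free_chn ed L" "src L = f" "c \<in> M ed (fst (hd L))" using ld fg no by blast
      obtain L' where L': "free_chn ed L'" "src L' = g" "c \<in> M ed (fst (hd L'))" using ld fg no by blast
      note ch = free_chnD(1)[OF L(1)] free_chnD(1)[OF L'(1)]
      have h: "hd L \<in> set L" "hd L' \<in> set L'" using chn_Nil ch by auto
      have one: "fst (hd X) \<in> kcomp ed p c x" if X: "free_chn ed X" "src X \<in> M ed x" "c \<in> M ed (fst (hd X))" for X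
      proof (rule ccontr)
        assume "fst (hd X) \<notin> kcomp ed p c x"
        then have out: "x \<notin> kcomp ed p c (fst (hd X))" by (rule comp_disj[OF pc comp_refl])
        have "\<forall>y\<in>set (butlast X). snd y \<noteq> c" using free_chnD(2)[OF X(1)] c(2) in_set_butlastD by fast
        note ps = free_swap[OF v p(1) X(1) cn hit_out[OF v p(1) X(1,3) c(2)] this]
        have "M (K ed p c (fst (hd X))) x = M ed x" by (rule M_K_out[OF p(2) cn out])
        then have "\<exists>ed'. two_tokens ed'" using sh[OF ps(2,1,3) M_K_in[OF p(2) cn comp_refl X(3)]] X(2) c by simp
        then show False using n2 by blast
      qed
      have "fst (hd L) \<in> kcomp ed p c x" "fst (hd L') \<in> kcomp ed p c x"
        using one L L' fg by auto
      then have "fst (hd L) = fst (hd L')"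
        using three_ends[OF pc cp[symmetric], of x x "fst (hd L)" "fst (hd L')"] chn_x[OF v ch(1) h(1)] chn_x[OF v ch(2) h(2)]
          c L(3) L'(3) by auto
      then have heq: "hd L = hd L'"
        using chn_edge[OF ch(1) h(1)] chn_edge[OF ch(2) h(2)] pcol_col[OF pc] by (simp add: prod_eq_iff)
      obtain A B B' where AB: "L = A @ B" "L' = A @ B'" "B = [] \<or> B' = [] \<or> hd B \<noteq> hd B'"
        using common_prefix[of L L'] by blast
      have A: "A \<noteq> []" using AB heq h by (cases "B = [] \<or> B' = []") auto
      have part: "free_chn ed X \<and> src A \<in> M ed (fst (hd X)) \<and> (\<forall>y\<in>set X. snd y \<noteq> src A)"
        if X: "free_chn ed (A @ X)" "X \<noteq> []" for X
        using free_chn_append[OF pc X(1) A X(2)] by blast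
      have cA: "src A \<noteq> c" "src A \<noteq> p"
        using free_chnD(2)[OF L(1), of "last A"] chn_not_r[OF ch(1), of "last A"] AB(1) A c p by auto
      \<comment> \<open>One chain stops where the other continues, so \<open>x\<close> misses
        \<open>src A\<close>. At most one of \<open>x\<close> and the next head is linked to
        \<open>r\<close>; the other one can be made to miss \<open>p\<close>.\<close>
      have m5: False if X: "free_chn ed (A @ X)" "X \<noteq> []" "src X \<in> M ed x" "src A \<in> M ed x" for X
      proof -
        note pX = part[OF X(1,2)]
        let ?g = "src A" let ?z = "fst (hd X)"
        have fX: "free_chn ed X" and gz: "?g \<in> M ed ?z" using pX by auto
        have gn: "?g < n" using X(4) M_less by blast
        have b: "\<forall>y\<in>set (butlast X). snd y \<noteq> ?g" using pX in_set_butlastD by fast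
        have hX: "hd X \<in> set X" using X(2) by simp
        note chX = free_chnD(1)[OF fX]
        show False
        proof (cases "x \<in> kcomp ed p ?g r")
          case False
          note ps = free_swap[OF v p(1) fX gn False b]
          have "two_tokens (K ed p ?g x)"
          proof (rule two_tokensI[OF ps(1)])
            show "c \<in> M (K ed p ?g x) x" using c cA cp by (simp add: M_K_other[OF p(2) gn])
            show "c \<in> C (K ed p ?g x)" using stable_C[OF ps(2)] c by simp
            show "p \<in> M (K ed p ?g x) x" by (rule M_K_in[OF p(2) gn comp_refl X(4)])
            show "p \<in> M (K ed p ?g x) r" using stableD(1)[OF ps(2)] p by simp
          qed
          then show False using n2 by blast
        next
          case True
          have z: "?z \<notin> kcomp ed p ?g r"
            using three_ends[OF pc cA(2)[symmetric], of r r x ?z] True chn_r[OF pc chX hX] chn_x[OF v chX hX] xu p X(4) gz by auto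
          note ps = free_swap[OF v p(1) fX gn z b]
          have "M (K ed p ?g ?z) x = M ed x" by (rule M_K_out[OF p(2) gn comp_disj[OF pc True z]])
          then show False using sh[OF ps(2,1,3) M_K_in[OF p(2) gn comp_refl gz]] X(3) c n2 by simp
        qed
      qed
      have m6: "fst (hd X) \<in> kcomp ed p (src A) r" if X: "free_chn ed (A @ X)" "X \<noteq> []" "src X \<in> M ed x" "src X \<noteq> p" for X
      proof (rule ccontr)
        note pX = part[OF X(1,2)]
        let ?g = "src A" let ?z = "fst (hd X)"
        have fX: "free_chn ed X" and gz: "?g \<in> M ed ?z" using pX by auto
        have gn: "?g < n" using gz M_less by blast
        have b: "\<forall>y\<in>set (butlast X). snd y \<noteq> ?g" using pX in_set_butlastD by fast
        assume z: "?z \<notin> kcomp ed p ?g r"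
        note ps = free_swap[OF v p(1) fX gn z b]
        have "src X \<noteq> ?g" using pX last_in_set[OF X(2)] by blast
        then have "src X \<in> M (K ed p ?g ?z) x" "c \<in> M (K ed p ?g ?z) x" using X c cA cp
          by (simp_all add: M_K_other[OF p(2) gn])
        then show False using sh[OF ps(2,1,3) M_K_in[OF p(2) gn comp_refl gz]] n2 by simp
      qed
      have fr: "free_chn ed (A @ B)" "free_chn ed (A @ B')" using L(1) L'(1) AB by simp_all
      consider "B = []" "B' = []" | "B = []" "B' \<noteq> []" | "B \<noteq> []" "B' = []" | "B \<noteq> []" "B' \<noteq> []" "hd B \<noteq> hd B'"
        using AB(3) by blast
      then show False
      proof cases
        case 1
        then show False using AB L(2) L'(2) fg(3) by simp
      next
        case 2
        then show False using m5[OF fr(2)] AB L L' fg by simp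
      next
        case 3
        then show False using m5[OF fr(1)] AB L L' fg by simp
      next
        case 4
        have sX: "src B = f" "src B' = g" using AB L(2) L'(2) 4 by simp_all
        have hB: "hd B \<in> set L" "hd B' \<in> set L'" using AB 4 by simp_all
        have "fst (hd B) \<noteq> fst (hd B')"
        proof
          assume eq: "fst (hd B) = fst (hd B')"
          have "snd (hd B) = snd (hd B')"
            using chn_edge[OF ch(1) hB(1)] chn_edge[OF ch(2) hB(2)] eq pcol_col[OF pc] by metis
          then show False using eq 4(3) by (simp add: prod_eq_iff)
        qed
        moreover have "fst (hd B) \<in> kcomp ed p (src A) r" "fst (hd B') \<in> kcomp ed p (src A) r"
          using m6[OF fr(1)] m6[OF fr(2)] 4 sX fg no by auto
        moreover have "src A \<in> M ed (fst (hd B))" "src A \<in> M ed (fst (hd B'))"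
          using part[OF fr(1)] part[OF fr(2)] 4 by auto
        ultimately show False
          using three_ends[OF pc cA(2)[symmetric], of r r "fst (hd B)" "fst (hd B')"] p
            chn_r[OF pc ch(1) hB(1)] chn_r[OF pc ch(2) hB(2)] by auto
      qed
    qed
  qed
qed

lemma two_tokens_r:
  assumes v: "valid ed" and k: "k \<in> M ed x" "k \<in> M ed r"
  shows "\<exists>ed'. two_tokens ed'"
proof -
  obtain a b where ab: "M ed s = {a, b}" using valid_s[OF v] by blast
  have aC: "a \<in> C ed" using M_s_C ab by blast
  note X = x_swap[OF v k(2) aC disjI1[OF k(1)]]
  have "M ed r = {k}" by (rule valid_r_eq[OF v k(2)])
  then have "M (K ed k a x) r = {k}" using stableD(1)[OF X(2)] by simp
  moreover have "a \<in> M (K ed k a x) x" by (rule M_K_in'[OF X(5,6) comp_refl k(1)])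
  ultimately show ?thesis using two_tokens_fan[OF X(3)] stable_C[OF X(2)] aC by simp
qed

lemma two_tokens_ex:
  assumes v: "valid ed" shows "\<exists>ed'. two_tokens ed'"
proof -
  obtain p where p: "M ed r = {p}" using valid_r[OF v] by blast
  obtain f where f: "f \<in> M ed x" using valid_x[OF v] by fastforce
  show ?thesis
  proof (cases "f \<in> C ed \<or> f = p")
    case True
    then show ?thesis using two_tokens_fan[OF v p f] two_tokens_r[OF v f] p by blast
  next
    case False
    have pC: "p \<notin> C ed" using C_not_r[OF v] p by blast
    \<comment> \<open>With the unreachable \<open>p\<close> as the colour to be spared, the chain
      outcome of \<open>token_step\<close> is impossible.\<close>
    show ?thesis
      by (rule token_step[OF v p f, of p]) (use False pC two_tokens_r in blast)+
  qed
qed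

section \<open>Permuting the colours at \<open>x\<close>\<close>

text \<open>Around \<open>x\<close> the exchange acts as a transposition, also on the colour of
  \<open>ux\<close>: if that colour is \<open>p\<close> or \<open>t\<close>, then \<open>u\<close>
  belongs to the component of \<open>x\<close>.\<close>

lemma token_swap:
  assumes v: "valid ed" and p: "M ed r = {p}" and t: "t \<in> C ed" "p \<in> M ed x \<or> t \<in> M ed x"
  shows "valid (K ed p t x)" "stable ed (K ed p t x)" "M (K ed p t x) r = {p}" "M (K ed p t x) s = M ed s"
    "C (K ed p t x) = C ed" "k \<in> M ed x \<Longrightarrow> sw p t k \<in> M (K ed p t x) x"
    "ed u x k \<Longrightarrow> K ed p t x u x (sw p t k)"
proof -
  have pr: "p \<in> M ed r" using p by simp
  note X = x_swap[OF v pr t(1,2)]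
  note pc = valid_pcol[OF v]
  show "valid (K ed p t x)" "stable ed (K ed p t x)" by (rule X)+
  show "M (K ed p t x) r = {p}" "M (K ed p t x) s = M ed s" "C (K ed p t x) = C ed"
    using stableD[OF X(2)] stable_C[OF X(2)] p by simp_all
  show "sw p t k \<in> M (K ed p t x) x" if "k \<in> M ed x" using that by (simp add: M_K[OF X(5,6)])
  assume k: "ed u x k"
  show "K ed p t x u x (sw p t k)"
  proof (cases "u \<in> kcomp ed p t x")
    case True
    then show ?thesis using k by (simp add: K_ed)
  next
    case False
    have "k \<noteq> p \<and> k \<noteq> t" using comp_edge[OF pc, of x u p t x] pcolD(1)[OF pc k] False by auto
    then show ?thesis using k False by (simp add: K_ed)
  qed
qed

lemma token_move:
  assumes v: "valid ed" and p: "M ed r = {p}" and c: "c \<in> M ed x" "c \<in> C ed \<union> {p}" and g: "g \<in> C ed"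
  shows "\<exists>ed'. valid ed' \<and> stable ed ed' \<and> g \<in> M ed' x \<and> (\<forall>k\<in>M ed x. k \<noteq> c \<longrightarrow> k \<noteq> g \<longrightarrow> k \<noteq> p \<longrightarrow> k \<in> M ed' x)"
proof (cases "c = p")
  case True
  note o = token_swap[OF v p g]
  have "sw p g p \<in> M (K ed p g x) x" using o(6) c True by blast
  moreover have "k \<in> M (K ed p g x) x" if "k \<in> M ed x" "k \<noteq> g" "k \<noteq> p" for k using o(6)[of k] c True that by simp
  ultimately show ?thesis using o(1,2) c True by (intro exI[of _ "K ed p g x"]) simp
next
  case False
  then have cC: "c \<in> C ed" using c by blast
  note o = token_swap[OF v p cC disjI2[OF c(1)]]
  let ?e = "K ed p c x"
  have px: "p \<in> M ?e x" using o(6)[OF c(1)] by simp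
  have gC: "g \<in> C ?e" using o(5) g by simp
  note o' = token_swap[OF o(1,3) gC disjI1[OF px]]
  let ?f = "K ?e p g x"
  have "stable ed ?f" using o(2) o'(2) stable_Fv[OF o(2)] unfolding stable_def by simp
  moreover have "g \<in> M ?f x" using o'(6)[OF px] by simp
  moreover have "k \<in> M ?f x" if "k \<in> M ed x" "k \<noteq> c" "k \<noteq> g" "k \<noteq> p" for k
    using o'(6)[of k] o(6)[OF that(1)] that by simp
  ultimately show ?thesis using o'(1) by blast
qed

lemma tokens_to_roots: assumes "valid ed0" shows "\<exists>ed. valid ed \<and> M ed s \<subseteq> M ed x"
proof -
  obtain ed where "two_tokens ed" using two_tokens_ex[OF assms] by blast
  then obtain c d where v: "valid ed" and cd: "c \<noteq> d" "c \<in> M ed x" "d \<in> M ed x" "c \<in> C ed \<union> M ed r" "d \<in> C ed \<union> M ed r"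
    unfolding two_tokens_def by blast
  obtain p where p: "M ed r = {p}" using valid_r[OF v] by blast
  obtain a b where ab: "a \<noteq> b" "M ed s = {a, b}" using valid_s[OF v] by blast
  have C: "a \<in> C ed" "b \<in> C ed" using M_s_C ab by blast+
  have pC: "p \<notin> C ed" using C_not_r[OF v] p by blast
  obtain e d' where e: "valid e" "stable ed e" "a \<in> M e x" "d' \<in> M e x" "d' \<in> C ed \<union> {p}" "d' \<noteq> a"
  proof (cases "a \<in> M ed x")
    case True
    have st: "stable ed ed" by (simp add: stable_def)
    obtain d' where d': "d' \<in> M ed x" "d' \<in> C ed \<union> {p}" "d' \<noteq> a"
    proof (cases "c = a")
      case True
      then show thesis using that[of d] cd p by blast
    next
      case False
      then show thesis using that[of c] cd p by blast
    qed
    show thesis by (rule that[OF v st True d'])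
  next
    case False
    \<comment> \<open>The names are chosen so that the colour to be kept is reachable;
      \<open>p\<close> could be used up by the move.\<close>
    obtain c d where c: "c \<in> M ed x" "d \<in> M ed x" "c \<in> C ed \<union> {p}" "d \<in> C ed" "c \<noteq> d"
    proof (cases "d = p")
      case True
      show thesis by (rule that[of d c]) (use True cd p in auto)
    next
      case False
      show thesis by (rule that[of c d]) (use False cd p in auto)
    qed
    have "d \<noteq> a" "d \<noteq> p" using c False pC by blast+
    obtain e where e: "valid e" "stable ed e" "a \<in> M e x"
      "\<forall>k\<in>M ed x. k \<noteq> c \<longrightarrow> k \<noteq> a \<longrightarrow> k \<noteq> p \<longrightarrow> k \<in> M e x"
      using token_move[OF v p c(1,3) C(1)] by blast
    have "d \<in> M e x" using e(4) c \<open>d \<noteq> a\<close> \<open>d \<noteq> p\<close> by metis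
    then show thesis using that[of e d] e c \<open>d \<noteq> a\<close> by simp
  qed
  note st = stableD(1,4)[OF e(2)] stable_C[OF e(2)]
  show ?thesis
  proof (cases "b \<in> M e x")
    case True
    then show ?thesis using e st ab by auto
  next
    case False
    have pr: "M e r = {p}" and C': "d' \<in> C e \<union> {p}" "b \<in> C e" using st p e(5) C by simp_all
    obtain f where f: "valid f" "stable e f" "b \<in> M f x" "\<forall>k\<in>M e x. k \<noteq> d' \<longrightarrow> k \<noteq> b \<longrightarrow> k \<noteq> p \<longrightarrow> k \<in> M f x"
      using token_move[OF e(1) pr e(4) C'] by blast
    have "a \<noteq> p" using C pC by blast
    then have "a \<in> M f x" using bspec[OF f(4) e(3)] e(6) ab(1) by simp
    moreover have "M f s = {a, b}" using stableD(4)[OF f(2)] st ab by simp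
    ultimately show ?thesis using f by auto
  qed
qed

text \<open>An exchange of \<open>p\<close> and \<open>g\<close> at \<open>x\<close> gives
  \<open>ux\<close> the colour \<open>g\<close> and makes \<open>x\<close> miss \<open>p\<close>. It
  does not reach \<open>s\<close>, whose component contains \<open>r\<close>, so
  \<open>su_in_D\<close> applies.\<close>

lemma hole_su_in_D:
  assumes v: "valid ed" and p: "M ed r = {p}" and g: "g \<in> M ed s" "g \<in> M ed x" and e: "ed u x p" "ed s u c"
  shows "c \<in> D ed g"
proof -
  obtain h where h: "M ed s = {g, h}" "g \<noteq> h"
  proof -
    obtain a b where ab: "a \<noteq> b" "M ed s = {a, b}" using valid_s[OF v] by blast
    then have "g = a \<or> g = b" using g(1) by simp
    then show thesis using that[of a] that[of b] ab by (metis insert_commute)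
  qed
  have pr: "p \<in> M ed r" using p by simp
  note o = token_swap[OF v p M_s_C[OF g(1)] disjI2[OF g(2)]]
  let ?e = "K ed p g x"
  have "?e u x g" using o(7)[OF e(1)] by simp
  moreover have "?e s u c" using e(2) K_ed_out[OF x_swap_s[OF v pr g(1) disjI2[OF g(2)]]] by simp
  moreover have "p \<in> M ?e x" using o(6)[OF g(2)] by simp
  ultimately have "c \<in> D ?e g" using su_in_D[OF o(1,3) _ h(2)] o(4) h(1) by simp
  then show ?thesis using stable_D[OF o(2) g(1)] by simp
qed

lemma su_ex: assumes "valid ed" obtains c where "ed s u c"
  using valid_ex[OF assms xu(4)] by blast

lemma no_common_D:
  assumes v: "valid ed" and "M ed s = {a, b}" "a \<noteq> b" "c \<in> D ed a" "c \<in> D ed b"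
  shows False
  using D_disjoint[OF v, of a b] assms by auto

lemma hole_tokens_False:
  assumes v: "valid ed" and p: "M ed r = {p}" and s: "M ed s = {a, b}" "a \<noteq> b" "M ed s \<subseteq> M ed x" and e: "ed u x p"
  shows False
proof (rule su_ex[OF v])
  fix c assume c: "ed s u c"
  show False by (rule no_common_D[OF v s(1,2)]; rule hole_su_in_D[OF v p _ _ e c]) (use s in auto)
qed

text \<open>A sliding puzzle: \<open>p\<close> may be exchanged with a reachable colour as long as
  \<open>x\<close> misses one of the two. The aim is to move \<open>p\<close> onto \<open>ux\<close>
  and to have \<open>a\<close> and \<open>b\<close> missing at \<open>x\<close> again.\<close>

lemma C_tokens_False:
  assumes v: "valid ed" and p: "M ed r = {p}" and s: "M ed s = {a, b}" "a \<noteq> b" "M ed s \<subseteq> M ed x"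
    and e: "ed u x t" "t \<in> C ed \<union> {p}"
  shows False
proof (cases "t = p")
  case True
  then show False using hole_tokens_False[OF v p s] e by blast
next
  case False
  then have tC: "t \<in> C ed" using e by blast
  have ab: "a \<in> C ed" "b \<in> C ed" using M_s_C s(1) by blast+
  have m: "a \<in> M ed x" "b \<in> M ed x" using s by auto
  have "t \<noteq> a" "t \<noteq> b" using m M_not pcolD(1)[OF valid_pcol[OF v] e(1)] by blast+
  moreover have "p \<noteq> a" "p \<noteq> b" using ab C_not_r[OF v] p by auto
  ultimately have ne: "t \<noteq> a" "t \<noteq> b" "t \<noteq> p" "p \<noteq> a" "p \<noteq> b" "a \<noteq> b" using False s(2) by auto
  note [simp] = ne ne[symmetric]
  \<comment> \<open>Written as missing colours at \<open>x\<close>, then colour of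
    \<open>ux\<close>, the states are \<open>a b, t\<close>; \<open>p b, t\<close>;
    \<open>t b, p\<close>; \<open>t p, b\<close>; \<open>t a, b\<close>; \<open>p a, b\<close>;
    \<open>b a, p\<close>.\<close>
  define e1 where "e1 = K ed p a x"
  note o1 = token_swap[OF v p ab(1) disjI2[OF m(1)], folded e1_def]
  have m1: "p \<in> M e1 x" "b \<in> M e1 x" "e1 u x t" using o1(6)[OF m(1)] o1(6)[OF m(2)] o1(7)[OF e(1)] by simp_all
  define e2 where "e2 = K e1 p t x"
  have "t \<in> C e1" using o1 tC by simp
  note o2 = token_swap[OF o1(1,3) this disjI1[OF m1(1)], folded e2_def]
  have m2: "t \<in> M e2 x" "b \<in> M e2 x" "e2 u x p" using o2(6)[OF m1(1)] o2(6)[OF m1(2)] o2(7)[OF m1(3)] by simp_all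
  define e3 where "e3 = K e2 p b x"
  have "b \<in> C e2" using o1 o2 ab by simp
  note o3 = token_swap[OF o2(1,3) this disjI2[OF m2(2)], folded e3_def]
  have m3: "t \<in> M e3 x" "p \<in> M e3 x" "e3 u x b" using o3(6)[OF m2(1)] o3(6)[OF m2(2)] o3(7)[OF m2(3)] by simp_all
  define e4 where "e4 = K e3 p a x"
  have "a \<in> C e3" using o1 o2 o3 ab by simp
  note o4 = token_swap[OF o3(1,3) this disjI1[OF m3(2)], folded e4_def]
  have m4: "t \<in> M e4 x" "a \<in> M e4 x" "e4 u x b" using o4(6)[OF m3(1)] o4(6)[OF m3(2)] o4(7)[OF m3(3)] by simp_all
  define e5 where "e5 = K e4 p t x"
  have "t \<in> C e4" using o1 o2 o3 o4 tC by simp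
  note o5 = token_swap[OF o4(1,3) this disjI2[OF m4(1)], folded e5_def]
  have m5: "p \<in> M e5 x" "a \<in> M e5 x" "e5 u x b" using o5(6)[OF m4(1)] o5(6)[OF m4(2)] o5(7)[OF m4(3)] by simp_all
  define e6 where "e6 = K e5 p b x"
  have "b \<in> C e5" using o1 o2 o3 o4 o5 ab by simp
  note o6 = token_swap[OF o5(1,3) this disjI1[OF m5(1)], folded e6_def]
  have m6: "b \<in> M e6 x" "a \<in> M e6 x" "e6 u x p" using o6(6)[OF m5(1)] o6(6)[OF m5(2)] o6(7)[OF m5(3)] by simp_all
  have "M e6 s = {a, b}" using o1 o2 o3 o4 o5 o6 s(1) by simp
  then show False using hole_tokens_False[OF o6(1,3) _ s(2) _ m6(3)] m6 by simp
qed

section \<open>An unreachable colour on \<open>ux\<close>\<close>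

text \<open>The shift makes the colour of \<open>ux\<close> the one missing at \<open>r\<close> and
  leaves the halves of the fan alone.\<close>

lemma shift_su_in_D:
  assumes v: "valid ed" and p: "M ed r = {p}" and g: "g \<in> M ed s" "g \<in> M ed x" and e: "ed u x t" "ed s u c"
    and L: "free_chn ed L" "src L = t" "p \<in> M ed (fst (hd L))"
  shows "c \<in> D ed g"
proof -
  have pr: "p \<in> M ed r" using p by simp
  from shift_target[OF v pr L(1,3)] obtain ed' where h: "valid ed'" "M ed' r = {src L}" "M ed' s = M ed s"
    "D ed' g = D ed g" "M ed' x = M ed x" "ed' s u c = ed s u c" "ed' u x t = ed u x t" using g(1) by metis
  have "c \<in> D ed' g" by (rule hole_su_in_D[OF h(1,2)]) (use h g e L in simp_all)
  then show ?thesis using h by simp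
qed

lemma shift_tokens_False:
  assumes v: "valid ed" and p: "M ed r = {p}" and s: "M ed s = {a, b}" "a \<noteq> b" "M ed s \<subseteq> M ed x" and e: "ed u x t"
    and L: "free_chn ed L" "src L = t" "p \<in> M ed (fst (hd L))"
  shows False
proof (rule su_ex[OF v])
  fix c assume c: "ed s u c"
  show False by (rule no_common_D[OF v s(1,2)]; rule shift_su_in_D[OF v p _ _ e c L]) (use s in auto)
qed

lemma sw_val: "sw p t c \<noteq> p \<Longrightarrow> sw p t c \<noteq> t \<Longrightarrow> sw p t c = c"
  by (auto simp: sw_def split: if_splits)

lemma K_ex: "ed s u c \<Longrightarrow> K ed p t z s u c \<or> K ed p t z s u (sw p t c)"
  by (simp add: K_ed)

text \<open>The other root \<open>h\<close> is spent to make \<open>x\<close> miss \<open>p\<close>.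
  Then \<open>x\<close> and the head of \<open>L\<close> cannot both be linked to \<open>r\<close>
  by \<open>p\<close> and \<open>t\<close>: an exchange at \<open>x\<close> gives \<open>ux\<close>
  the colour \<open>p\<close>, one at the head makes the head miss \<open>p\<close>.\<close>

lemma cycle_su_in_D:
  assumes v: "valid ed" and p: "M ed r = {p}" and s: "M ed s = {g, h}" "g \<noteq> h" "M ed s \<subseteq> M ed x"
    and e: "ed u x t" "ed s u c" and L: "free_chn ed L" "src L = t" "t \<in> M ed (fst (hd L))"
  shows "c \<in> D ed g"
proof -
  have pr: "p \<in> M ed r" using p by simp
  have hm: "h \<in> M ed s" "h \<in> M ed x" "g \<in> M ed x" "g \<in> M ed s" using s by auto
  note hC = M_s_C[OF hm(1)] and gC = M_s_C[OF hm(4)]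
  note o = token_swap[OF v p hC disjI2[OF hm(2)]]
  let ?e = "K ed p h x"
  have pe: "pcol ?e" by (rule valid_pcol[OF o(1)])
  note ch = free_chnD(1)[OF L(1)]
  have lL: "last L \<in> set L" and hL: "hd L \<in> set L" using chn_Nil[OF ch] by simp_all
  have tC: "t \<notin> C ed" and tp: "t \<noteq> p" using free_chnD(2)[OF L(1) lL] chn_not_r[OF ch lL] L(2) pr by auto
  have ne: "p \<noteq> g" "p \<noteq> h" "t \<noteq> g" "t \<noteq> h" using C_not_r[OF v] hC gC pr tC by auto
  have n: "p < n" "h < n" "t < n" using pr hm L(3) M_less by blast+
  have "\<forall>y\<in>set (butlast L). snd y \<noteq> h" using free_chnD(2)[OF L(1)] hC in_set_butlastD by fast
  note ps = free_swap[OF v pr L(1) n(2) x_swap(1)[OF v pr hC disjI2[OF hm(2)]] this]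
  note fe = ps(3)
  note che = free_chnD(1)[OF fe]
  have m: "p \<in> M ?e x" "g \<in> M ?e x" using o(6)[OF hm(2)] o(6)[OF hm(3)] ne s(2) by simp_all
  have tw: "t \<in> M ?e (fst (hd L))" using L(3) tp ne by (simp add: M_K_other[OF n(1,2)])
  have ux: "?e u x t" using o(7)[OF e(1)] tp ne by simp
  have su: "?e s u c" using e(2) K_ed_out[OF x_swap_s[OF v pr hm(1) disjI2[OF hm(2)]]] by simp
  have pr': "p \<in> M ?e r" using o(3) by simp
  have gs: "g \<in> M ?e s" using o(4) hm by simp
  have De: "D ?e g = D ed g" by (rule stable_D[OF o(2) hm(4)])
  \<comment> \<open>The exchange of \<open>p\<close> and \<open>t\<close> may act on
    \<open>su\<close>, but a colour found in the half is neither \<open>p\<close> nor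
    \<open>t\<close>, so it is the original one.\<close>
  have fin: ?thesis if "c' \<in> D ed g" "c' = c \<or> c' = sw p t c" for c'
  proof -
    have "c' \<in> C ed" using that(1) C_I hm(4) by blast
    then have "c' \<noteq> p" "c' \<noteq> t" using C_not_r[OF v] pr tC by auto
    then have "c' = c" using that(2) sw_val by blast
    then show ?thesis using that by simp
  qed
  show ?thesis
  proof (cases "x \<in> kcomp ?e p t r")
    case False
    let ?f = "K ?e p t x"
    have f: "valid ?f" "stable ?e ?f"
      using valid_K[OF o(1) n(1,3)] fan_stable[OF o(1) pr' n(3) False] by auto
    have "u \<in> kcomp ?e p t x" by (rule comp_step[of ?e x u]) (use pcolD(1)[OF pe ux] in simp_all)
    then have fux: "?f u x p" using ux by (simp add: K_ed)
    obtain c' where c': "?f s u c'" "c' = c \<or> c' = sw p t c" using K_ex[of ?e c p t x] su by blast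
    have "c' \<in> D ?f g"
    proof (rule hole_su_in_D[OF f(1) _ _ _ fux c'(1)])
      show "M ?f r = {p}" "g \<in> M ?f s" using stableD[OF f(2)] o(3) gs by simp_all
      show "g \<in> M ?f x" using m(2) ne by (simp add: M_K_other[OF n(1,3)])
    qed
    then show ?thesis using fin c'(2) stable_D[OF f(2) gs] De by simp
  next
    case True
    let ?w = "fst (hd L)"
    have w: "?w \<notin> kcomp ?e p t r"
      using three_ends[OF pe tp[symmetric], of r r x ?w] True chn_r[OF pe che hL] chn_x[OF o(1) che hL] xu pr' m(1) tw by auto
    have "\<forall>y\<in>set (butlast L). snd y \<noteq> t" using chn_butlast_src[OF pe che] L(2) by simp
    note f = free_swap[OF o(1) pr' fe n(3) w this]
    let ?f = "K ?e p t ?w"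
    have xw: "x \<notin> kcomp ?e p t ?w" by (rule comp_disj[OF pe True w])
    then have "u \<notin> kcomp ?e p t ?w" using comp_edge[OF pe, of x u p t ?w] pcolD(1)[OF pe ux] by blast
    then have fux: "?f u x t" using ux by (simp add: K_ed_out)
    obtain c' where c': "?f s u c'" "c' = c \<or> c' = sw p t c" using K_ex[of ?e c p t ?w] su by blast
    have "c' \<in> D ?f g"
    proof (rule shift_su_in_D[OF f(1) _ _ _ fux c'(1) f(3) L(2)])
      show "M ?f r = {p}" "g \<in> M ?f s" using stableD[OF f(2)] o(3) gs by simp_all
      show "g \<in> M ?f x" using m(2) M_K_out[OF n(1,3) xw] by simp
      show "p \<in> M ?f ?w" by (rule M_K_in[OF n(1,3) comp_refl tw])
    qed
    then show ?thesis using fin c'(2) stable_D[OF f(2) gs] De by simp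
  qed
qed

text \<open>If the head can be exchanged without \<open>x\<close>, the shift applies with both roots
  still missing at \<open>x\<close>. Otherwise one exchange of \<open>p\<close> and \<open>a\<close>
  at \<open>x\<close> makes the head miss \<open>p\<close> as well, which puts \<open>c\<close> in
  the half of \<open>b\<close>. Trading \<open>b\<close> for \<open>p\<close> at \<open>x\<close>
  beforehand separates the head from \<open>x\<close>, which puts \<open>c\<close> in the half of
  \<open>a\<close>.\<close>

lemma root_hit_False:
  assumes v: "valid ed" and p: "M ed r = {p}" and s: "M ed s = {a, b}" "a \<noteq> b" "M ed s \<subseteq> M ed x"
    and e: "ed u x t" and L: "free_chn ed L" "src L = t" "a \<in> M ed (fst (hd L))"
  shows False
proof (rule su_ex[OF v])
  fix c assume c: "ed s u c"
  let ?w = "fst (hd L)"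
  note pc = valid_pcol[OF v]
  have pr: "p \<in> M ed r" using p by simp
  have hm: "a \<in> M ed s" "b \<in> M ed s" "a \<in> M ed x" "b \<in> M ed x" using s by auto
  note aC = M_s_C[OF hm(1)] and bC = M_s_C[OF hm(2)]
  note ch = free_chnD(1)[OF L(1)]
  have lL: "last L \<in> set L" and hL: "hd L \<in> set L" using chn_Nil[OF ch] by simp_all
  have tC: "t \<notin> C ed" and tp: "t \<noteq> p" using free_chnD(2)[OF L(1) lL] chn_not_r[OF ch lL] L(2) pr by auto
  have ne: "p \<noteq> a" "p \<noteq> b" "t \<noteq> a" "t \<noteq> b" using C_not_r[OF v] aC bC pr tC by auto
  have n: "p < n" "a < n" "b < n" using pr hm M_less by blast+
  have ba: "\<forall>y\<in>set (butlast L). snd y \<noteq> a" and bb: "\<forall>y\<in>set (butlast L). snd y \<noteq> b"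
    using free_chnD(2)[OF L(1)] aC bC in_set_butlastD by fast+
  show False
  proof (cases "?w \<in> kcomp ed p a x")
    case False
    note f = free_swap[OF v pr L(1) n(2) hit_out[OF v pr L(1,3) aC] ba]
    have xw: "x \<notin> kcomp ed p a ?w" by (rule comp_disj[OF pc comp_refl False])
    show False
    proof (rule shift_tokens_False[OF f(1) _ _ s(2) _ _ f(3) L(2) M_K_in[OF n(1,2) comp_refl L(3)]])
      show "M (K ed p a ?w) r = {p}" "M (K ed p a ?w) s = {a, b}" using stableD[OF f(2)] p s by simp_all
      show "M (K ed p a ?w) s \<subseteq> M (K ed p a ?w) x" using stableD[OF f(2)] s M_K_out[OF n(1,2) xw] by simp
      show "K ed p a ?w u x t" using e tp ne by (simp add: K_ed_other)
    qed
  next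
    case True
    have xr: "x \<notin> kcomp ed p a r" by (rule x_swap(1)[OF v pr aC disjI2[OF hm(3)]])
    note f = free_swap[OF v pr L(1) n(2) xr ba]
    note o = token_swap[OF v p aC disjI2[OF hm(3)]]
    have "c \<in> D (K ed p a x) b"
    proof (rule shift_su_in_D[OF o(1,3) _ _ _ _ f(3) L(2) M_K_in[OF n(1,2) True L(3)]])
      show "b \<in> M (K ed p a x) s" using o(4) hm by simp
      show "b \<in> M (K ed p a x) x" using o(6)[OF hm(4)] ne s(2) by simp
      show "K ed p a x u x t" using o(7)[OF e] tp ne by simp
      show "K ed p a x s u c" using c K_ed_out[OF x_swap_s[OF v pr hm(1) disjI2[OF hm(3)]]] by simp
    qed
    then have cb: "c \<in> D ed b" using stable_D[OF o(2) hm(2)] by simp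
    let ?e = "K ed p b x"
    note o' = token_swap[OF v p bC disjI2[OF hm(4)]]
    note f' = free_swap[OF v pr L(1) n(3) x_swap(1)[OF v pr bC disjI2[OF hm(4)]] bb]
    have pe: "pcol ?e" by (rule valid_pcol[OF o'(1)])
    have pr': "p \<in> M ?e r" using o'(3) by simp
    have m: "p \<in> M ?e x" "a \<in> M ?e x" "a \<in> M ?e ?w" "a \<in> M ?e s" "?e u x t" "?e s u c"
      using o'(6)[OF hm(4)] o'(6)[OF hm(3)] L(3) o'(4) hm o'(7)[OF e] tp ne s(2) c
        K_ed_out[OF x_swap_s[OF v pr hm(2) disjI2[OF hm(4)]]] by (simp_all add: M_K_other[OF n(1,3)])
    have aC': "a \<in> C ?e" by (rule M_s_C[OF m(4)])
    note w = hit_out[OF o'(1) pr' f'(3) m(3) aC']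
    note g = free_swap[OF o'(1) pr' f'(3) n(2) w ba]
    let ?f = "K ?e p a ?w"
    \<comment> \<open>Missing both colours, \<open>x\<close> is a component by itself.\<close>
    have "closed ?e p a {x}" using m(1,2) by (simp add: closed_def M_def)
    then have "kcomp ?e p a x \<subseteq> {x}" by (rule comp_min) simp
    moreover have "?w \<noteq> x" using chn_x[OF v ch hL] .
    ultimately have xw: "x \<notin> kcomp ?e p a ?w" using comp_sym[OF pe, of x p a ?w] by blast
    have sw: "s \<notin> kcomp ?e p a ?w" by (rule comp_disj[OF pe s_linked_r[OF o'(1) m(4) pr'] w])
    have "c \<in> D ?f a"
    proof (rule shift_su_in_D[OF g(1) _ _ _ _ _ g(3) L(2) M_K_in[OF n(1,2) comp_refl m(3)]])
      show "M ?f r = {p}" "a \<in> M ?f s" using stableD[OF g(2)] o'(3) m by simp_all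
      show "a \<in> M ?f x" using m M_K_out[OF n(1,2) xw] by simp
      show "?f u x t" using m tp ne by (simp add: K_ed_other)
      show "?f s u c" using m sw by (simp add: K_ed_out)
    qed
    then have "c \<in> D ed a" using stable_D[OF g(2) m(4)] stable_D[OF o'(2) hm(1)] by simp
    then show False using no_common_D[OF v s(1,2)] cb by blast
  qed
qed

lemma no_colouring: assumes "valid ed0" shows False
proof -
  obtain ed where v: "valid ed" and sx: "M ed s \<subseteq> M ed x" using tokens_to_roots[OF assms] by blast
  obtain p where p: "M ed r = {p}" using valid_r[OF v] by blast
  obtain a b where ab: "M ed s = {a, b}" "a \<noteq> b" using valid_s[OF v] by blast
  obtain t where t: "ed u x t" using valid_ex[OF v xu(5)] by blast
  note pc = valid_pcol[OF v]
  have pr: "p \<in> M ed r" "p < n" using p M_less by auto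
  have tn: "t < n" using pcolD(2)[OF pc t] .
  show False
  proof (cases "t \<in> C ed \<union> {p}")
    case True
    show False by (rule C_tokens_False[OF v p ab sx t True])
  next
    case False
    then have tC: "t \<notin> C ed" "t \<noteq> p" by auto
    have sw: False if k: "k \<noteq> a" "k \<noteq> b" "k \<noteq> p" "k \<noteq> t" "k < n" and z: "valid (K ed p k z)" "stable ed (K ed p k z)"
      and L: "free_chn (K ed p k z) L" "src L = t" "p \<in> M (K ed p k z) (fst (hd L))" for k z L
    proof (rule shift_tokens_False[OF z(1) _ _ ab(2) _ _ L])
      have ne: "p \<noteq> a" "p \<noteq> b" using nocol[OF v pr(1)] ab by auto
      show "M (K ed p k z) r = {p}" "M (K ed p k z) s = {a, b}" using stableD[OF z(2)] p ab by simp_all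
      then show "M (K ed p k z) s \<subseteq> M (K ed p k z) x" using sx ab k ne by (simp add: M_K_other[OF pr(2) k(5)])
      show "K ed p k z u x t" using t k tC by (simp add: K_ed_other)
    qed
    show False
    proof (rule greedy[OF v tn tC(1)])
      show "t \<notin> M ed r" using p tC by simp
    next
      fix L k assume L: "free_chn ed L" "src L = t" and k: "k \<in> M ed (fst (hd L))" "k \<in> C ed \<or> k \<in> M ed r"
      show False
      proof (cases "k = p")
        case True
        then show False using shift_tokens_False[OF v p ab sx t L] k by blast
      next
        case kp: False
        then have kC: "k \<in> C ed" using k p by simp
        show False
        proof (cases "k = a \<or> k = b")
          case True
          then show False
            using root_hit_False[OF v p ab sx t L] root_hit_False[OF v p _ ab(2)[symmetric] sx t L] ab(1) k(1) by (metis insert_commute)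
        next
          case False
          have kn: "k < n" and kt: "k \<noteq> t" using k M_less kC tC by blast+
          have "\<forall>y\<in>set (butlast L). snd y \<noteq> k" using free_chnD(2)[OF L(1)] kC in_set_butlastD by fast
          note ps = free_swap[OF v pr(1) L(1) kn hit_out[OF v pr(1) L(1) k(1) kC] this]
          show False
            by (rule sw[OF _ _ kp kt kn ps L(2) M_K_in[OF pr(2) kn comp_refl k(1)]]) (use False in auto)
        qed
      qed
    next
      fix L assume L: "free_chn ed L" "src L = t" "t \<in> M ed (fst (hd L))"
      have sym: "M ed s = {b, a}" using ab by auto
      show False
      proof (rule su_ex[OF v])
        fix c assume c: "ed s u c"
        show False
          by (rule no_common_D[OF v ab cycle_su_in_D[OF v p ab sx t c L] cycle_su_in_D[OF v p sym ab(2)[symmetric] sx t c L]])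
      qed
    next
      fix A B k assume L: "free_chn ed (A @ B)" "src (A @ B) = t" "A \<noteq> []" "B \<noteq> []" "src A = k"
        "k \<in> M ed (fst (hd B))" "k \<in> M ed (fst (hd A))" "k \<notin> C ed" "k \<notin> M ed r"
      have ka: "k \<noteq> a" "k \<noteq> b" using L(8) M_s_C ab by blast+
      show False
      proof (rule rho_free[OF v pr(1) L(1,3-7)])
        fix z L' assume h: "z \<notin> kcomp ed p k r" "free_chn (K ed p k z) L'" "src L' = src (A @ B)"
          "p \<in> M (K ed p k z) (fst (hd L'))" "valid (K ed p k z)" "stable ed (K ed p k z)" "k \<noteq> src (A @ B)" "p \<noteq> k" "k < n"
        show False
          by (rule sw[OF ka _ _ h(9,5,6,2) _ h(4)]) (use h L(2) in auto)
      qed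
    qed
  qed
qed

end

section \<open>Colourings of set-based graphs\<close>

lemma doubleton_nbhd: "{w. {v, w} \<in> E} = nbhd E v"
  unfolding nbhd_def by (simp add: insert_commute)

theorem theorem1p5:
  fixes V :: "'a set" and E :: "'a set set" and \<Delta> :: nat and r s :: 'a
  assumes "simple_graph V E"
    and "class2 V E"
    and "\<Delta> = max_degree V E"
    and "r \<in> V"
    and "light V E r"
    and "degree E r = \<Delta>"
    and "s \<in> nbhd_deg E (\<Delta> - 1) r"
    and "critical_edge E {r, s}"
  shows "\<forall>x \<in> V - closed_nbhd E r.
           int (degree E x) \<le> int \<Delta> - 3 \<longrightarrow>
           nbhd E x \<inter> nbhd E s \<subseteq> nbhd E r - nbhd_deg E \<Delta> r"
proof (intro ballI impI subsetI, rule ccontr)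
  fix x u assume x: "x \<in> V - closed_nbhd E r" and dx: "int (degree E x) \<le> int \<Delta> - 3"
    and u: "u \<in> nbhd E x \<inter> nbhd E s"
  have fV: "finite V" and E: "\<forall>e\<in>E. e \<subseteq> V \<and> card e = 2" using assms(1) by (auto simp: simple_graph_def)
  have inV: "v \<in> V \<and> w \<in> V \<and> v \<noteq> w" if "{v, w} \<in> E" for v w
    using bspec[OF E that] by (auto simp: card_2_iff doubleton_eq_iff)
  have "E \<subseteq> Pow V" using E by blast
  then have fE: "finite E" using fV finite_subset by blast
  have fN: "finite (nbhd E v)" for v
    by (rule finite_subset[OF _ fV]) (use inV in \<open>auto simp: nbhd_def\<close>)
  have rsE: "{r, s} \<in> E" and ds: "degree E s = \<Delta> - 1"
    using assms(7,8) by (auto simp: nbhd_deg_def critical_edge_def)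
  have chi: "chromatic_index E = \<Delta> + 1" using assms(2,3) by (simp add: class2_def)
  have rs: "r \<noteq> s" "s \<in> V" using inV[OF rsE] by auto
  have xr: "x \<noteq> r" "{r, x} \<notin> E" using x by (auto simp: closed_nbhd_def nbhd_def insert_commute)
  then have xs: "x \<noteq> s" using rsE by blast
  have ux: "{u, x} \<in> E" and us: "{s, u} \<in> E" using u by (auto simp: nbhd_def insert_commute)
  then have ur: "u \<noteq> r" using xr by blast
  let ?F = "E - {{r, s}}"
  let ?G = "\<lambda>v w. {v, w} \<in> ?F"
  interpret kempe \<Delta> V by unfold_locales (rule fV)
  have N: "{w. ?G v w} = (if v = r then nbhd E r - {s} else if v = s then nbhd E s - {r} else nbhd E v)" for v
    unfolding doubleton_nbhd[symmetric] using rs by (auto simp: doubleton_eq_iff)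
  have sr: "s \<in> nbhd E r" "r \<in> nbhd E s" using rsE by (auto simp: nbhd_def insert_commute)
  have cM: "card (M ed v) + card {w. ?G v w} = \<Delta>" if "pcol ed" "\<And>v w. (\<exists>c. ed v w c) \<longleftrightarrow> ?G v w" for ed v
    by (rule card_M[OF that])
  interpret target \<Delta> V ?G r s u x
  proof unfold_locales
    show "r \<noteq> s" "r \<in> V" "s \<in> V" "\<not> ?G r s" "\<not> ?G s r" using rs assms(4) by (auto simp: insert_commute)
    show "u \<noteq> r" "x \<noteq> r" "x \<noteq> s" "\<not> ?G r x" using ur xr xs by auto
    show "?G s u" "?G u x" using ux us ur xr xs by (auto simp: doubleton_eq_iff)
  next
    fix ed assume h: "pcol ed" "\<And>v w. (\<exists>c. ed v w c) \<longleftrightarrow> ?G v w \<or> {v, w} = {r, s}"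
    have "(\<exists>c. ed v w c) \<longleftrightarrow> {v, w} \<in> E" for v w unfolding h(2) using rsE by auto
    then obtain c where "proper_edge_colouring E \<Delta> c" using colouring_of_col[OF h(1), of E] E by blast
    then have "chromatic_index E \<le> \<Delta>" unfolding chromatic_index_def by (intro Least_le) blast
    then show False using chi by simp
  next
    fix ed assume h: "pcol ed" "\<And>v w. (\<exists>c. ed v w c) \<longleftrightarrow> ?G v w"
    note c = cM[OF h]
    \<comment> \<open>As \<open>r\<close> and \<open>s\<close> are adjacent, both degrees are
      positive, so truncated subtraction does not falsify the counts \<open>\<Delta> - 1\<close> and
      \<open>\<Delta> - 2\<close>.\<close>
    have pos: "card (nbhd E r) > 0" "card (nbhd E s) > 0" using fN sr by (auto simp: card_gt_0_iff)
    have "card {w. ?G r w} = \<Delta> - 1" unfolding N using sr assms(6) by (simp add: degree_def)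
    then have "card (M ed r) = 1" using c[of r] pos assms(6) by (simp add: degree_def)
    then show "\<exists>p. M ed r = {p}" by (auto simp: card_1_singleton_iff)
    have "card {w. ?G s w} = \<Delta> - 2" unfolding N using sr ds rs by (simp add: degree_def)
    then have "card (M ed s) = 2" using c[of s] pos ds by (simp add: degree_def)
    then show "\<exists>a b. a \<noteq> b \<and> M ed s = {a, b}" by (auto simp: card_2_iff)
    show "3 \<le> card (M ed x)" using c[of x] dx xr xs unfolding N by (simp add: degree_def)
    have "{v. ?G r v \<and> M ed v = {}} \<subseteq> nbhd_deg E \<Delta> r"
    proof
      fix v assume "v \<in> {v. ?G r v \<and> M ed v = {}}"
      then have v: "{r, v} \<in> E" "v \<noteq> s" "M ed v = {}" by auto
      then have "v \<noteq> r" using inV by blast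
      then have "degree E v = \<Delta>" using c[of v] v N[of v] by (simp add: degree_def)
      then show "v \<in> nbhd_deg E \<Delta> r" using v by (simp add: nbhd_deg_def nbhd_def insert_commute)
    qed
    moreover have "finite (nbhd_deg E \<Delta> r)" using fN[of r] by (simp add: nbhd_deg_def)
    ultimately have "card {v. ?G r v \<and> M ed v = {}} \<le> card (nbhd_deg E \<Delta> r)" by (rule card_mono[rotated])
    then show "card {v. ?G r v \<and> M ed v = {}} \<le> 2" using assms(3,5) by (simp add: light_def)
  qed
  have "chromatic_index ?F \<le> \<Delta>" using assms(8) chi by (simp add: critical_edge_def)
  moreover obtain c where "proper_edge_colouring ?F (chromatic_index ?F) c"
  proof -
    have "\<exists>k c. proper_edge_colouring ?F k c" by (rule proper_edge_colouring_exists) (use fE in simp)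
    then have "\<exists>c. proper_edge_colouring ?F (chromatic_index ?F) c"
      unfolding chromatic_index_def by (rule LeastI_ex)
    then show thesis using that by blast
  qed
  ultimately have "pcol (\<lambda>v w j. ?G v w \<and> c {v, w} = j)" using col_of_colouring[of ?F] E by blast
  then have "valid (\<lambda>v w j. ?G v w \<and> c {v, w} = j)" unfolding valid_def by blast
  then show False by (rule no_colouring)
qed

end
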